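(* Let $\Omega\subset\mathbb{R}^d$ be a compact Lipschitz region and let $\Phi$ be a continuous kernel whose native space satisfies $\mathcal{N}_\Phi(\Omega)\simeq W_2^\tau(\Omega)$ (equality as sets with equivalent norms) for some $\tau>d/2$. Let $(X_n)_{n\in\mathbb{N}}$ be a nested sequence ($X_n\subset X_{n+1}$) of finite, quasi-uniformly distributed point sets in $\Omega$ with geometrically decaying fill distance, i.e. there are constants $c_0,c_0'>0$ and $a\in(0,1)$ with $$c_0'a^n\le q_{X_n}\le h_{X_n,\Omega}\le c_0a^n\qquad\text{for all }n\in\mathbb{N}.$$ Let $f\in W_2^\beta(\Omega)$, where $d/2<\beta\le\tau$. Then there are a constant $C>0$ independent of $n$ and $f$, and a constant $C'>0$ independent of $n$ (but possibly depending on $f$), such that for all $n\in\mathbb{N}$ $$\|I_{X_n}f-I_{X_{n+1}}f\|_{\mathcal{N}_\Phi(\Omega)}\le C\,h_{X_n,\Omega}^{\beta-\tau}\,\|f\|_{W_2^\beta(\Omega)}$$ and $$\|I_{X_n}f\|_{\mathcal{N}_\Phi(\Omega)}\le C'\,h_{X_n,\Omega}^{\beta-\tau}.$$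
   Context: Kernels: $\Phi(\mathbf{x})=\phi(\|\mathbf{x}\|_2)$ is a radial, strictly positive definite function on $\mathbb{R}^d$, i.e. $\sum_{i,j}\alpha_i\alpha_j\Phi(\boldsymbol\xi_i-\boldsymbol\xi_j)>0$ for all pairwise distinct points $\boldsymbol\xi_1,\dots,\boldsymbol\xi_n$ and all $\boldsymbol\alpha\in\mathbb{R}^n\setminus\{0\}$; the associated kernel is $K(\mathbf{x},\mathbf{y})=\Phi(\mathbf{x}-\mathbf{y})$, and it is identified with $\Phi$. The native space $\mathcal{N}_\Phi(\Omega)$ is the reproducing kernel Hilbert space of $K$ on $\Omega$, i.e. the completion of $\operatorname{span}\{\Phi(\cdot-\mathbf{x}):\mathbf{x}\in\Omega\}$ in the norm induced by $\langle\Phi(\cdot-\mathbf{x}),\Phi(\cdot-\mathbf{y})\rangle=\Phi(\mathbf{x}-\mathbf{y})$. Interpolation: for finite $X=\{\mathbf{x}_1,\dots,\mathbf{x}_N\}\subset\Omega$ and continuous $f$ on $\Omega$, $I_Xf$ is the unique element of $\mathcal{N}_\Phi(X):=\operatorname{span}\{\Phi(\cdot-\mathbf{x}):\mathbf{x}\in X\}$ with $(I_Xf)(\mathbf{x}_i)=f(\mathbf{x}_i)$ for all $i$ (functions in $W_2^\beta(\Omega)$ with $\beta>d/2$ are identified with their continuous representatives). Point set geometry: the fill distance is $h_{X,\Omega}=\sup_{\mathbf{x}\in\Omega}\min_{\mathbf{x}_j\in X}\|\mathbf{x}-\mathbf{x}_j\|_2$ and the separation radius is $q_X=\frac12\min_{\mathbf{x}_i\ne\mathbf{x}_j\in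 X}\|\mathbf{x}_i-\mathbf{x}_j\|_2$. A sequence $(X_n)$ is quasi-uniform if $\sup_n h_{X_n,\Omega}/q_{X_n}<\infty$. $W_2^s(\Omega)=H^s(\Omega)$ is the $L_2$-based Sobolev space of possibly fractional order $s$. *)

theory Defs
  imports "HOL-Analysis.Analysis"
begin

section \<open>Compact Lipschitz regions\<close>

text \<open>
  Near every boundary point the set is the closed epigraph of a Lipschitz function over the
  hyperplane orthogonal to some unit vector \<open>u\<close>. In particular such a set is the closure of its
  interior. In dimension one the hyperplane is \<open>{0}\<close> and the set is locally a closed half line.
  Connectedness is not imposed.
\<close>

definition compact_lipschitz_region :: "'a::euclidean_space set \<Rightarrow> bool" where
  "compact_lipschitz_region \<Omega> \<longleftrightarrow> compact \<Omega> \<and> \<Omega> \<noteq> {} \<and>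
     (\<forall>p\<in>frontier \<Omega>. \<exists>r>0. \<exists>u L \<gamma>. norm u = 1 \<and> L-lipschitz_on {y. y \<bullet> u = 0} \<gamma> \<and>
        (\<forall>x\<in>ball p r. x \<in> \<Omega> \<longleftrightarrow> \<gamma> (x - (x \<bullet> u) *\<^sub>R u) \<le> x \<bullet> u))"

section \<open>Sobolev spaces of fractional order\<close>

definition square_integrable :: "('a::euclidean_space \<Rightarrow> complex) \<Rightarrow> bool" where
  "square_integrable F \<longleftrightarrow>
     F \<in> borel_measurable lborel \<and> integrable lborel (\<lambda>x. (norm (F x))\<^sup>2)"

definition truncated_inverse_fourier ::
    "real \<Rightarrow> ('a::euclidean_space \<Rightarrow> complex) \<Rightarrow> 'a \<Rightarrow> complex" where
  "truncated_inverse_fourier R g x =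
     (2 * pi) powr (- (real DIM('a) / 2)) *\<^sub>R (LINT \<omega>:cball 0 R|lborel. cis (x \<bullet> \<omega>) * g \<omega>)"

text \<open>
  \<open>F\<close> is the inverse Fourier-Plancherel transform of \<open>g\<close> (equivalently, \<open>g\<close> is the Fourier transform
  of \<open>F\<close>), with the unitary normalisation: the truncated inverse Fourier integrals of \<open>g\<close> converge
  to \<open>F\<close> in the mean. The integrals over balls exist because \<open>g\<close> is locally integrable.
\<close>

definition has_fourier_transform ::
    "('a::euclidean_space \<Rightarrow> complex) \<Rightarrow> ('a \<Rightarrow> complex) \<Rightarrow> bool" where
  "has_fourier_transform F g \<longleftrightarrow> square_integrable F \<and> square_integrable g \<and>
     ((\<lambda>R. \<integral>\<^sup>+x. ennreal ((norm (truncated_inverse_fourier R g x - F x))\<^sup>2) \<partial>lborel)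
        \<longlongrightarrow> 0) at_top"

text \<open>
  The Bessel potential norm \<open>(\<integral> (1 + |\<omega>|\<^sup>2)\<^sup>s |g \<omega>|\<^sup>2 d\<omega>)\<^sup>1\<^sup>/\<^sup>2\<close>, as a function of the Fourier
  transform \<open>g\<close>. Orders \<open>s \<ge> 0\<close> are intended.
\<close>

definition bessel_finite :: "real \<Rightarrow> ('a::euclidean_space \<Rightarrow> complex) \<Rightarrow> bool" where
  "bessel_finite s g \<longleftrightarrow> integrable lborel (\<lambda>\<omega>. (1 + (norm \<omega>)\<^sup>2) powr s * (norm (g \<omega>))\<^sup>2)"

definition bessel_norm :: "real \<Rightarrow> ('a::euclidean_space \<Rightarrow> complex) \<Rightarrow> real" where
  "bessel_norm s g = sqrt (LINT \<omega>|lborel. (1 + (norm \<omega>)\<^sup>2) powr s * (norm (g \<omega>))\<^sup>2)"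

text \<open>
  \<open>W\<^sub>2\<^sup>s(\<Omega>)\<close> consists of the restrictions to \<open>\<Omega>\<close> of elements \<open>F\<close> of \<open>W\<^sub>2\<^sup>s\<close> on the whole space, with
  the quotient norm. Its elements are represented by functions on the whole type of which only the
  values on \<open>\<Omega>\<close>, up to null sets, matter. Only real-valued elements are considered; allowing
  complex-valued extensions changes neither the space nor the norm, since passing to the real part
  does not increase the Bessel potential norm.
\<close>

definition sobolev_extension ::
    "real \<Rightarrow> 'a::euclidean_space set \<Rightarrow> ('a \<Rightarrow> real) \<Rightarrow> ('a \<Rightarrow> complex) \<Rightarrow> ('a \<Rightarrow> complex) \<Rightarrow> bool" where
  "sobolev_extension s \<Omega> f F g \<longleftrightarrow> has_fourier_transform F g \<and> bessel_finite s g \<and>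
     (AE x in lborel. x \<in> \<Omega> \<longrightarrow> F x = complex_of_real (f x))"

definition sobolev_space :: "real \<Rightarrow> 'a::euclidean_space set \<Rightarrow> ('a \<Rightarrow> real) set" where
  "sobolev_space s \<Omega> = {f. \<exists>F g. sobolev_extension s \<Omega> f F g}"

definition sobolev_norm :: "real \<Rightarrow> 'a::euclidean_space set \<Rightarrow> ('a \<Rightarrow> real) \<Rightarrow> real" where
  "sobolev_norm s \<Omega> f = Inf {bessel_norm s g | F g. sobolev_extension s \<Omega> f F g}"

text \<open>The continuous representatives; for \<open>s > d/2\<close> every class has one.\<close>

definition continuous_sobolev_space ::
    "real \<Rightarrow> 'a::euclidean_space set \<Rightarrow> ('a \<Rightarrow> real) set" where
  "continuous_sobolev_space s \<Omega> = {f \<in> sobolev_space s \<Omega>. continuous_on \<Omega> f}"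

section \<open>Kernels, native spaces and interpolation\<close>

definition radial :: "('a::euclidean_space \<Rightarrow> real) \<Rightarrow> bool" where
  "radial \<Phi> \<longleftrightarrow> (\<exists>\<phi>. \<forall>x. \<Phi> x = \<phi> (norm x))"

definition strictly_positive_definite :: "('a::euclidean_space \<Rightarrow> real) \<Rightarrow> bool" where
  "strictly_positive_definite \<Phi> \<longleftrightarrow>
     (\<forall>S \<alpha>. finite S \<and> (\<exists>\<xi>\<in>S. \<alpha> \<xi> \<noteq> 0) \<longrightarrow>
        (\<Sum>\<xi>\<in>S. \<Sum>\<eta>\<in>S. \<alpha> \<xi> * \<alpha> \<eta> * \<Phi> (\<xi> - \<eta>)) > 0)"

text \<open>
  An element of the span of the translates \<open>\<Phi>(\<cdot> - y)\<close>, \<open>y \<in> \<Omega>\<close>, is encoded by its coefficient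
  function \<open>c\<close>, which has finite support in \<open>\<Omega>\<close>. For strictly positive definite \<open>\<Phi>\<close> the coefficients
  are determined by the element.
\<close>

definition kernel_coeffs :: "'a::euclidean_space set \<Rightarrow> ('a \<Rightarrow> real) set" where
  "kernel_coeffs \<Omega> = {c. finite {y. c y \<noteq> 0} \<and> {y. c y \<noteq> 0} \<subseteq> \<Omega>}"

definition kernel_sum :: "('a::euclidean_space \<Rightarrow> real) \<Rightarrow> ('a \<Rightarrow> real) \<Rightarrow> 'a \<Rightarrow> real" where
  "kernel_sum \<Phi> c x = (\<Sum>y | c y \<noteq> 0. c y * \<Phi> (x - y))"

definition kernel_norm :: "('a::euclidean_space \<Rightarrow> real) \<Rightarrow> ('a \<Rightarrow> real) \<Rightarrow> real" where
  "kernel_norm \<Phi> c = sqrt (\<Sum>y | c y \<noteq> 0. \<Sum>z | c z \<noteq> 0. c y * c z * \<Phi> (y - z))"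

text \<open>
  The completion of the span, realised as a space of functions on \<open>\<Omega>\<close>: a Cauchy sequence in the
  norm of the span converges pointwise on \<open>\<Omega>\<close>, its class is identified with the pointwise limit, and
  the norm of the class is the limit of the norms. As above, functions on the whole type are used of
  which only the values on \<open>\<Omega>\<close> matter.
\<close>

definition native_approximation ::
    "('a::euclidean_space \<Rightarrow> real) \<Rightarrow> 'a set \<Rightarrow> ('a \<Rightarrow> real) \<Rightarrow> (nat \<Rightarrow> 'a \<Rightarrow> real) \<Rightarrow> bool" where
  "native_approximation \<Phi> \<Omega> f c \<longleftrightarrow> (\<forall>n. c n \<in> kernel_coeffs \<Omega>) \<and>
     (\<forall>e>0. \<exists>M. \<forall>m\<ge>M. \<forall>n\<ge>M. kernel_norm \<Phi> (\<lambda>y. c m y - c n y) < e) \<and>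
     (\<forall>x\<in>\<Omega>. (\<lambda>n. kernel_sum \<Phi> (c n) x) \<longlonglongrightarrow> f x)"

definition native_space :: "('a::euclidean_space \<Rightarrow> real) \<Rightarrow> 'a set \<Rightarrow> ('a \<Rightarrow> real) set" where
  "native_space \<Phi> \<Omega> = {f. \<exists>c. native_approximation \<Phi> \<Omega> f c}"

definition native_norm :: "('a::euclidean_space \<Rightarrow> real) \<Rightarrow> 'a set \<Rightarrow> ('a \<Rightarrow> real) \<Rightarrow> real" where
  "native_norm \<Phi> \<Omega> f =
     (THE r. \<exists>c. native_approximation \<Phi> \<Omega> f c \<and> (\<lambda>n. kernel_norm \<Phi> (c n)) \<longlonglongrightarrow> r)"

definition native_space_equivalent_sobolev ::
    "('a::euclidean_space \<Rightarrow> real) \<Rightarrow> 'a set \<Rightarrow> real \<Rightarrow> bool" where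
  "native_space_equivalent_sobolev \<Phi> \<Omega> \<tau> \<longleftrightarrow>
     native_space \<Phi> \<Omega> = continuous_sobolev_space \<tau> \<Omega> \<and>
     (\<exists>A>0. \<exists>B>0. \<forall>f\<in>native_space \<Phi> \<Omega>.
        A * sobolev_norm \<tau> \<Omega> f \<le> native_norm \<Phi> \<Omega> f \<and>
        native_norm \<Phi> \<Omega> f \<le> B * sobolev_norm \<tau> \<Omega> f)"

definition kernel_span :: "('a::euclidean_space \<Rightarrow> real) \<Rightarrow> 'a set \<Rightarrow> ('a \<Rightarrow> real) set" where
  "kernel_span \<Phi> X = {kernel_sum \<Phi> c | c. c \<in> kernel_coeffs X}"

definition interpolant ::
    "('a::euclidean_space \<Rightarrow> real) \<Rightarrow> 'a set \<Rightarrow> ('a \<Rightarrow> real) \<Rightarrow> 'a \<Rightarrow> real" where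
  "interpolant \<Phi> X f = (THE s. s \<in> kernel_span \<Phi> X \<and> (\<forall>x\<in>X. s x = f x))"

section \<open>Geometry of point sets\<close>

definition fill_distance :: "'a::euclidean_space set \<Rightarrow> 'a set \<Rightarrow> real" where
  "fill_distance X \<Omega> = (SUP x\<in>\<Omega>. Min ((\<lambda>y. dist x y) ` X))"

text \<open>
  The separation radius is extended real, with value \<open>\<infinity>\<close> for sets of fewer than two points. An upper
  bound by the (real) fill distance therefore entails that there are at least two points.
\<close>

definition separation_radius :: "'a::euclidean_space set \<Rightarrow> ereal" where
  "separation_radius X = (INF (x, y)\<in>{(x, y). x \<in> X \<and> y \<in> X \<and> x \<noteq> y}. ereal (dist x y / 2))"

definition quasi_uniform :: "(nat \<Rightarrow> 'a::euclidean_space set) \<Rightarrow> 'a set \<Rightarrow> bool" where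
  "quasi_uniform X \<Omega> \<longleftrightarrow>
     (SUP n. ereal (fill_distance (X n) \<Omega>) / separation_radius (X n)) < \<infinity>"

end

theory Submission
  imports Defs "HOL-Probability.Characteristic_Functions" "HOL-Analysis.Ball_Volume"
begin

text \<open>
  For the interpolant \<open>s = I\<^sub>X f = \<Sum>\<^sub>y c\<^sub>y \<Phi>(\<cdot> - y)\<close> put \<open>P(\<omega>) = \<Sum>\<^sub>y c\<^sub>y e\<^sup>i\<^sup>y\<^sup>\<omega>\<close> and
  \<open>D\<^sub>t = \<integral> |P|\<^sup>2 (1 + |\<omega>|\<^sup>2)\<^sup>-\<^sup>t\<close>. Since \<open>\<parallel>s\<parallel>\<^sup>2 = \<Sum>\<^sub>y c\<^sub>y f(y)\<close> is, up to a constant, \<open>\<integral> P g\<close> for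
  the Fourier transform \<open>g\<close> of any extension of \<open>f\<close>, Cauchy-Schwarz bounds it by
  \<open>\<parallel>f\<parallel>\<^sub>\<beta> D\<^sub>\<beta>\<^sup>1\<^sup>/\<^sup>2\<close>. Testing \<open>s\<close> against the function with Fourier transform
  \<open>cnj P (1 + |\<omega>|\<^sup>2)\<^sup>-\<^sup>\<tau>\<close>, which lies in the native space, gives \<open>D\<^sub>\<tau>\<^sup>1\<^sup>/\<^sup>2 \<le> C \<parallel>s\<parallel>\<close>. It remains to
  compare the two dual norms: \<open>D\<^sub>\<beta> \<le> C q\<^sup>-\<^sup>2\<^sup>(\<^sup>\<tau>\<^sup>-\<^sup>\<beta>\<^sup>) D\<^sub>\<tau>\<close> whenever the points are \<open>2q\<close>-separated.
  At frequencies up to \<open>\<kappa>/q\<close> this holds pointwise; the higher ones carry at most a constant times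
  \<open>(\<kappa>/q)\<^sup>d\<^sup>-\<^sup>2\<^sup>\<beta> \<Sum>|c\<^sub>y|\<^sup>2\<close>, which the right-hand side dominates because Gaussian averages of \<open>|P|\<^sup>2\<close> at that scale
  are comparable to \<open>\<Sum>|c\<^sub>y|\<^sup>2\<close>. The bound on differences follows from the triangle inequality.
\<close>

section \<open>Fourier integrals of Gaussians\<close>

text \<open>Moreover \<Phi> is known only through a norm equivalence on \<Omega>, so there is no
  decay of its Fourier transform to work with, and its norm is reached only through test functions.
  The two dual estimates close on themselves: the squared norm of the interpolant is bounded by a
  quantity containing that norm once, and one factor cancels. The exponent of the frequency scale s,
  of order 1/q, is decided at high frequencies: the weight of order -\<beta> contributes s^(-2
  \<beta>) there, and fitting a Gaussian of width s below the weight of order -\<tau> costs s^(2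
  \<tau>); the volume factor s^d occurs in both estimates and drops out. Separation of the points
  serves to make a Gaussian matrix diagonally dominant. All orders exceed d/2, so the transforms of
  Sobolev functions are integrable, and a Plancherel inequality for integrable functions can replace
  the full L2 theory.\<close>

lemma nn_integral_lborel_affine:
  fixes f :: "'a::euclidean_space \<Rightarrow> ennreal"
  assumes [measurable]: "f \<in> borel_measurable borel" and c: "c \<noteq> 0"
  shows "(\<integral>\<^sup>+x. f x \<partial>lborel) = ennreal (\<bar>c\<bar> ^ DIM('a)) * (\<integral>\<^sup>+x. f (t + c *\<^sub>R x) \<partial>lborel)"
  by (subst lborel_affine[OF c, of t])
     (simp add: nn_integral_density nn_integral_distr nn_integral_cmult)

lemma lborel_integrable_affine:
  fixes f :: "'a::euclidean_space \<Rightarrow> 'b :: {banach, second_countable_topology}"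
  assumes f: "integrable lborel f" and c: "c \<noteq> 0"
  shows "integrable lborel (\<lambda>x. f (t + c *\<^sub>R x))"
  using f f[THEN borel_measurable_integrable] c unfolding integrable_iff_bounded
  by (subst (asm) nn_integral_lborel_affine[where c=c and t=t])
     (auto simp: ennreal_mult_less_top)

lemma lborel_integrable_affine_iff:
  fixes f :: "'a::euclidean_space \<Rightarrow> 'b :: {banach, second_countable_topology}"
  assumes c: "c \<noteq> 0"
  shows "integrable lborel (\<lambda>x. f (t + c *\<^sub>R x)) \<longleftrightarrow> integrable lborel f"
  using lborel_integrable_affine[of f c t]
    lborel_integrable_affine[of "\<lambda>x. f (t + c *\<^sub>R x)" "1/c" "- (1/c) *\<^sub>R t"] c
  by (auto simp: algebra_simps)

lemma lborel_integral_affine: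
  fixes f :: "'a::euclidean_space \<Rightarrow> 'b :: {banach, second_countable_topology}"
  assumes c: "c \<noteq> 0"
  shows "(LINT x|lborel. f x) = \<bar>c\<bar> ^ DIM('a) *\<^sub>R (LINT x|lborel. f (t + c *\<^sub>R x))"
proof cases
  assume f[measurable]: "integrable lborel f"
  then show ?thesis
    using c f f[THEN borel_measurable_integrable] lborel_integrable_affine[OF f c, of t]
    by (subst lborel_affine[OF c, of t])
       (simp add: integral_density integral_distr)
next
  assume "\<not> integrable lborel f" with c show ?thesis
    by (simp add: lborel_integrable_affine_iff not_integrable_integral_eq)
qed

text \<open>Lebesgue measure is the image of the product of its one-dimensional copies under
  \<open>?T\<close>, so a product of functions of single coordinates integrates factor by
  factor.\<close>

lemma has_bochner_integral_lborel_prod: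
  fixes f :: "'a::euclidean_space \<Rightarrow> real \<Rightarrow> complex"
  assumes f: "\<And>b. b \<in> Basis \<Longrightarrow> integrable lborel (f b)"
  shows "has_bochner_integral lborel (\<lambda>x. \<Prod>b\<in>Basis. f b (x \<bullet> b)) (\<Prod>b\<in>Basis. LINT x|lborel. f b x)"
proof -
  interpret product_sigma_finite "\<lambda>_::'a. lborel :: real measure" ..
  let ?T = "\<lambda>g. \<Sum>b\<in>Basis. g b *\<^sub>R (b::'a)"
  have T[measurable]: "?T \<in> (\<Pi>\<^sub>M b\<in>Basis. lborel) \<rightarrow>\<^sub>M borel"
    by measurable
  have [measurable]: "(\<lambda>x. \<Prod>b\<in>Basis. f b (x \<bullet> b)) \<in> borel_measurable borel"
    using f by (auto intro!: borel_measurable_prod measurable_compose[OF _ borel_measurable_integrable[OF f, simplified]])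
  have eq: "(\<Prod>b\<in>Basis. f b (?T g \<bullet> b)) = (\<Prod>b\<in>Basis. f b (g b))" for g
    by (intro prod.cong) auto
  have 1: "integrable (\<Pi>\<^sub>M b\<in>Basis. lborel) (\<lambda>g. \<Prod>b\<in>Basis. f b (g b))"
    by (rule product_integrable_prod) (auto intro: f)
  have 2: "(LINT g|(\<Pi>\<^sub>M b\<in>Basis. lborel). (\<Prod>b\<in>Basis. f b (g b))) = (\<Prod>b\<in>Basis. LINT x|lborel. f b x)"
    by (rule product_integral_prod) (auto intro: f)
  have L: "(lborel :: 'a measure) = distr (\<Pi>\<^sub>M b\<in>Basis. lborel) borel ?T"
    by (rule lborel_eq)
  show ?thesis
    unfolding has_bochner_integral_iff L
    using 1 2 by (auto simp: integrable_distr_eq integral_distr eq)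
qed

text \<open>The characteristic function of the standard normal distribution, with the density's
  factor \<open>1 / sqrt (2 * pi)\<close> removed.\<close>

lemma fourier_std_gaussian_real:
  "has_bochner_integral lborel (\<lambda>x. cis (t * x) * of_real (exp (- x\<^sup>2 / 2)))
     (of_real (sqrt (2 * pi) * exp (- t\<^sup>2 / 2)) :: complex)"
proof -
  define F :: "real \<Rightarrow> complex" where "F x = std_normal_density x *\<^sub>R iexp (t * x)" for x
  have *: "(\<lambda>x. cis (t * x) * of_real (exp (- x\<^sup>2 / 2))) = (\<lambda>x. complex_of_real (sqrt (2 * pi)) * F x)"
    by (rule ext) (simp add: F_def std_normal_density_def cis_conv_exp scaleR_conv_of_real)
  have int: "integrable lborel F"
    unfolding F_def[abs_def] by (rule Bochner_Integration.integrable_bound[of _ std_normal_density]) auto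
  have "(LINT x|lborel. F x) = char std_normal_distribution t"
    unfolding char_def F_def by (subst integral_density) auto
  also have "\<dots> = complex_of_real (exp (- t\<^sup>2 / 2))"
    by (simp add: char_std_normal_distribution)
  finally have "has_bochner_integral lborel F (complex_of_real (exp (- t\<^sup>2 / 2)))"
    using int by (simp add: has_bochner_integral_iff)
  from has_bochner_integral_mult_right[OF this, of "complex_of_real (sqrt (2 * pi))"]
  show ?thesis unfolding * of_real_mult by blast
qed

text \<open>Unnormalised, with value 1 at the origin: the matrices with entries
  \<open>gauss (1/s) (y - z)\<close> below then have unit diagonal.\<close>

definition gauss :: "real \<Rightarrow> 'a::euclidean_space \<Rightarrow> real" where
  "gauss s x = exp (- (norm x)\<^sup>2 / (2 * s\<^sup>2))"

lemma gauss_pos [simp]: "gauss s x > 0" and gauss_nonneg [simp]: "gauss s x \<ge> 0"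
  by (simp_all add: gauss_def)

lemma gauss_measurable [measurable]: "gauss s \<in> borel_measurable borel"
  by (auto simp: gauss_def[abs_def])

lemma gauss_scale: "c \<noteq> 0 \<Longrightarrow> gauss s (c *\<^sub>R x) = gauss (s / c) x"
  by (simp add: gauss_def power_mult_distrib power_divide mult_ac)

text \<open>For width 1 both the Gaussian and the character are products over the coordinates.
  Rescaling the frequency by \<open>1/s\<close> trades the width \<open>s\<close> for the value of
  the width-1 transform at \<open>s *\<^sub>R x\<close>.\<close>

lemma has_fourier_integral_gauss:
  fixes x :: "'a::euclidean_space"
  assumes s: "s > 0"
  shows "has_bochner_integral lborel (\<lambda>\<omega>. cis (x \<bullet> \<omega>) * of_real (gauss s \<omega>))
    (of_real ((sqrt (2 * pi) * s) ^ DIM('a) * gauss (1 / s) x))"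
proof -
  define h where "h y \<omega> = cis (y \<bullet> \<omega>) * of_real (gauss 1 \<omega>)" for y \<omega> :: 'a
  define e :: "real \<Rightarrow> real" where "e t = exp (- t\<^sup>2 / 2)" for t
  have nrm: "(norm y)\<^sup>2 = (\<Sum>b\<in>Basis. (y \<bullet> b)\<^sup>2)" for y :: 'a
    unfolding power2_norm_eq_inner euclidean_inner[of y y] by (simp add: power2_eq_square)
  have g1: "gauss 1 y = (\<Prod>b\<in>Basis. e (y \<bullet> b))" for y :: 'a
    by (simp add: gauss_def e_def nrm sum_divide_distrib exp_sum flip: sum_negf)
  have cs: "cis (\<Sum>b\<in>B. g b) = (\<Prod>b\<in>B. cis (g b))" if "finite B" for B :: "'a set" and g
    using that by induction (simp_all flip: cis_mult)
  have hprod: "h y = (\<lambda>\<omega>. \<Prod>b\<in>Basis. cis ((y \<bullet> b) * (\<omega> \<bullet> b)) * of_real (e (\<omega> \<bullet> b)))" for y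
  proof
    fix \<omega>
    have "y \<bullet> \<omega> = (\<Sum>b\<in>Basis. (y \<bullet> b) * (\<omega> \<bullet> b))" by (rule euclidean_inner)
    then have "cis (y \<bullet> \<omega>) = (\<Prod>b\<in>Basis. cis ((y \<bullet> b) * (\<omega> \<bullet> b)))" by (simp only: cs finite_Basis)
    then show "h y \<omega> = (\<Prod>b\<in>Basis. cis ((y \<bullet> b) * (\<omega> \<bullet> b)) * of_real (e (\<omega> \<bullet> b)))"
      unfolding h_def g1 prod.distrib of_real_prod by simp
  qed
  have bas: "integrable lborel (\<lambda>x. cis (t * x) * complex_of_real (e x))"
    "(LINT x|lborel. cis (t * x) * complex_of_real (e x)) = of_real (sqrt (2 * pi) * e t)" for t
    using fourier_std_gaussian_real[of t] unfolding has_bochner_integral_iff e_def by blast+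
  have std: "has_bochner_integral lborel (h y) (of_real (sqrt (2 * pi) ^ DIM('a) * gauss 1 y))" for y
  proof -
    have "has_bochner_integral lborel (h y)
       (\<Prod>b\<in>Basis. LINT x|lborel. cis ((y \<bullet> b) * x) * complex_of_real (e x))"
      unfolding hprod by (intro has_bochner_integral_lborel_prod bas)
    also have "(\<Prod>b\<in>Basis. LINT x|lborel. cis ((y \<bullet> b) * x) * complex_of_real (e x)) =
       of_real (\<Prod>b\<in>Basis. sqrt (2 * pi) * e (y \<bullet> b))"
      unfolding bas of_real_prod ..
    also have "(\<Prod>b\<in>Basis. sqrt (2 * pi) * e (y \<bullet> b)) = sqrt (2 * pi) ^ DIM('a) * gauss 1 y"
      unfolding g1 prod.distrib by simp
    finally show ?thesis .
  qed
  have sx: "(s *\<^sub>R x) \<bullet> ((1/s) *\<^sub>R \<omega>) = x \<bullet> \<omega>" for \<omega>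
    using s by simp
  have gs: "gauss 1 ((1/s) *\<^sub>R \<omega>) = gauss s \<omega>" "gauss 1 (s *\<^sub>R \<omega>) = gauss (1/s) \<omega>" for \<omega> :: 'a
    using s by (simp_all add: gauss_scale)
  have eq: "(\<lambda>\<omega>. cis (x \<bullet> \<omega>) * of_real (gauss s \<omega>)) = (\<lambda>\<omega>. h (s *\<^sub>R x) (0 + (1/s) *\<^sub>R \<omega>))"
    unfolding h_def add_0 gs sx ..
  have 1: "integrable lborel (\<lambda>\<omega>. h (s *\<^sub>R x) (0 + (1/s) *\<^sub>R \<omega>))"
    using std[of "s *\<^sub>R x"] s by (intro lborel_integrable_affine) (auto simp: has_bochner_integral_iff)
  have "(LINT \<omega>|lborel. h (s *\<^sub>R x) \<omega>) = (1/s) ^ DIM('a) *\<^sub>R (LINT \<omega>|lborel. h (s *\<^sub>R x) (0 + (1/s) *\<^sub>R \<omega>))"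
    using s by (subst lborel_integral_affine[of "1/s" _ 0]) auto
  then have "s ^ DIM('a) *\<^sub>R (LINT \<omega>|lborel. h (s *\<^sub>R x) \<omega>) = (LINT \<omega>|lborel. h (s *\<^sub>R x) (0 + (1/s) *\<^sub>R \<omega>))"
    using s by (simp add: power_divide)
  also have "(LINT \<omega>|lborel. h (s *\<^sub>R x) \<omega>) = of_real (sqrt (2 * pi) ^ DIM('a) * gauss (1/s) x)"
    using std[of "s *\<^sub>R x"] unfolding has_bochner_integral_iff gs by blast
  also have "s ^ DIM('a) *\<^sub>R complex_of_real (sqrt (2 * pi) ^ DIM('a) * gauss (1/s) x) =
      of_real ((sqrt (2 * pi) * s) ^ DIM('a) * gauss (1 / s) x)"
    unfolding scaleR_conv_of_real power_mult_distrib of_real_mult by (simp only: mult_ac)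
  finally show ?thesis
    using 1 unfolding eq has_bochner_integral_iff by metis
qed

lemma has_integral_gauss:
  assumes s: "s > 0"
  shows "has_bochner_integral lborel (gauss s :: 'a::euclidean_space \<Rightarrow> real) ((sqrt (2 * pi) * s) ^ DIM('a))"
proof -
  have g0: "gauss (1/s) (0::'a) = 1" by (simp add: gauss_def)
  show ?thesis
    using has_bochner_integral_bounded_linear[OF bounded_linear_Re has_fourier_integral_gauss[OF s, of "0::'a"]]
    unfolding g0 by simp
qed

section \<open>Bessel weights\<close>

text \<open>The weight inside \<open>bessel_norm\<close>. Its order may be negative: such weights
  give the dual norms of exponential sums.\<close>

definition bessel_weight :: "real \<Rightarrow> 'a::euclidean_space \<Rightarrow> real" where
  "bessel_weight s \<omega> = (1 + (norm \<omega>)\<^sup>2) powr s"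

lemma one_plus_norm_pos [simp]: "1 + (norm (x :: 'a::real_normed_vector))\<^sup>2 > 0"
  by (simp add: add_pos_nonneg)

lemma bessel_weight_pos [simp]: "bessel_weight s \<omega> > 0" and bessel_weight_nonneg [simp]: "bessel_weight s \<omega> \<ge> 0"
  using one_plus_norm_pos[of \<omega>] by (auto simp: bessel_weight_def simp del: one_plus_norm_pos)

lemma bessel_weight_measurable [measurable]: "bessel_weight s \<in> borel_measurable borel"
  by (auto simp: bessel_weight_def[abs_def])

lemma bessel_weight_add: "bessel_weight s \<omega> * bessel_weight t \<omega> = bessel_weight (s + t) \<omega>"
  by (simp add: bessel_weight_def powr_add)

lemma bessel_weight_zero [simp]: "bessel_weight 0 \<omega> = 1"
  using one_plus_norm_pos[of \<omega>] by (simp add: bessel_weight_def del: one_plus_norm_pos)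

lemma bessel_weight_uminus [simp]: "bessel_weight s (- \<omega>) = bessel_weight s \<omega>"
  by (simp add: bessel_weight_def)

text \<open>\<open>k\<close> is the least exponent whose ball of radius \<open>2 ^ k\<close>
  contains \<omega>. Minimality bounds the norm from below by half the radius, except for
  \<open>k = 0\<close>, where \<open>4 ^ k / 4\<close> is below 1 anyway.\<close>

lemma bessel_weight_neg_le_dyadic:
  fixes \<omega> :: "'a::euclidean_space"
  assumes b: "b > 0"
  obtains k where "norm \<omega> \<le> 2 ^ k" "bessel_weight (- b) \<omega> \<le> 4 powr b * (4 powr (- b)) ^ k"
proof -
  have "\<exists>k. norm \<omega> \<le> 2 ^ k"
    using real_arch_pow[of 2 "norm \<omega>"] by (auto intro: less_imp_le)
  then obtain k where k: "norm \<omega> \<le> 2 ^ k" and least: "\<And>j. j < k \<Longrightarrow> \<not> norm \<omega> \<le> 2 ^ j"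
    using exists_least_iff[of "\<lambda>k. norm \<omega> \<le> 2 ^ k"] by blast
  have "4 ^ k / 4 \<le> 1 + (norm \<omega>)\<^sup>2"
  proof (cases k)
    case (Suc j)
    then have "(2 ^ j)\<^sup>2 \<le> (norm \<omega>)\<^sup>2" using least[of j] by (intro power_mono) auto
    moreover have "(2 ^ j)\<^sup>2 = (4::real) ^ j" by (simp add: power2_eq_square flip: power_mult_distrib)
    ultimately show ?thesis using Suc by simp
  qed (use zero_le_power2[of "norm \<omega>"] in simp)
  then have "bessel_weight (- b) \<omega> \<le> (4 ^ k / 4) powr (- b)"
    unfolding bessel_weight_def using b by (intro powr_mono2') auto
  also have "\<dots> = 4 powr b * (4 powr (- b)) ^ k"
    by (simp add: powr_divide powr_minus divide_simps powr_power mult.commute flip: powr_realpow powr_powr)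
       (simp add: powr_powr mult.commute)
  finally show ?thesis using k that by blast
qed

lemma integrable_bessel_weight:
  assumes b: "b > real DIM('a) / 2"
  shows "integrable lborel (bessel_weight (- b) :: 'a::euclidean_space \<Rightarrow> real)"
proof (rule integrableI_nonneg)
  define V where "V = unit_ball_vol (real DIM('a))"
  \<comment> \<open>The ratio of consecutive dyadic terms: doubling the radius multiplies the volume
    by \<open>2 ^ DIM('a)\<close> and the weight by \<open>4 powr (- b)\<close>. It is below 1
    exactly when \<open>b\<close> exceeds half the dimension.\<close>
  define q where "q = 2 ^ DIM('a) * 4 powr (- b)"
  have b0: "b > 0" using b by (meson divide_nonneg_nonneg le_less_trans of_nat_0_le_iff zero_le_numeral)
  have "q = 2 powr (real DIM('a) - 2 * b)"
    unfolding q_def using powr_powr[of 2 2 "- b"] by (simp add: powr_diff powr_realpow powr_minus divide_inverse)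
  also have "\<dots> < 2 powr 0" using b by (intro powr_less_mono) auto
  finally have q: "0 \<le> q" "q < 1" by (auto simp: q_def)
  \<comment> \<open>Each point is charged to one ball of the series; the balls overlap, which only
    enlarges the right-hand side.\<close>
  have "(\<integral>\<^sup>+\<omega>. ennreal (bessel_weight (- b) \<omega>) \<partial>(lborel :: 'a measure)) \<le>
      (\<integral>\<^sup>+\<omega>. (\<Sum>k. ennreal (4 powr b * (4 powr (- b)) ^ k) * indicator (cball 0 (2 ^ k)) \<omega>) \<partial>(lborel :: 'a measure))"
  proof (intro nn_integral_mono)
    fix \<omega> :: 'a
    obtain k where k: "norm \<omega> \<le> 2 ^ k" "bessel_weight (- b) \<omega> \<le> 4 powr b * (4 powr (- b)) ^ k"
      using bessel_weight_neg_le_dyadic[OF b0] by blast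
    let ?f = "\<lambda>k. ennreal (4 powr b * (4 powr (- b)) ^ k) * indicator (cball 0 (2 ^ k)) \<omega>"
    have "ennreal (bessel_weight (- b) \<omega>) \<le> ?f k"
      using k by (simp add: ennreal_leI)
    also have "F k \<le> suminf F" for F :: "nat \<Rightarrow> ennreal"
      using sum_le_suminf[of F "{k}"] by simp
    finally show "ennreal (bessel_weight (- b) \<omega>) \<le> suminf ?f" .
  qed
  also have "\<dots> = (\<Sum>k. \<integral>\<^sup>+\<omega>. ennreal (4 powr b * (4 powr (- b)) ^ k) * indicator (cball 0 (2 ^ k)) \<omega> \<partial>(lborel :: 'a measure))"
    by (rule nn_integral_suminf) (intro borel_measurable_times_ennreal borel_measurable_const borel_measurable_indicator, simp)
  also have "\<dots> = (\<Sum>k. ennreal (4 powr b * V * q ^ k))"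
  proof (intro suminf_cong)
    fix k
    have "(\<integral>\<^sup>+\<omega>. ennreal (4 powr b * (4 powr (- b)) ^ k) * indicator (cball 0 (2 ^ k)) \<omega> \<partial>(lborel :: 'a measure)) =
      ennreal (4 powr b * (4 powr (- b)) ^ k) * ennreal (V * (2 ^ k) ^ DIM('a))"
      by (subst nn_integral_cmult_indicator) (auto simp: emeasure_cball V_def)
    also have "\<dots> = ennreal (4 powr b * (4 powr (- b)) ^ k * (V * (2 ^ k) ^ DIM('a)))"
      by (rule ennreal_mult'[symmetric]) simp
    also have "4 powr b * (4 powr (- b)) ^ k * (V * (2 ^ k) ^ DIM('a)) = 4 powr b * V * q ^ k"
      by (simp add: q_def power_mult_distrib mult_ac flip: power_mult)
    finally show "(\<integral>\<^sup>+\<omega>. ennreal (4 powr b * (4 powr (- b)) ^ k) * indicator (cball 0 (2 ^ k)) \<omega> \<partial>(lborel :: 'a measure)) =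
      ennreal (4 powr b * V * q ^ k)" .
  qed
  also have "\<dots> = ennreal (4 powr b * V * (1 / (1 - q)))"
    using q by (intro suminf_ennreal_eq sums_mult geometric_sums) (auto simp: V_def)
  also have "\<dots> < \<infinity>" by simp
  finally show "(\<integral>\<^sup>+\<omega>. ennreal (bessel_weight (- b) \<omega>) \<partial>(lborel :: 'a measure)) < \<infinity>" .
qed auto

section \<open>The Plancherel inequality\<close>

text \<open>Same sign as in \<open>truncated_inverse_fourier\<close>, but without its factor, which
  is kept apart as \<open>fourier_const\<close>. For integrable \<open>h\<close> the integral exists
  at every point.\<close>

definition fourier_integral :: "('a::euclidean_space \<Rightarrow> complex) \<Rightarrow> 'a \<Rightarrow> complex" where
  "fourier_integral h x = (LINT \<omega>|lborel. cis (x \<bullet> \<omega>) * h \<omega>)"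

lemma cis_inner_measurable [measurable]: "(\<lambda>\<omega>. cis (x \<bullet> \<omega>)) \<in> borel_measurable borel"
  by (intro borel_measurable_continuous_onI continuous_intros)

lemma integrable_cis_mult:
  assumes "integrable lborel h"
  shows "integrable lborel (\<lambda>\<omega>. cis (x \<bullet> \<omega>) * h \<omega>)"
  by (rule Bochner_Integration.integrable_bound[OF assms]) (use assms in \<open>auto simp: norm_mult\<close>)

lemma norm_fourier_integral_le: "norm (fourier_integral h x) \<le> (LINT \<omega>|lborel. norm (h \<omega>))"
  unfolding fourier_integral_def by (rule order_trans[OF integral_norm_bound]) (simp add: norm_mult)

lemma continuous_on_fourier_integral:
  assumes h: "integrable lborel h"
  shows "continuous_on UNIV (fourier_integral h)"
  unfolding continuous_on_sequentially
proof (intro allI ballI impI)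
  fix u and a :: 'a assume "(\<forall>n. u n \<in> UNIV) \<and> u \<longlonglongrightarrow> a"
  then have u: "u \<longlonglongrightarrow> a" by simp
  show "(fourier_integral h \<circ> u) \<longlonglongrightarrow> fourier_integral h a"
    unfolding fourier_integral_def comp_def
  proof (rule integral_dominated_convergence[where w="\<lambda>\<omega>. norm (h \<omega>)"])
    show "AE \<omega> in lborel. (\<lambda>i. cis (u i \<bullet> \<omega>) * h \<omega>) \<longlonglongrightarrow> cis (a \<bullet> \<omega>) * h \<omega>"
      by (intro AE_I2 tendsto_intros u)
  qed (use h in \<open>auto simp: norm_mult\<close>)
qed

lemma fourier_integral_measurable:
  "integrable lborel h \<Longrightarrow> fourier_integral h \<in> borel_measurable borel"
  by (intro borel_measurable_continuous_onI continuous_on_fourier_integral)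

lemma integrable_fourier_integral_mult:
  assumes h: "integrable lborel h" and v: "integrable lborel v"
  shows "integrable lborel (\<lambda>x. fourier_integral h x * v x)"
proof (rule Bochner_Integration.integrable_bound[of _ "\<lambda>x. (LINT \<omega>|lborel. norm (h \<omega>)) * norm (v x)"])
  show "(\<lambda>x. fourier_integral h x * v x) \<in> borel_measurable lborel"
    using fourier_integral_measurable[OF h] v by auto
  show "AE x in lborel. norm (fourier_integral h x * v x) \<le> norm ((LINT \<omega>|lborel. norm (h \<omega>)) * norm (v x))"
    by (intro AE_I2) (auto simp: norm_mult intro!: mult_right_mono norm_fourier_integral_le)
qed (use v in auto)

text \<open>Fubini's theorem, as \<open>cis (x \<bullet> \<omega>)\<close> is symmetric in its two
  variables.\<close>

lemma fourier_integral_multiplication: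
  assumes h: "integrable lborel h" and v: "integrable lborel v"
  shows "(LINT x|lborel. fourier_integral h x * v x) = (LINT \<omega>|lborel. h \<omega> * fourier_integral v \<omega>)"
proof -
  let ?f = "\<lambda>(x::'a, \<omega>). cis (x \<bullet> \<omega>) * h \<omega> * v x"
  have [measurable]: "h \<in> borel_measurable borel" "v \<in> borel_measurable borel"
    using borel_measurable_integrable[OF h] borel_measurable_integrable[OF v] by simp_all
  have [measurable]: "(\<lambda>z. cis (fst z \<bullet> (snd z :: 'a))) \<in> borel_measurable (borel \<Otimes>\<^sub>M borel)"
    unfolding borel_prod by (intro borel_measurable_continuous_onI continuous_intros)
  have m: "?f \<in> borel_measurable (lborel \<Otimes>\<^sub>M lborel)"
    unfolding split_beta' by measurable
  have int: "integrable (lborel \<Otimes>\<^sub>M lborel) ?f"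
  proof (rule lborel_pair.Fubini_integrable[OF m])
    show "integrable lborel (\<lambda>x. LINT \<omega>|lborel. norm (?f (x, \<omega>)))"
      using v by (simp add: norm_mult)
    show "AE x in lborel. integrable lborel (\<lambda>\<omega>. ?f (x, \<omega>))"
      using integrable_cis_mult[OF h] by auto
  qed
  have "(LINT x|lborel. fourier_integral h x * v x) = (LINT x|lborel. LINT \<omega>|lborel. ?f (x, \<omega>))"
    unfolding fourier_integral_def by simp
  also have "\<dots> = (LINT \<omega>|lborel. LINT x|lborel. ?f (x, \<omega>))"
    using lborel_pair.Fubini_integral[of "\<lambda>x \<omega>. ?f (x, \<omega>)"] int by simp
  also have "\<dots> = (LINT \<omega>|lborel. h \<omega> * fourier_integral v \<omega>)"
    unfolding fourier_integral_def
    by (intro Bochner_Integration.integral_cong refl)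
       (simp add: inner_commute mult_ac flip: integral_mult_right_zero)
  finally show ?thesis .
qed

lemma fourier_integral_gauss:
  assumes "s > 0"
  shows "fourier_integral (\<lambda>\<omega>. of_real (gauss s \<omega>)) (x :: 'a::euclidean_space) =
    of_real ((sqrt (2 * pi) * s) ^ DIM('a) * gauss (1 / s) x)"
  using has_fourier_integral_gauss[OF assms, of x] unfolding fourier_integral_def has_bochner_integral_iff by blast

lemma nn_integral_gauss:
  fixes t :: "'a::euclidean_space"
  assumes "s > 0"
  shows "(\<integral>\<^sup>+x. ennreal (gauss s (t - x)) \<partial>lborel) = ennreal ((sqrt (2 * pi) * s) ^ DIM('a))"
proof -
  have "(\<integral>\<^sup>+x. ennreal (gauss s (t - x)) \<partial>lborel) = (\<integral>\<^sup>+x. ennreal (gauss s x) \<partial>(lborel :: 'a measure))"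
    by (subst (2) nn_integral_lborel_affine[of _ "-1" t]) auto
  also have "\<dots> = ennreal ((sqrt (2 * pi) * s) ^ DIM('a))"
    using has_integral_gauss[OF assms, where 'a='a] assms
    by (intro nn_integral_eq_integral[THEN trans]) (auto simp: has_bochner_integral_iff)
  finally show ?thesis .
qed

text \<open>
  The Gaussian factor makes the multiplication formula applicable twice; it turns the regularised
  integral into \<open>\<integral>\<integral> h(\<omega>) cnj (h(\<eta>)) K(\<eta> - \<omega>)\<close> with a positive kernel \<open>K\<close> of mass \<open>(2\<pi>)\<^sup>d\<close>, and
  Fatou's lemma removes the regularisation.
\<close>

lemma plancherel_le:
  fixes h :: "'a::euclidean_space \<Rightarrow> complex"
  assumes h: "integrable lborel h"
  shows "(\<integral>\<^sup>+x. ennreal ((norm (fourier_integral h x))\<^sup>2) \<partial>lborel) \<le>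
     ennreal ((2 * pi) ^ DIM('a)) * (\<integral>\<^sup>+x. ennreal ((norm (h x))\<^sup>2) \<partial>lborel)"
proof -
  let ?H = "\<integral>\<^sup>+x. ennreal ((norm (h x))\<^sup>2) \<partial>lborel"
  have hm[measurable]: "h \<in> borel_measurable borel" using borel_measurable_integrable[OF h] by simp
  note fm[measurable] = fourier_integral_measurable[OF h]
  have G: "integrable lborel (gauss s :: 'a \<Rightarrow> real)" if "s > 0" for s
    using has_integral_gauss[OF that, where 'a='a] by (simp add: has_bochner_integral_iff)
  have reg: "(\<integral>\<^sup>+x. ennreal (gauss s x * (norm (fourier_integral h x))\<^sup>2) \<partial>lborel) \<le> ennreal ((2 * pi) ^ DIM('a)) * ?H"
    if s: "s > 0" for s
  proof -
    \<comment> \<open>The Fourier integral of \<open>gauss s\<close>, by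
      \<open>fourier_integral_gauss\<close>.\<close>
    define K :: "'a \<Rightarrow> real" where "K z = (sqrt (2 * pi) * s) ^ DIM('a) * gauss (1 / s) z" for z
    have K0: "K z \<ge> 0" for z using s by (simp add: K_def)
    have Km[measurable]: "K \<in> borel_measurable borel" by (simp add: K_def[abs_def])
    \<comment> \<open>Chosen so that \<open>fourier_integral h x * v x\<close> is the regularised
      integrand.\<close>
    define v where "v x = complex_of_real (gauss s x) * cnj (fourier_integral h x)" for x
    have cg: "integrable lborel (\<lambda>x::'a. complex_of_real (gauss s x))" using G[OF s] by simp
    have "integrable lborel (\<lambda>x. cnj (fourier_integral h x * complex_of_real (gauss s x)))"
      by (intro integrable_cnj integrable_fourier_integral_mult[OF h cg])
    then have v: "integrable lborel v"
      unfolding v_def[abs_def] by (simp add: mult.commute)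
    have pv: "fourier_integral h x * v x = of_real (gauss s x * (norm (fourier_integral h x))\<^sup>2)" for x
      unfolding v_def of_real_mult complex_norm_square by (simp only: mult_ac)
    have intr: "integrable lborel (\<lambda>x. gauss s x * (norm (fourier_integral h x))\<^sup>2)"
      using integrable_fourier_integral_mult[OF h v] unfolding pv complex_of_real_integrable_eq .
    \<comment> \<open>Conjugation turns the Fourier integral of \<open>v\<close> into an integral of
      \<open>fourier_integral h\<close> against a modulated Gaussian \<open>w\<close>; the
      modulation centres the transform of the Gaussian at \<omega>.\<close>
    have bnd: "ennreal (norm (fourier_integral v \<omega>)) \<le> (\<integral>\<^sup>+\<eta>. ennreal (norm (h \<eta>) * K (\<eta> - \<omega>)) \<partial>lborel)" for \<omega>
    proof -
      define w where "w x = cis (- \<omega> \<bullet> x) * complex_of_real (gauss s x)" for x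
      have w: "integrable lborel w" unfolding w_def[abs_def] by (rule integrable_cis_mult[OF cg])
      have Fw: "fourier_integral w \<eta> = of_real (K (\<eta> - \<omega>))" for \<eta>
        using fourier_integral_gauss[OF s, of "\<eta> - \<omega>"]
        by (simp add: K_def fourier_integral_def w_def cis_mult inner_diff_left flip: mult.assoc)
      have "cnj (fourier_integral v \<omega>) = (LINT x|lborel. cnj (cis (\<omega> \<bullet> x) * v x))"
        unfolding fourier_integral_def by (subst Bochner_Integration.integral_cnj) (rule refl)
      also have "\<dots> = (LINT x|lborel. fourier_integral h x * w x)"
        by (intro Bochner_Integration.integral_cong refl) (simp add: v_def w_def cis_cnj mult_ac)
      also have "\<dots> = (LINT \<eta>|lborel. h \<eta> * of_real (K (\<eta> - \<omega>)))"
        unfolding fourier_integral_multiplication[OF h w] Fw ..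
      finally have "norm (fourier_integral v \<omega>) = norm (LINT \<eta>|lborel. h \<eta> * of_real (K (\<eta> - \<omega>)))"
        by (metis complex_mod_cnj)
      also have "ennreal \<dots> \<le> (\<integral>\<^sup>+\<eta>. ennreal (norm (h \<eta> * of_real (K (\<eta> - \<omega>)))) \<partial>lborel)"
      proof (rule integral_norm_bound_ennreal)
        have "integrable lborel (\<lambda>\<eta>. fourier_integral w \<eta> * h \<eta>)"
          by (rule integrable_fourier_integral_mult[OF w h])
        then show "integrable lborel (\<lambda>\<eta>. h \<eta> * of_real (K (\<eta> - \<omega>)))"
          unfolding Fw by (simp add: mult.commute)
      qed
      also have "\<dots> = (\<integral>\<^sup>+\<eta>. ennreal (norm (h \<eta>) * K (\<eta> - \<omega>)) \<partial>lborel)"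
        using K0 by (simp add: norm_mult)
      finally show ?thesis .
    qed
    \<comment> \<open>The widths \<open>s\<close> and \<open>1/s\<close> cancel, so the mass of
      \<open>K\<close> does not depend on the regularisation.\<close>
    have sq: "sqrt (2 * pi) * s * (sqrt (2 * pi) * (1 / s)) = 2 * pi" using s by simp
    have IK: "(\<integral>\<^sup>+z. ennreal (K (t - z)) \<partial>lborel) = ennreal ((2 * pi) ^ DIM('a))" for t
    proof -
      have "(\<integral>\<^sup>+z. ennreal (K (t - z)) \<partial>lborel) = ennreal ((sqrt (2 * pi) * s) ^ DIM('a)) * ennreal ((sqrt (2 * pi) * (1 / s)) ^ DIM('a))"
        unfolding K_def using s by (simp add: ennreal_mult nn_integral_cmult nn_integral_gauss[of "1/s" t] del: times_divide_eq_right)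
      also have "\<dots> = ennreal ((sqrt (2 * pi) * s) ^ DIM('a) * (sqrt (2 * pi) * (1 / s)) ^ DIM('a))"
        using s by (intro ennreal_mult[symmetric]) auto
      also have "\<dots> = ennreal ((2 * pi) ^ DIM('a))"
        unfolding power_mult_distrib[symmetric] sq ..
      finally show ?thesis .
    qed
    have Keven: "K (\<eta> - \<omega>) = K (\<omega> - \<eta>)" for \<eta> \<omega> :: 'a
      by (simp add: K_def gauss_def norm_minus_commute)
    have "(\<integral>\<^sup>+x. ennreal (gauss s x * (norm (fourier_integral h x))\<^sup>2) \<partial>lborel) =
        ennreal (LINT x|lborel. gauss s x * (norm (fourier_integral h x))\<^sup>2)"
      by (rule nn_integral_eq_integral[OF intr]) auto
    also have "(LINT x|lborel. gauss s x * (norm (fourier_integral h x))\<^sup>2) =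
        norm (LINT x|lborel. fourier_integral h x * v x)"
      unfolding pv integral_complex_of_real norm_of_real
      by (intro abs_of_nonneg[symmetric] integral_nonneg_AE) auto
    also have "\<dots> = norm (LINT \<omega>|lborel. h \<omega> * fourier_integral v \<omega>)"
      unfolding fourier_integral_multiplication[OF h v] ..
    also have "ennreal \<dots> \<le> (\<integral>\<^sup>+\<omega>. ennreal (norm (h \<omega> * fourier_integral v \<omega>)) \<partial>lborel)"
      using integrable_fourier_integral_mult[OF v h] by (intro integral_norm_bound_ennreal) (simp add: mult.commute)
    also have "\<dots> \<le> (\<integral>\<^sup>+\<omega>. \<integral>\<^sup>+\<eta>. ennreal (norm (h \<omega>) * (norm (h \<eta>) * K (\<eta> - \<omega>))) \<partial>lborel \<partial>lborel)"
    proof (intro nn_integral_mono)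
      fix \<omega>
      have "ennreal (norm (h \<omega> * fourier_integral v \<omega>)) \<le> ennreal (norm (h \<omega>)) * (\<integral>\<^sup>+\<eta>. ennreal (norm (h \<eta>) * K (\<eta> - \<omega>)) \<partial>lborel)"
        unfolding norm_mult by (simp add: ennreal_mult mult_left_mono bnd)
      then show "ennreal (norm (h \<omega> * fourier_integral v \<omega>)) \<le> (\<integral>\<^sup>+\<eta>. ennreal (norm (h \<omega>) * (norm (h \<eta>) * K (\<eta> - \<omega>))) \<partial>lborel)"
        using K0 by (subst ennreal_mult) (auto simp: nn_integral_cmult)
    qed
    \<comment> \<open>Schur's test: the arithmetic-geometric mean inequality decouples
      \<open>h \<omega>\<close> from \<open>h \<eta>\<close>, and in each half \<open>K\<close> is
      integrated over the free variable. The computation stays in \<open>ennreal\<close> because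
      \<open>?H\<close> may be infinite.\<close>
    also have "\<dots> \<le> (\<integral>\<^sup>+\<omega>. \<integral>\<^sup>+\<eta>. ennreal ((norm (h \<omega>))\<^sup>2 / 2 * K (\<omega> - \<eta>)) + ennreal ((norm (h \<eta>))\<^sup>2 / 2 * K (\<omega> - \<eta>)) \<partial>lborel \<partial>lborel)"
    proof (intro nn_integral_mono)
      fix \<omega> \<eta>
      have "norm (h \<omega>) * norm (h \<eta>) \<le> (norm (h \<omega>))\<^sup>2 / 2 + (norm (h \<eta>))\<^sup>2 / 2"
        using sum_squares_bound[of "norm (h \<omega>)" "norm (h \<eta>)"] by simp
      from mult_right_mono[OF this K0[of "\<omega> - \<eta>"]]
      have le: "norm (h \<omega>) * (norm (h \<eta>) * K (\<omega> - \<eta>)) \<le> (norm (h \<omega>))\<^sup>2 / 2 * K (\<omega> - \<eta>) + (norm (h \<eta>))\<^sup>2 / 2 * K (\<omega> - \<eta>)"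
        by (simp only: distrib_right mult.assoc)
      have p: "(norm (h z))\<^sup>2 / 2 * K (\<omega> - \<eta>) \<ge> 0" for z
        by (intro mult_nonneg_nonneg[OF _ K0]) simp
      show "ennreal (norm (h \<omega>) * (norm (h \<eta>) * K (\<eta> - \<omega>))) \<le> ennreal ((norm (h \<omega>))\<^sup>2 / 2 * K (\<omega> - \<eta>)) + ennreal ((norm (h \<eta>))\<^sup>2 / 2 * K (\<omega> - \<eta>))"
        unfolding Keven[of \<eta>] ennreal_plus[OF p p, symmetric] by (rule ennreal_leI[OF le])
    qed
    also have "\<dots> = (\<integral>\<^sup>+\<omega>. \<integral>\<^sup>+\<eta>. ennreal ((norm (h \<omega>))\<^sup>2 / 2 * K (\<omega> - \<eta>)) \<partial>lborel \<partial>lborel) +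
        (\<integral>\<^sup>+\<omega>. \<integral>\<^sup>+\<eta>. ennreal ((norm (h \<eta>))\<^sup>2 / 2 * K (\<omega> - \<eta>)) \<partial>lborel \<partial>lborel)"
      by (simp add: nn_integral_add)
    also have "(\<integral>\<^sup>+\<omega>. \<integral>\<^sup>+\<eta>. ennreal ((norm (h \<eta>))\<^sup>2 / 2 * K (\<omega> - \<eta>)) \<partial>lborel \<partial>lborel) =
        (\<integral>\<^sup>+\<eta>. \<integral>\<^sup>+\<omega>. ennreal ((norm (h \<eta>))\<^sup>2 / 2 * K (\<eta> - \<omega>)) \<partial>lborel \<partial>lborel)"
      by (subst lborel_pair.Fubini') (auto simp: Keven)
    also have "(\<integral>\<^sup>+\<omega>. \<integral>\<^sup>+\<eta>. ennreal ((norm (h \<omega>))\<^sup>2 / 2 * K (\<omega> - \<eta>)) \<partial>lborel \<partial>lborel) =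
        (\<integral>\<^sup>+\<omega>. ennreal ((norm (h \<omega>))\<^sup>2 / 2) * ennreal ((2 * pi) ^ DIM('a)) \<partial>lborel)"
      by (intro nn_integral_cong) (simp only: ennreal_mult''[OF K0], subst nn_integral_cmult, auto simp: IK)
    also have "\<dots> = (\<integral>\<^sup>+\<omega>. ennreal ((norm (h \<omega>))\<^sup>2 / 2) \<partial>lborel) * ennreal ((2 * pi) ^ DIM('a))"
      by (rule nn_integral_multc) simp
    also have "\<dots> + \<dots> = (\<integral>\<^sup>+\<omega>. ennreal ((norm (h \<omega>))\<^sup>2 / 2) + ennreal ((norm (h \<omega>))\<^sup>2 / 2) \<partial>lborel) * ennreal ((2 * pi) ^ DIM('a))"
      by (subst nn_integral_add) (auto simp: distrib_right)
    also have "\<dots> = ennreal ((2 * pi) ^ DIM('a)) * ?H"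
      by (simp add: mult.commute flip: ennreal_plus)
    finally show ?thesis .
  qed
  have "(\<integral>\<^sup>+x. ennreal ((norm (fourier_integral h x))\<^sup>2) \<partial>lborel) =
      (\<integral>\<^sup>+x. liminf (\<lambda>n. ennreal (gauss (real (Suc n)) x * (norm (fourier_integral h x))\<^sup>2)) \<partial>lborel)"
  proof (intro nn_integral_cong)
    fix x :: 'a
    have inv: "- a / (2 * k\<^sup>2) = - a / 2 * (inverse k * inverse k)" for a k :: real
      by (cases "k = 0") (simp_all add: field_simps power2_eq_square)
    have "(\<lambda>n. - (norm x)\<^sup>2 / 2 * (inverse (real (Suc n)) * inverse (real (Suc n)))) \<longlonglongrightarrow> - (norm x)\<^sup>2 / 2 * (0 * 0)"
      by (intro tendsto_intros LIMSEQ_inverse_real_of_nat)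
    then have "(\<lambda>n. exp (- (norm x)\<^sup>2 / 2 * (inverse (real (Suc n)) * inverse (real (Suc n))))) \<longlonglongrightarrow> exp (- (norm x)\<^sup>2 / 2 * (0 * 0))"
      by (rule tendsto_exp)
    then have "(\<lambda>n. gauss (real (Suc n)) x) \<longlonglongrightarrow> 1"
      unfolding gauss_def inv by simp
    then have "(\<lambda>n. ennreal (gauss (real (Suc n)) x * (norm (fourier_integral h x))\<^sup>2)) \<longlonglongrightarrow> ennreal (1 * (norm (fourier_integral h x))\<^sup>2)"
      by (intro tendsto_ennrealI tendsto_mult tendsto_const)
    from lim_imp_Liminf[OF _ this]
    show "ennreal ((norm (fourier_integral h x))\<^sup>2) = liminf (\<lambda>n. ennreal (gauss (real (Suc n)) x * (norm (fourier_integral h x))\<^sup>2))"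
      by simp
  qed
  also have "\<dots> \<le> liminf (\<lambda>n. \<integral>\<^sup>+x. ennreal (gauss (real (Suc n)) x * (norm (fourier_integral h x))\<^sup>2) \<partial>lborel)"
    by (rule nn_integral_liminf) auto
  also have "\<dots> \<le> liminf (\<lambda>n::nat. ennreal ((2 * pi) ^ DIM('a)) * ?H)"
    by (intro Liminf_mono always_eventually allI reg) simp
  also have "\<dots> = ennreal ((2 * pi) ^ DIM('a)) * ?H"
    by (simp add: Liminf_const)
  finally show ?thesis .
qed

section \<open>Sobolev functions as Fourier integrals\<close>

definition fourier_const :: "'a::euclidean_space itself \<Rightarrow> real" where
  "fourier_const _ = (2 * pi) powr (- (real DIM('a) / 2))"

lemma fourier_const_pos [simp]: "fourier_const TYPE('a::euclidean_space) > 0"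
  by (simp add: fourier_const_def)

lemma fourier_const_power2: "(fourier_const TYPE('a::euclidean_space))\<^sup>2 * (2 * pi) ^ DIM('a) = 1"
proof -
  have "(fourier_const TYPE('a))\<^sup>2 = (2 * pi) powr (- real DIM('a))"
    by (simp add: fourier_const_def power2_eq_square flip: powr_add)
  moreover have "(2 * pi) ^ DIM('a) = (2 * pi) powr real DIM('a)"
    by (simp add: powr_realpow)
  ultimately show ?thesis by (simp flip: powr_add)
qed

lemma truncated_inverse_fourier_eq:
  "truncated_inverse_fourier R g (x::'a::euclidean_space) =
     fourier_const TYPE('a) *\<^sub>R fourier_integral (\<lambda>\<omega>. indicator (cball 0 R) \<omega> *\<^sub>R g \<omega>) x"
  unfolding truncated_inverse_fourier_def fourier_integral_def set_lebesgue_integral_def fourier_const_def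
  by simp

lemma square_integrable_borel: "square_integrable g \<Longrightarrow> g \<in> borel_measurable borel"
  by (simp add: square_integrable_def)

text \<open>The truncation error is, up to a constant, the Fourier integral of the tail of
  \<open>g\<close>, to which the Plancherel inequality can be applied.\<close>

lemma truncated_inverse_fourier_diff:
  fixes g :: "'a::euclidean_space \<Rightarrow> complex"
  assumes "integrable lborel g"
  shows "truncated_inverse_fourier R g x - fourier_const TYPE('a) *\<^sub>R fourier_integral g x =
     - (fourier_const TYPE('a) *\<^sub>R fourier_integral (\<lambda>\<omega>. indicator (- cball 0 R) \<omega> *\<^sub>R g \<omega>) x)"
proof -
  have 1: "integrable lborel (\<lambda>\<omega>. cis (x \<bullet> \<omega>) * (indicator A \<omega> *\<^sub>R g \<omega>))" if "A \<in> sets lborel" for A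
    by (intro integrable_cis_mult integrable_mult_indicator that assms)
  have "fourier_integral g x = (LINT \<omega>|lborel. cis (x \<bullet> \<omega>) * (indicator (cball 0 R) \<omega> *\<^sub>R g \<omega>) + cis (x \<bullet> \<omega>) * (indicator (- cball 0 R) \<omega> *\<^sub>R g \<omega>))"
    unfolding fourier_integral_def by (intro Bochner_Integration.integral_cong) (auto simp: indicator_def)
  also have "\<dots> = fourier_integral (\<lambda>\<omega>. indicator (cball 0 R) \<omega> *\<^sub>R g \<omega>) x + fourier_integral (\<lambda>\<omega>. indicator (- cball 0 R) \<omega> *\<^sub>R g \<omega>) x"
    unfolding fourier_integral_def by (intro Bochner_Integration.integral_add 1) auto
  finally show ?thesis
    by (simp add: truncated_inverse_fourier_eq scaleR_add_right)
qed

text \<open>The squared normalising constant is the inverse of the Plancherel constant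
  \<open>(2 * pi) ^ DIM('a)\<close>, which leaves a contraction in L2.\<close>

lemma nn_integral_fourier_const_le:
  fixes h :: "'a::euclidean_space \<Rightarrow> complex"
  assumes h: "integrable lborel h"
  shows "(\<integral>\<^sup>+x. ennreal ((norm (fourier_const TYPE('a) *\<^sub>R fourier_integral h x))\<^sup>2) \<partial>lborel) \<le>
     (\<integral>\<^sup>+x. ennreal ((norm (h x))\<^sup>2) \<partial>lborel)"
proof -
  let ?N = "fourier_const TYPE('a)"
  note [measurable] = fourier_integral_measurable[OF h]
  have "(\<integral>\<^sup>+x. ennreal ((norm (?N *\<^sub>R fourier_integral h x))\<^sup>2) \<partial>lborel) =
      ennreal (?N\<^sup>2) * (\<integral>\<^sup>+x. ennreal ((norm (fourier_integral h x))\<^sup>2) \<partial>lborel)"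
    by (subst nn_integral_cmult[symmetric]) (auto simp: power_mult_distrib ennreal_mult)
  also have "\<dots> \<le> ennreal (?N\<^sup>2) * (ennreal ((2 * pi) ^ DIM('a)) * (\<integral>\<^sup>+x. ennreal ((norm (h x))\<^sup>2) \<partial>lborel))"
    by (intro mult_left_mono plancherel_le h) simp
  also have "\<dots> = ennreal (?N\<^sup>2 * (2 * pi) ^ DIM('a)) * (\<integral>\<^sup>+x. ennreal ((norm (h x))\<^sup>2) \<partial>lborel)"
    by (subst ennreal_mult) (auto simp: mult.assoc)
  finally show ?thesis by (simp only: fourier_const_power2 ennreal_1 mult_1)
qed

text \<open>The Plancherel inequality bounds the mean square error of truncation by the mass of
  \<open>(norm (g \<omega>))\<^sup>2\<close> outside \<open>cball 0 R\<close>. This is how an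
  explicit Sobolev function is later produced from its transform.\<close>

lemma has_fourier_transform_fourier_integral:
  fixes g :: "'a::euclidean_space \<Rightarrow> complex"
  assumes g: "integrable lborel g" and sq: "square_integrable g"
  shows "has_fourier_transform (\<lambda>x. fourier_const TYPE('a) *\<^sub>R fourier_integral g x) g"
  unfolding has_fourier_transform_def
proof (intro conjI sq)
  let ?N = "fourier_const TYPE('a)"
  note [measurable] = fourier_integral_measurable[OF g] square_integrable_borel[OF sq]
  have isq: "integrable lborel (\<lambda>x. (norm (g x))\<^sup>2)" using sq by (simp add: square_integrable_def)
  have fin: "(\<integral>\<^sup>+x. ennreal ((norm (g x))\<^sup>2) \<partial>lborel) < \<infinity>"
    using isq by (simp add: nn_integral_eq_integral)
  show "square_integrable (\<lambda>x. ?N *\<^sub>R fourier_integral g x)"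
    unfolding square_integrable_def
  proof (intro conjI integrableI_nonneg)
    show "(\<integral>\<^sup>+x. ennreal ((norm (?N *\<^sub>R fourier_integral g x))\<^sup>2) \<partial>lborel) < \<infinity>"
      using order.strict_trans1[OF nn_integral_fourier_const_le[OF g] fin] .
  qed auto
  let ?h = "\<lambda>R \<omega>. indicator (- cball 0 R) \<omega> *\<^sub>R g \<omega>"
  have le: "(\<integral>\<^sup>+x. ennreal ((norm (truncated_inverse_fourier R g x - ?N *\<^sub>R fourier_integral g x))\<^sup>2) \<partial>lborel)
     \<le> ennreal (LINT \<omega>|lborel. indicator (- cball 0 R) \<omega> * (norm (g \<omega>))\<^sup>2)" for R
  proof -
    have "(\<integral>\<^sup>+x. ennreal ((norm (truncated_inverse_fourier R g x - ?N *\<^sub>R fourier_integral g x))\<^sup>2) \<partial>lborel)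
       = (\<integral>\<^sup>+x. ennreal ((norm (?N *\<^sub>R fourier_integral (?h R) x))\<^sup>2) \<partial>lborel)"
      unfolding truncated_inverse_fourier_diff[OF g] norm_minus_cancel ..
    also have "\<dots> \<le> (\<integral>\<^sup>+x. ennreal ((norm (?h R x))\<^sup>2) \<partial>lborel)"
      by (intro nn_integral_fourier_const_le integrable_mult_indicator g) simp
    also have "\<dots> = (\<integral>\<^sup>+\<omega>. ennreal (indicator (- cball 0 R) \<omega> * (norm (g \<omega>))\<^sup>2) \<partial>lborel)"
      by (intro nn_integral_cong) (auto simp: indicator_def)
    also have "\<dots> = ennreal (LINT \<omega>|lborel. indicator (- cball 0 R) \<omega> * (norm (g \<omega>))\<^sup>2)"
      using integrable_mult_indicator[OF _ isq, of "- cball 0 R"]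
      by (intro nn_integral_eq_integral) auto
    finally show ?thesis .
  qed
  have "((\<lambda>R. LINT \<omega>|lborel. indicator (- cball 0 R) \<omega> * (norm (g \<omega>))\<^sup>2) \<longlongrightarrow> (LINT \<omega>|(lborel::'a measure). 0)) at_top"
  proof (rule integral_dominated_convergence_at_top[where w="\<lambda>\<omega>. (norm (g \<omega>))\<^sup>2"])
    show "AE \<omega> in lborel. ((\<lambda>R. indicator (- cball 0 R) \<omega> * (norm (g \<omega>))\<^sup>2) \<longlongrightarrow> 0) at_top"
    proof (intro AE_I2)
      fix \<omega> :: 'a
      have "\<forall>\<^sub>F R in at_top. indicator (- cball 0 R) \<omega> * (norm (g \<omega>))\<^sup>2 = 0"
        using eventually_ge_at_top[of "norm \<omega>"] by eventually_elim (simp add: indicator_def)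
      then show "((\<lambda>R. indicator (- cball 0 R) \<omega> * (norm (g \<omega>))\<^sup>2) \<longlongrightarrow> 0) at_top"
        by (rule tendsto_eventually)
    qed
    show "\<forall>\<^sub>F R in at_top. AE \<omega> in lborel. norm (indicator (- cball 0 R) \<omega> * (norm (g \<omega>))\<^sup>2) \<le> (norm (g \<omega>))\<^sup>2"
      by (intro always_eventually allI AE_I2) (auto simp: indicator_def)
  qed (use isq in auto)
  then have "((\<lambda>R. ennreal (LINT \<omega>|lborel. indicator (- cball 0 R) \<omega> * (norm (g \<omega>))\<^sup>2)) \<longlongrightarrow> ennreal 0) at_top"
    by (intro tendsto_ennrealI) simp
  then show "((\<lambda>R. \<integral>\<^sup>+x. ennreal ((norm (truncated_inverse_fourier R g x - ?N *\<^sub>R fourier_integral g x))\<^sup>2) \<partial>lborel) \<longlongrightarrow> 0) at_top"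
    unfolding ennreal_0
    by (rule tendsto_sandwich[OF _ _ tendsto_const, rotated 2]) (intro always_eventually allI zero_le le)+
qed

text \<open>For integrable \<open>g\<close> the truncated integrals also converge at every point;
  Fatou's lemma makes the pointwise limit agree with the limit in the mean.\<close>

lemma has_fourier_transform_AE_eq:
  fixes g :: "'a::euclidean_space \<Rightarrow> complex"
  assumes T: "has_fourier_transform F g" and g: "integrable lborel g"
  shows "AE x in lborel. F x = fourier_const TYPE('a) *\<^sub>R fourier_integral g x"
proof -
  let ?V = "\<lambda>x. fourier_const TYPE('a) *\<^sub>R fourier_integral g x"
  let ?T = "\<lambda>n x. truncated_inverse_fourier (real n) g x"
  have [measurable]: "F \<in> borel_measurable borel" "g \<in> borel_measurable borel"
    using T by (auto simp: has_fourier_transform_def square_integrable_def)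
  note [measurable] = fourier_integral_measurable[OF g]
  have ti: "integrable lborel (\<lambda>\<omega>. indicator (cball 0 R) \<omega> *\<^sub>R g \<omega>)" for R
    by (intro integrable_mult_indicator g) simp
  have [measurable]: "?T n \<in> borel_measurable borel" for n
    unfolding truncated_inverse_fourier_eq[abs_def] using fourier_integral_measurable[OF ti] by simp
  have conv: "(\<lambda>n. ?T n x) \<longlonglongrightarrow> ?V x" for x
    unfolding truncated_inverse_fourier_eq fourier_integral_def
  proof (intro tendsto_scaleR tendsto_const integral_dominated_convergence[where w="\<lambda>\<omega>. norm (g \<omega>)"])
    show "AE \<omega> in lborel. (\<lambda>n. cis (x \<bullet> \<omega>) * indicat_real (cball 0 (real n)) \<omega> *\<^sub>R g \<omega>) \<longlonglongrightarrow> cis (x \<bullet> \<omega>) * g \<omega>"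
    proof (intro AE_I2)
      fix \<omega> :: 'a
      obtain N where N: "norm \<omega> \<le> real N" using real_arch_simple by blast
      have "\<forall>\<^sub>F n in sequentially. cis (x \<bullet> \<omega>) * indicat_real (cball 0 (real n)) \<omega> *\<^sub>R g \<omega> = cis (x \<bullet> \<omega>) * g \<omega>"
        using eventually_ge_at_top[of N] by eventually_elim (use N in \<open>simp add: indicator_def\<close>)
      then show "(\<lambda>n. cis (x \<bullet> \<omega>) * indicat_real (cball 0 (real n)) \<omega> *\<^sub>R g \<omega>) \<longlonglongrightarrow> cis (x \<bullet> \<omega>) * g \<omega>"
        by (rule tendsto_eventually)
    qed
  qed (use g in \<open>auto simp: norm_mult indicator_def\<close>)
  have "(\<integral>\<^sup>+x. ennreal ((norm (?V x - F x))\<^sup>2) \<partial>lborel) = (\<integral>\<^sup>+x. liminf (\<lambda>n. ennreal ((norm (?T n x - F x))\<^sup>2)) \<partial>lborel)"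
  proof (intro nn_integral_cong)
    fix x
    have "(\<lambda>n. ennreal ((norm (?T n x - F x))\<^sup>2)) \<longlonglongrightarrow> ennreal ((norm (?V x - F x))\<^sup>2)"
      by (intro tendsto_ennrealI tendsto_power tendsto_norm tendsto_diff tendsto_const conv)
    from lim_imp_Liminf[OF _ this]
    show "ennreal ((norm (?V x - F x))\<^sup>2) = liminf (\<lambda>n. ennreal ((norm (?T n x - F x))\<^sup>2))" by simp
  qed
  also have "\<dots> \<le> liminf (\<lambda>n. \<integral>\<^sup>+x. ennreal ((norm (?T n x - F x))\<^sup>2) \<partial>lborel)"
    by (rule nn_integral_liminf) auto
  also have "\<dots> = 0"
  proof (rule lim_imp_Liminf)
    have "((\<lambda>R. \<integral>\<^sup>+x. ennreal ((norm (truncated_inverse_fourier R g x - F x))\<^sup>2) \<partial>lborel) \<longlongrightarrow> 0) at_top"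
      using T by (simp add: has_fourier_transform_def)
    from filterlim_compose[OF this filterlim_real_sequentially]
    show "(\<lambda>n. \<integral>\<^sup>+x. ennreal ((norm (?T n x - F x))\<^sup>2) \<partial>lborel) \<longlonglongrightarrow> 0" .
  qed simp
  finally have "(\<integral>\<^sup>+x. ennreal ((norm (?V x - F x))\<^sup>2) \<partial>lborel) = 0" by simp
  then have "AE x in lborel. ennreal ((norm (?V x - F x))\<^sup>2) = 0"
    by (subst (asm) nn_integral_0_iff_AE) auto
  then show ?thesis by (auto elim!: eventually_mono)
qed

text \<open>The Fourier side of the Sobolev embedding: \<open>norm (g \<omega>)\<close> is the
  product of the square roots of \<open>bessel_weight (- s) \<omega>\<close> and of the integrand of
  the Bessel norm, and the arithmetic-geometric mean inequality bounds it by their sum.\<close>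

lemma bessel_finite_imp_integrable:
  fixes g :: "'a::euclidean_space \<Rightarrow> complex"
  assumes sq: "square_integrable g" and fin: "bessel_finite s g" and s: "s > real DIM('a) / 2"
  shows "integrable lborel g"
proof (rule Bochner_Integration.integrable_bound)
  show "integrable lborel (\<lambda>\<omega>. bessel_weight (- s) \<omega> + bessel_weight s \<omega> * (norm (g \<omega>))\<^sup>2)"
    using fin integrable_bessel_weight[OF s] unfolding bessel_finite_def bessel_weight_def[symmetric]
    by (intro Bochner_Integration.integrable_add)
  show "g \<in> borel_measurable lborel" using square_integrable_borel[OF sq] by simp
  show "AE \<omega> in lborel. norm (g \<omega>) \<le> norm (bessel_weight (- s) \<omega> + bessel_weight s \<omega> * (norm (g \<omega>))\<^sup>2)"
  proof (intro AE_I2)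
    fix \<omega>
    let ?a = "bessel_weight (- s/2) \<omega>" and ?b = "bessel_weight (s/2) \<omega> * norm (g \<omega>)"
    have "2 * (?a * ?b) \<le> ?a\<^sup>2 + ?b\<^sup>2" using sum_squares_bound[of ?a ?b] by simp
    moreover have "?a * ?b = norm (g \<omega>)" by (simp add: bessel_weight_add flip: mult.assoc)
    moreover have "?a\<^sup>2 = bessel_weight (- s) \<omega>" by (simp add: power2_eq_square bessel_weight_add)
    moreover have "?b\<^sup>2 = bessel_weight s \<omega> * (norm (g \<omega>))\<^sup>2"
      by (simp add: power_mult_distrib) (simp add: power2_eq_square bessel_weight_add)
    ultimately have "2 * norm (g \<omega>) \<le> bessel_weight (- s) \<omega> + bessel_weight s \<omega> * (norm (g \<omega>))\<^sup>2"
      by (simp only:)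
    then show "norm (g \<omega>) \<le> norm (bessel_weight (- s) \<omega> + bessel_weight s \<omega> * (norm (g \<omega>))\<^sup>2)"
      unfolding real_norm_def using norm_ge_zero[of "g \<omega>"] by linarith
  qed
qed

section \<open>Continuous representatives on Lipschitz regions\<close>

text \<open>From a frontier point \<open>p\<close> of the region one moves a distance
  \<open>t\<close> along \<open>u\<close>; a small ball around the new point stays above the graph
  of \<gamma>, since its projections stay close to that of \<open>p\<close>.\<close>

lemma compact_lipschitz_region_subset_closure_interior:
  assumes "compact_lipschitz_region \<Omega>"
  shows "\<Omega> \<subseteq> closure (interior \<Omega>)"
proof
  fix p assume p: "p \<in> \<Omega>"
  show "p \<in> closure (interior \<Omega>)"
  proof (cases "p \<in> interior \<Omega>")
    case True
    then show ?thesis using closure_subset by blast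
  next
    case False
    with p have "p \<in> frontier \<Omega>" using closure_subset[of \<Omega>] by (auto simp: frontier_def)
    then obtain r u L \<gamma> where r: "r > 0" and u: "norm u = 1" and L: "L-lipschitz_on {y. y \<bullet> u = 0} \<gamma>"
      and G: "\<And>x. x \<in> ball p r \<Longrightarrow> x \<in> \<Omega> \<longleftrightarrow> \<gamma> (x - (x \<bullet> u) *\<^sub>R u) \<le> x \<bullet> u"
      using assms unfolding compact_lipschitz_region_def by blast
    have L0: "L \<ge> 0" using L by (rule lipschitz_on_nonneg)
    have uu: "u \<bullet> u = 1" using u by (simp add: norm_eq_1)
    have gp: "\<gamma> (p - (p \<bullet> u) *\<^sub>R u) \<le> p \<bullet> u" using G[of p] r p by simp
    show ?thesis
      unfolding closure_approachable
    proof (intro allI impI)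
      fix \<epsilon> :: real assume \<epsilon>: "\<epsilon> > 0"
      define t where "t = min \<epsilon> r / 2"
      \<comment> \<open>\<open>r - t\<close> keeps the ball inside the chart. On the ball \<gamma>
        exceeds its value at \<open>p\<close> by at most \<open>2 * L * \<delta>\<close>, while the
        height is at least \<open>p \<bullet> u + t - \<delta>\<close>; hence
        \<open>t / (1 + 2 * L)\<close>. The 2 is a crude bound for the norm of the projection along
        \<open>u\<close>.\<close>
      define \<delta> where "\<delta> = min (r - t) (t / (1 + 2 * L))"
      have t: "t > 0" "t < \<epsilon>" "t < r" using \<epsilon> r by (auto simp: t_def)
      have \<delta>: "\<delta> > 0" using t L0 by (simp add: \<delta>_def)
      have \<delta>t: "\<delta> * (1 + 2 * L) \<le> t"
        using L0 by (simp add: \<delta>_def min_le_iff_disj pos_le_divide_eq[symmetric])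
      define z where "z = p + t *\<^sub>R u"
      have "ball z \<delta> \<subseteq> \<Omega>"
      proof
        fix x assume "x \<in> ball z \<delta>"
        then have xz: "norm (x - z) < \<delta>" by (simp add: dist_norm norm_minus_commute)
        have "norm (x - p) \<le> norm (x - z) + norm (z - p)" by norm
        then have xp: "x \<in> ball p r"
          using xz t u by (simp add: z_def dist_norm norm_minus_commute \<delta>_def)
        have iu: "\<bar>(x - z) \<bullet> u\<bar> \<le> norm (x - z)"
          using Cauchy_Schwarz_ineq2[of "x - z" u] u by simp
        have "(x - (x \<bullet> u) *\<^sub>R u) - (p - (p \<bullet> u) *\<^sub>R u) = (x - z) - ((x - z) \<bullet> u) *\<^sub>R u"
          by (simp add: z_def algebra_simps inner_simps uu)
        then have "dist (x - (x \<bullet> u) *\<^sub>R u) (p - (p \<bullet> u) *\<^sub>R u) \<le> norm (x - z) + norm (((x - z) \<bullet> u) *\<^sub>R u)"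
          unfolding dist_norm by (metis norm_triangle_ineq4)
        then have d: "dist (x - (x \<bullet> u) *\<^sub>R u) (p - (p \<bullet> u) *\<^sub>R u) \<le> 2 * \<delta>"
          using iu xz u by simp
        have "dist (\<gamma> (x - (x \<bullet> u) *\<^sub>R u)) (\<gamma> (p - (p \<bullet> u) *\<^sub>R u)) \<le> L * dist (x - (x \<bullet> u) *\<^sub>R u) (p - (p \<bullet> u) *\<^sub>R u)"
          by (rule lipschitz_onD[OF L]) (auto simp: inner_simps uu)
        also have "\<dots> \<le> L * (2 * \<delta>)" by (rule mult_left_mono[OF d L0])
        finally have "\<gamma> (x - (x \<bullet> u) *\<^sub>R u) \<le> p \<bullet> u + L * (2 * \<delta>)"
          using gp by (simp add: dist_real_def)
        also have "\<dots> \<le> p \<bullet> u + t - \<delta>" using \<delta>t by (simp add: algebra_simps)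
        also have "\<dots> \<le> x \<bullet> u" using iu xz by (simp add: z_def inner_simps uu)
        finally show "x \<in> \<Omega>" using G[OF xp] by simp
      qed
      then have "z \<in> interior \<Omega>" using \<delta> mem_interior by blast
      moreover have "dist z p < \<epsilon>" using t u by (simp add: z_def dist_norm)
      ultimately show "\<exists>y\<in>interior \<Omega>. dist y p < \<epsilon>" by blast
    qed
  qed
qed

text \<open>Functions that differ at an interior point differ on a ball, which has positive measure;
  the remaining points of \<Omega> are limits of interior points.\<close>

lemma AE_eq_imp_eq_of_continuous_on:
  fixes f g :: "'a::euclidean_space \<Rightarrow> 'b::t2_space"
  assumes \<Omega>: "\<Omega> \<subseteq> closure (interior \<Omega>)"
    and f: "continuous_on \<Omega> f" and g: "continuous_on \<Omega> g"
    and ae: "AE x in lborel. x \<in> \<Omega> \<longrightarrow> f x = g x" and x: "x \<in> \<Omega>"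
  shows "f x = g x"
proof -
  have sub: "interior \<Omega> \<subseteq> \<Omega>" by (rule interior_subset)
  have int: "f z = g z" if z: "z \<in> interior \<Omega>" for z
  proof (rule ccontr)
    assume "f z \<noteq> g z"
    then obtain U V where UV: "open U" "open V" "f z \<in> U" "g z \<in> V" "U \<inter> V = {}"
      using hausdorff by metis
    have "open (f -` U \<inter> interior \<Omega>)" "open (g -` V \<inter> interior \<Omega>)"
      using continuous_on_subset[OF f sub] continuous_on_subset[OF g sub] UV(1,2)
      by (auto simp: continuous_on_open_vimage)
    then have "open ((f -` U \<inter> interior \<Omega>) \<inter> (g -` V \<inter> interior \<Omega>))" by (rule open_Int)
    moreover have "z \<in> (f -` U \<inter> interior \<Omega>) \<inter> (g -` V \<inter> interior \<Omega>)" using z UV by simp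
    ultimately obtain e where e: "e > 0" "ball z e \<subseteq> (f -` U \<inter> interior \<Omega>) \<inter> (g -` V \<inter> interior \<Omega>)"
      by (meson open_contains_ball)
    obtain N where N: "{x \<in> space lborel. \<not> (x \<in> \<Omega> \<longrightarrow> f x = g x)} \<subseteq> N" "emeasure lborel N = 0" "N \<in> sets lborel"
      by (rule AE_E[OF ae])
    have "ball z e \<subseteq> N"
    proof
      fix w assume "w \<in> ball z e"
      then have w: "f w \<in> U" "g w \<in> V" "w \<in> interior \<Omega>" using e(2) by auto
      then have "f w \<noteq> g w" using UV(5) by (metis IntI empty_iff)
      then have "w \<in> {x \<in> space lborel. \<not> (x \<in> \<Omega> \<longrightarrow> f x = g x)}" using w(3) sub by auto
      then show "w \<in> N" by (rule subsetD[OF N(1)])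
    qed
    then have "emeasure lborel (ball z e) \<le> 0"
      using emeasure_mono[OF _ N(3)] N(2) by metis
    then show False
      using e(1) unit_ball_vol_pos[of "real DIM('a)"] by (simp add: emeasure_ball mult_le_0_iff not_le)
  qed
  obtain u where u: "\<And>n. u n \<in> interior \<Omega>" "u \<longlonglongrightarrow> x"
    using x \<Omega> by (meson closure_sequential subsetD)
  have "\<forall>\<^sub>F n in sequentially. u n \<in> \<Omega>" using u(1) sub by (intro always_eventually) blast
  then have "(\<lambda>n. f (u n)) \<longlonglongrightarrow> f x" "(\<lambda>n. g (u n)) \<longlonglongrightarrow> g x"
    using x by (auto intro!: continuous_on_tendsto_compose[OF f u(2)] continuous_on_tendsto_compose[OF g u(2)])
  then show ?thesis
    unfolding int[OF u(1)] by (rule LIMSEQ_unique)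
qed

text \<open>Interpolation uses values on a finite, hence null, set, so the almost everywhere
  identity has to be upgraded to every point of \<Omega>.\<close>

lemma sobolev_extension_eq_fourier_integral:
  fixes \<Omega> :: "'a::euclidean_space set"
  assumes "compact_lipschitz_region \<Omega>" "continuous_on \<Omega> f"
    and E: "sobolev_extension s \<Omega> f F g" and s: "s > real DIM('a) / 2" and x: "x \<in> \<Omega>"
  shows "complex_of_real (f x) = fourier_const TYPE('a) *\<^sub>R fourier_integral g x"
proof -
  have T: "has_fourier_transform F g" and fin: "bessel_finite s g"
    and ae: "AE x in lborel. x \<in> \<Omega> \<longrightarrow> F x = complex_of_real (f x)"
    using E by (auto simp: sobolev_extension_def)
  have g: "integrable lborel g"
    using T by (intro bessel_finite_imp_integrable[OF _ fin s]) (simp add: has_fourier_transform_def)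
  have "AE x in lborel. x \<in> \<Omega> \<longrightarrow> complex_of_real (f x) = fourier_const TYPE('a) *\<^sub>R fourier_integral g x"
    using ae has_fourier_transform_AE_eq[OF T g] by eventually_elim auto
  then show ?thesis
    by (rule AE_eq_imp_eq_of_continuous_on[OF compact_lipschitz_region_subset_closure_interior[OF assms(1)], rotated 2])
       (use x assms(2) continuous_on_subset[OF continuous_on_fourier_integral[OF g]] in \<open>auto intro!: continuous_intros\<close>)
qed

section \<open>Exponential sums over separated points\<close>

text \<open>The Fourier integral of the discrete measure with mass \<open>\<alpha> y\<close> at
  \<open>y\<close>. Complex coefficients make room for modulation, the counterpart of a translation
  in frequency.\<close>

definition trig_sum :: "'a::euclidean_space set \<Rightarrow> ('a \<Rightarrow> complex) \<Rightarrow> 'a \<Rightarrow> complex" where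
  "trig_sum S \<alpha> \<omega> = (\<Sum>y\<in>S. \<alpha> y * cis (y \<bullet> \<omega>))"

lemma trig_sum_measurable [measurable]: "trig_sum S \<alpha> \<in> borel_measurable borel"
  unfolding trig_sum_def[abs_def] by measurable

lemma norm_trig_sum_le: "norm (trig_sum S \<alpha> \<omega>) \<le> (\<Sum>y\<in>S. norm (\<alpha> y))"
  unfolding trig_sum_def by (rule order_trans[OF norm_sum]) (simp add: norm_mult)

lemma integrable_trig_sum_mult:
  assumes w: "integrable lborel w"
  shows "integrable lborel (\<lambda>\<omega>. (norm (trig_sum S \<alpha> \<omega>))\<^sup>2 * w \<omega> :: real)"
proof (rule Bochner_Integration.integrable_bound)
  let ?M = "(\<Sum>y\<in>S. norm (\<alpha> y))\<^sup>2"
  show "integrable lborel (\<lambda>\<omega>. ?M * norm (w \<omega>))" using w by simp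
  show "(\<lambda>\<omega>. (norm (trig_sum S \<alpha> \<omega>))\<^sup>2 * w \<omega>) \<in> borel_measurable lborel"
    using borel_measurable_integrable[OF w] by measurable
  have "(norm (trig_sum S \<alpha> \<omega>))\<^sup>2 * \<bar>w \<omega>\<bar> \<le> ?M * \<bar>w \<omega>\<bar>" for \<omega>
    by (intro mult_right_mono power_mono norm_trig_sum_le) auto
  then show "AE \<omega> in lborel. norm ((norm (trig_sum S \<alpha> \<omega>))\<^sup>2 * w \<omega>) \<le> norm (?M * norm (w \<omega>))"
    by (simp add: abs_mult)
qed

section \<open>Gaussian averages and diagonal dominance\<close>

text \<open>Expanding the square gives \<open>G\<close> times the quadratic form of the matrix with
  entries \<open>gauss (1/s) (y - z)\<close>. The diagonal contributes \<open>G * M\<close>;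
  off-diagonal row sums of at most 1/2 make the rest at most half of that.\<close>

lemma trig_sum_gauss_bounds_centered:
  fixes S :: "'a::euclidean_space set" and \<alpha> :: "'a \<Rightarrow> complex"
  assumes S: "finite S" and s: "s > 0"
    and row: "\<And>y. y \<in> S \<Longrightarrow> (\<Sum>z\<in>S - {y}. gauss (1/s) (y - z)) \<le> 1/2"
  defines "G \<equiv> (sqrt (2 * pi) * s) ^ DIM('a)" and "M \<equiv> \<Sum>y\<in>S. (norm (\<alpha> y))\<^sup>2"
  shows "\<bar>(LINT \<omega>|lborel. (norm (trig_sum S \<alpha> \<omega>))\<^sup>2 * gauss s \<omega>) - G * M\<bar> \<le> G * M / 2"
proof -
  let ?g = "gauss (1/s) :: 'a \<Rightarrow> real"
  have G0: "G \<ge> 0" using s by (simp add: G_def)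
  have sq: "complex_of_real ((norm (trig_sum S \<alpha> \<omega>))\<^sup>2) = (\<Sum>y\<in>S. \<Sum>z\<in>S. \<alpha> y * cnj (\<alpha> z) * cis ((y - z) \<bullet> \<omega>))" for \<omega>
  proof -
    have "complex_of_real ((norm (trig_sum S \<alpha> \<omega>))\<^sup>2) = trig_sum S \<alpha> \<omega> * cnj (trig_sum S \<alpha> \<omega>)"
      by (rule complex_norm_square)
    also have "cnj (trig_sum S \<alpha> \<omega>) = (\<Sum>z\<in>S. cnj (\<alpha> z) * cis (- (z \<bullet> \<omega>)))"
      by (simp add: trig_sum_def cis_cnj)
    also have "trig_sum S \<alpha> \<omega> * \<dots> = (\<Sum>y\<in>S. \<Sum>z\<in>S. \<alpha> y * cis (y \<bullet> \<omega>) * (cnj (\<alpha> z) * cis (- (z \<bullet> \<omega>))))"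
      unfolding trig_sum_def by (rule sum_product)
    also have "\<dots> = (\<Sum>y\<in>S. \<Sum>z\<in>S. \<alpha> y * cnj (\<alpha> z) * cis ((y - z) \<bullet> \<omega>))"
    proof (intro sum.cong refl)
      fix y z
      have "cis ((y - z) \<bullet> \<omega>) = cis (y \<bullet> \<omega>) * cis (- (z \<bullet> \<omega>))"
        by (simp add: cis_mult inner_diff_left)
      then show "\<alpha> y * cis (y \<bullet> \<omega>) * (cnj (\<alpha> z) * cis (- (z \<bullet> \<omega>))) = \<alpha> y * cnj (\<alpha> z) * cis ((y - z) \<bullet> \<omega>)"
        by (simp only: mult_ac)
    qed
    finally show ?thesis .
  qed
  have "complex_of_real (LINT \<omega>|lborel. (norm (trig_sum S \<alpha> \<omega>))\<^sup>2 * gauss s \<omega>) =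
      (LINT \<omega>|lborel. (\<Sum>y\<in>S. \<Sum>z\<in>S. \<alpha> y * cnj (\<alpha> z) * (cis ((y - z) \<bullet> \<omega>) * of_real (gauss s \<omega>))))"
    unfolding integral_complex_of_real[symmetric] of_real_mult sq
    by (simp only: sum_distrib_right mult.assoc)
  also have "\<dots> = (\<Sum>y\<in>S. \<Sum>z\<in>S. \<alpha> y * cnj (\<alpha> z) * fourier_integral (\<lambda>\<omega>. of_real (gauss s \<omega>)) (y - z))"
  proof -
    have int: "integrable lborel (\<lambda>\<omega>. \<alpha> y * cnj (\<alpha> z) * (cis ((y - z) \<bullet> \<omega>) * of_real (gauss s \<omega>)))" for y z
      using has_fourier_integral_gauss[OF s, of "y - z"] by (simp add: has_bochner_integral_iff)
    show ?thesis
      unfolding fourier_integral_def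
      by (simp only: Bochner_Integration.integral_sum int Bochner_Integration.integrable_sum Bochner_Integration.integral_mult_right_zero)
  qed
  also have "\<dots> = (\<Sum>y\<in>S. \<Sum>z\<in>S. \<alpha> y * cnj (\<alpha> z) * of_real (G * ?g (y - z)))"
    unfolding fourier_integral_gauss[OF s] G_def ..
  also have "\<dots> = (\<Sum>y\<in>S. of_real (G * (norm (\<alpha> y))\<^sup>2) + (\<Sum>z\<in>S - {y}. \<alpha> y * cnj (\<alpha> z) * of_real (G * ?g (y - z))))"
  proof (intro sum.cong refl)
    fix y assume y: "y \<in> S"
    have g0: "?g (y - y) = 1" by (simp add: gauss_def)
    have "complex_of_real (G * (norm (\<alpha> y))\<^sup>2) = \<alpha> y * cnj (\<alpha> y) * of_real (G * ?g (y - y))"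
      unfolding of_real_mult complex_norm_square g0 by simp
    then show "(\<Sum>z\<in>S. \<alpha> y * cnj (\<alpha> z) * of_real (G * ?g (y - z))) =
       of_real (G * (norm (\<alpha> y))\<^sup>2) + (\<Sum>z\<in>S - {y}. \<alpha> y * cnj (\<alpha> z) * of_real (G * ?g (y - z)))"
      by (simp only: sum.remove[OF S y])
  qed
  also have "\<dots> = of_real (G * M) + (\<Sum>y\<in>S. \<Sum>z\<in>S - {y}. \<alpha> y * cnj (\<alpha> z) * of_real (G * ?g (y - z)))"
    by (simp only: sum.distrib M_def sum_distrib_left of_real_sum)
  finally have eq: "complex_of_real (LINT \<omega>|lborel. (norm (trig_sum S \<alpha> \<omega>))\<^sup>2 * gauss s \<omega>) - of_real (G * M) =
      (\<Sum>y\<in>S. \<Sum>z\<in>S - {y}. \<alpha> y * cnj (\<alpha> z) * of_real (G * ?g (y - z)))" by (simp only: add_diff_cancel_left')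
  have "\<bar>(LINT \<omega>|lborel. (norm (trig_sum S \<alpha> \<omega>))\<^sup>2 * gauss s \<omega>) - G * M\<bar> =
      norm (\<Sum>y\<in>S. \<Sum>z\<in>S - {y}. \<alpha> y * cnj (\<alpha> z) * complex_of_real (G * ?g (y - z)))"
    unfolding eq[symmetric] of_real_diff[symmetric] norm_of_real ..
  also have "\<dots> \<le> (\<Sum>y\<in>S. \<Sum>z\<in>S - {y}. norm (\<alpha> y * cnj (\<alpha> z) * complex_of_real (G * ?g (y - z))))"
    by (intro order_trans[OF norm_sum] sum_mono norm_sum)
  \<comment> \<open>Each product is split into squares; as the matrix is symmetric, the two
    resulting double sums agree and both are controlled by the row sums.\<close>
  also have "\<dots> \<le> (\<Sum>y\<in>S. \<Sum>z\<in>S - {y}. G / 2 * ((norm (\<alpha> y))\<^sup>2 * ?g (y - z)) + G / 2 * ((norm (\<alpha> z))\<^sup>2 * ?g (y - z)))"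
  proof (intro sum_mono)
    fix y z
    have "norm (\<alpha> y) * norm (\<alpha> z) \<le> ((norm (\<alpha> y))\<^sup>2 + (norm (\<alpha> z))\<^sup>2) / 2"
      using sum_squares_bound[of "norm (\<alpha> y)" "norm (\<alpha> z)"] by simp
    then have "norm (\<alpha> y) * norm (\<alpha> z) * (G * ?g (y - z)) \<le> ((norm (\<alpha> y))\<^sup>2 + (norm (\<alpha> z))\<^sup>2) / 2 * (G * ?g (y - z))"
      using G0 by (intro mult_right_mono) auto
    then show "norm (\<alpha> y * cnj (\<alpha> z) * complex_of_real (G * ?g (y - z))) \<le>
       G / 2 * ((norm (\<alpha> y))\<^sup>2 * ?g (y - z)) + G / 2 * ((norm (\<alpha> z))\<^sup>2 * ?g (y - z))"
      using G0 by (simp add: norm_mult algebra_simps add_divide_distrib)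
  qed
  also have "\<dots> = G / 2 * (\<Sum>y\<in>S. \<Sum>z\<in>S - {y}. (norm (\<alpha> y))\<^sup>2 * ?g (y - z)) + G / 2 * (\<Sum>y\<in>S. \<Sum>z\<in>S - {y}. (norm (\<alpha> z))\<^sup>2 * ?g (y - z))"
    by (simp only: sum.distrib sum_distrib_left)
  also have "(\<Sum>y\<in>S. \<Sum>z\<in>S - {y}. (norm (\<alpha> z))\<^sup>2 * ?g (y - z)) = (\<Sum>y\<in>S. \<Sum>z\<in>S - {y}. (norm (\<alpha> y))\<^sup>2 * ?g (y - z))"
  proof -
    have D: "S - {y} = {z \<in> S. z \<noteq> y}" "S - {y} = {z \<in> S. y \<noteq> z}" for y by blast+
    have "(\<Sum>y\<in>S. \<Sum>z\<in>S - {y}. (norm (\<alpha> z))\<^sup>2 * ?g (y - z)) = (\<Sum>y\<in>S. \<Sum>z\<in>{z\<in>S. z \<noteq> y}. (norm (\<alpha> z))\<^sup>2 * ?g (y - z))"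
      unfolding D(1) ..
    also have "\<dots> = (\<Sum>z\<in>S. \<Sum>y\<in>{y\<in>S. z \<noteq> y}. (norm (\<alpha> z))\<^sup>2 * ?g (y - z))"
      by (rule sum.swap_restrict[OF S S])
    also have "\<dots> = (\<Sum>z\<in>S. \<Sum>y\<in>S - {z}. (norm (\<alpha> z))\<^sup>2 * ?g (z - y))"
      unfolding D(2) by (intro sum.cong refl) (simp add: gauss_def norm_minus_commute)
    finally show ?thesis .
  qed
  also have "G / 2 * (\<Sum>y\<in>S. \<Sum>z\<in>S - {y}. (norm (\<alpha> y))\<^sup>2 * ?g (y - z)) + G / 2 * (\<Sum>y\<in>S. \<Sum>z\<in>S - {y}. (norm (\<alpha> y))\<^sup>2 * ?g (y - z)) =
      G * (\<Sum>y\<in>S. (norm (\<alpha> y))\<^sup>2 * (\<Sum>z\<in>S - {y}. ?g (y - z)))"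
    by (simp add: sum_distrib_left)
  also have "\<dots> \<le> G * (\<Sum>y\<in>S. (norm (\<alpha> y))\<^sup>2 * (1/2))"
    by (intro mult_left_mono sum_mono row G0) auto
  also have "\<dots> = G * M / 2"
    unfolding M_def sum_distrib_right[symmetric] by simp
  finally show ?thesis .
qed

text \<open>Shifting the Gaussian to \<open>c\<close> multiplies each coefficient by a number of
  modulus 1, so the centred bound applies with the same sum of squares.\<close>

lemma trig_sum_gauss_upper:
  fixes S :: "'a::euclidean_space set"
  assumes S: "finite S" and s: "s > 0"
    and row: "\<And>y. y \<in> S \<Longrightarrow> (\<Sum>z\<in>S - {y}. gauss (1/s) (y - z)) \<le> 1/2"
  shows "(\<integral>\<^sup>+\<omega>. ennreal ((norm (trig_sum S \<alpha> \<omega>))\<^sup>2 * gauss s (\<omega> - c)) \<partial>lborel)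
    \<le> ennreal (3/2 * (sqrt (2 * pi) * s) ^ DIM('a) * (\<Sum>y\<in>S. (norm (\<alpha> y))\<^sup>2))"
proof -
  let ?\<alpha> = "\<lambda>y. \<alpha> y * cis (y \<bullet> c)"
  have shift: "trig_sum S \<alpha> (c + 1 *\<^sub>R \<omega>) = trig_sum S ?\<alpha> \<omega>" for \<omega>
    by (simp add: trig_sum_def inner_add_right mult.assoc flip: cis_mult)
  have gi: "integrable lborel (gauss s :: 'a \<Rightarrow> real)"
    using has_integral_gauss[OF s, where 'a='a] by (simp add: has_bochner_integral_iff)
  have "(\<integral>\<^sup>+\<omega>. ennreal ((norm (trig_sum S \<alpha> \<omega>))\<^sup>2 * gauss s (\<omega> - c)) \<partial>lborel) =
      (\<integral>\<^sup>+\<omega>. ennreal ((norm (trig_sum S ?\<alpha> \<omega>))\<^sup>2 * gauss s \<omega>) \<partial>lborel)"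
    by (subst nn_integral_lborel_affine[of _ 1 c]) (simp_all only: shift, simp_all)
  also have "\<dots> = ennreal (LINT \<omega>|lborel. (norm (trig_sum S ?\<alpha> \<omega>))\<^sup>2 * gauss s \<omega>)"
    by (intro nn_integral_eq_integral integrable_trig_sum_mult gi) auto
  also have "\<dots> \<le> ennreal (3/2 * (sqrt (2 * pi) * s) ^ DIM('a) * (\<Sum>y\<in>S. (norm (?\<alpha> y))\<^sup>2))"
    using trig_sum_gauss_bounds_centered[OF S s row, of ?\<alpha>] by (intro ennreal_leI) linarith
  finally show ?thesis by (simp add: norm_mult)
qed

lemma trig_sum_gauss_lower:
  fixes S :: "'a::euclidean_space set"
  assumes S: "finite S" and s: "s > 0"
    and row: "\<And>y. y \<in> S \<Longrightarrow> (\<Sum>z\<in>S - {y}. gauss (1/s) (y - z)) \<le> 1/2"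
  shows "(sqrt (2 * pi) * s) ^ DIM('a) * (\<Sum>y\<in>S. (norm (\<alpha> y))\<^sup>2) / 2
    \<le> (LINT \<omega>|lborel. (norm (trig_sum S \<alpha> \<omega>))\<^sup>2 * gauss s \<omega>)"
  using trig_sum_gauss_bounds_centered[OF S s row, of \<alpha>] by linarith

text \<open>
  The value at \<open>z\<close> is compared with the mean of a wider Gaussian over \<open>ball z q\<close>; these balls are
  disjoint, and they keep a distance of at least \<open>q\<close> from \<open>y\<close>.
\<close>

lemma gauss_row_sum_le:
  fixes S :: "'a::euclidean_space set"
  assumes S: "finite S" and q: "q > 0" and s: "s > 0" and y: "y \<in> S"
    and sep: "\<And>y z. y \<in> S \<Longrightarrow> z \<in> S \<Longrightarrow> y \<noteq> z \<Longrightarrow> dist y z \<ge> 2 * q"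
  shows "(\<Sum>z\<in>S - {y}. gauss (1/s) (y - z)) * (unit_ball_vol DIM('a) * (s * q) ^ DIM('a))
     \<le> exp (- ((s * q)\<^sup>2 / 16)) * (sqrt (2 * pi) * sqrt 8) ^ DIM('a)"
proof -
  define V where "V = unit_ball_vol (real DIM('a)) * q ^ DIM('a)"
  define E where "E = exp (- ((s * q)\<^sup>2 / 16))"
  \<comment> \<open>The 8 here and the 16 in \<open>E\<close> come from
    \<open>q\<^sup>2 + (dist y u)\<^sup>2 \<le> 8 * (dist y z)\<^sup>2\<close>: the exponent at
    \<open>z\<close> pays for the factor \<open>E\<close> and for a wider Gaussian at
    \<open>u\<close>.\<close>
  define \<sigma> where "\<sigma> = sqrt 8 / s"
  have V: "V \<ge> 0" "emeasure lborel (ball z q) = ennreal V" for z :: 'a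
    using q by (simp_all add: V_def emeasure_ball)
  have \<sigma>: "\<sigma> > 0" using s by (simp add: \<sigma>_def)
  have pw: "gauss (1/s) (y - z) \<le> E * gauss \<sigma> (y - u)" if z: "z \<in> S - {y}" and u: "u \<in> ball z q" for z u
  proof -
    have d: "2 * q \<le> dist y z" using sep[OF y] z by auto
    have zu: "dist z u < q" using u by simp
    have lo: "q \<le> dist y u" using d zu dist_triangle[of y z u] by (simp add: dist_commute)
    have hi: "dist y u \<le> 2 * dist y z" using d zu dist_triangle[of y u z] q by (simp add: dist_commute)
    have 1: "q\<^sup>2 \<le> (dist y u)\<^sup>2" using lo q by (intro power_mono) auto
    have 2: "(dist y u)\<^sup>2 \<le> 4 * (dist y z)\<^sup>2" using power_mono[OF hi, of 2] by (simp add: power_mult_distrib)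
    have "(s * q)\<^sup>2 / 16 + (dist y u)\<^sup>2 / (2 * \<sigma>\<^sup>2) = s\<^sup>2 * (q\<^sup>2 + (dist y u)\<^sup>2) / 16"
      using s by (simp add: \<sigma>_def power_divide power_mult_distrib field_simps)
    also have "\<dots> \<le> s\<^sup>2 * (8 * (dist y z)\<^sup>2) / 16"
      using 1 2 by (intro divide_right_mono mult_left_mono) auto
    also have "\<dots> = (dist y z)\<^sup>2 / (2 * (1/s)\<^sup>2)"
      using s by (simp add: power_divide field_simps)
    finally have "- ((dist y z)\<^sup>2) / (2 * (1/s)\<^sup>2) \<le> - ((s * q)\<^sup>2 / 16) + - ((dist y u)\<^sup>2) / (2 * \<sigma>\<^sup>2)"
      by simp
    then show ?thesis
      unfolding E_def gauss_def dist_norm exp_add[symmetric] exp_le_cancel_iff .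
  qed
  have disj: "(\<Sum>z\<in>S - {y}. indicator (ball z q) u) \<le> (1 :: ennreal)" for u
  proof (cases "\<exists>z\<in>S - {y}. u \<in> ball z q")
    case True
    then obtain z where z: "z \<in> S - {y}" "u \<in> ball z q" by blast
    have "u \<notin> ball z' q" if "z' \<in> (S - {y}) - {z}" for z'
    proof
      assume "u \<in> ball z' q"
      then have "dist z z' < 2 * q"
        using z(2) dist_triangle[of z z' u] by (simp add: dist_commute)
      then show False using sep[of z z'] z(1) that by auto
    qed
    then have "(\<Sum>z\<in>(S - {y}) - {z}. indicator (ball z q) u) = (0 :: ennreal)"
      by (intro sum.neutral) auto
    then show ?thesis
      using S z by (subst sum.remove[of _ z]) auto
  next
    case False
    then have "(\<Sum>z\<in>S - {y}. indicator (ball z q) u) = (0 :: ennreal)"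
      by (intro sum.neutral) auto
    then show ?thesis by simp
  qed
  have Gm: "(\<lambda>u. ennreal (E * gauss \<sigma> (y - u))) \<in> borel_measurable lborel" by measurable
  have "ennreal ((\<Sum>z\<in>S - {y}. gauss (1/s) (y - z)) * V) = (\<Sum>z\<in>S - {y}. ennreal (gauss (1/s) (y - z) * V))"
    unfolding sum_distrib_right using V(1) by (intro sum_ennreal[symmetric]) auto
  also have "\<dots> = (\<Sum>z\<in>S - {y}. \<integral>\<^sup>+u. ennreal (gauss (1/s) (y - z)) * indicator (ball z q) u \<partial>lborel)"
    by (intro sum.cong refl, subst nn_integral_cmult_indicator) (auto simp: V ennreal_mult)
  also have "\<dots> \<le> (\<Sum>z\<in>S - {y}. \<integral>\<^sup>+u. ennreal (E * gauss \<sigma> (y - u)) * indicator (ball z q) u \<partial>lborel)"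
    by (intro sum_mono nn_integral_mono) (use pw in \<open>auto simp: indicator_def intro!: ennreal_leI\<close>)
  also have "\<dots> = (\<integral>\<^sup>+u. (\<Sum>z\<in>S - {y}. ennreal (E * gauss \<sigma> (y - u)) * indicator (ball z q) u) \<partial>lborel)"
    by (rule nn_integral_sum[symmetric]) (intro borel_measurable_times_ennreal borel_measurable_indicator Gm, simp)
  also have "\<dots> \<le> (\<integral>\<^sup>+u. ennreal (E * gauss \<sigma> (y - u)) \<partial>lborel)"
  proof (intro nn_integral_mono)
    fix u
    show "(\<Sum>z\<in>S - {y}. ennreal (E * gauss \<sigma> (y - u)) * indicator (ball z q) u) \<le> ennreal (E * gauss \<sigma> (y - u))"
      unfolding sum_distrib_left[symmetric] using mult_left_mono[OF disj[of u]] by simp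
  qed
  also have "\<dots> = (\<integral>\<^sup>+u. ennreal E * ennreal (gauss \<sigma> (y - u)) \<partial>lborel)"
    by (intro nn_integral_cong ennreal_mult) (auto simp: E_def)
  also have "\<dots> = ennreal E * ennreal ((sqrt (2 * pi) * \<sigma>) ^ DIM('a))"
    by (subst nn_integral_cmult) (auto simp: nn_integral_gauss[OF \<sigma>])
  also have "\<dots> = ennreal (E * (sqrt (2 * pi) * \<sigma>) ^ DIM('a))"
    using \<sigma> by (intro ennreal_mult[symmetric]) (auto simp: E_def)
  finally have "(\<Sum>z\<in>S - {y}. gauss (1/s) (y - z)) * V \<le> E * (sqrt (2 * pi) * \<sigma>) ^ DIM('a)"
    using \<sigma> by (subst (asm) ennreal_le_iff) (auto simp: E_def)
  from mult_right_mono[OF this, of "s ^ DIM('a)"] s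
  have "(\<Sum>z\<in>S - {y}. gauss (1/s) (y - z)) * (V * s ^ DIM('a)) \<le> E * ((sqrt (2 * pi) * \<sigma>) ^ DIM('a) * s ^ DIM('a))"
    by (simp add: mult.assoc)
  also have "(sqrt (2 * pi) * \<sigma>) ^ DIM('a) * s ^ DIM('a) = (sqrt (2 * pi) * sqrt 8) ^ DIM('a)"
    unfolding power_mult_distrib[symmetric] \<sigma>_def using s by simp
  also have "V * s ^ DIM('a) = unit_ball_vol DIM('a) * (s * q) ^ DIM('a)"
    by (simp add: V_def power_mult_distrib)
  finally show ?thesis unfolding E_def .
qed

text \<open>The preceding bound depends on \<open>s\<close> and \<open>q\<close> only through their
  product and tends to 0 as it grows, so a threshold can be fixed before the point set.\<close>

lemma gauss_row_sum_le_half: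
  obtains \<kappa> where "\<kappa> > 0" "\<And>(S::'a::euclidean_space set) q s y. \<lbrakk>finite S; q > 0; s * q \<ge> \<kappa>; y \<in> S;
     \<And>y z. y \<in> S \<Longrightarrow> z \<in> S \<Longrightarrow> y \<noteq> z \<Longrightarrow> dist y z \<ge> 2 * q\<rbrakk> \<Longrightarrow> (\<Sum>z\<in>S - {y}. gauss (1/s) (y - z)) \<le> 1/2"
proof -
  define V where "V = unit_ball_vol (real DIM('a))"
  define B where "B = (sqrt (2 * pi) * sqrt 8) ^ DIM('a)"
  \<comment> \<open>The 1 makes powers of \<open>t = s * q\<close> at least 1; beyond
    \<open>32 * B / V\<close> the bound \<open>16 / t * B\<close> is at most
    \<open>V / 2\<close>.\<close>
  define \<kappa> where "\<kappa> = max 1 (32 * B / V)"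
  have V: "V > 0" by (simp add: V_def)
  have B: "B > 0" by (simp add: B_def)
  have \<kappa>: "\<kappa> \<ge> 1" "\<kappa> \<ge> 32 * B / V" by (simp_all add: \<kappa>_def)
  have "(\<Sum>z\<in>S - {y}. gauss (1/s) (y - z)) \<le> 1/2"
    if S: "finite S" and q: "q > 0" and t: "s * q \<ge> \<kappa>" and y: "y \<in> S"
     and sep: "\<And>y z. y \<in> S \<Longrightarrow> z \<in> S \<Longrightarrow> y \<noteq> z \<Longrightarrow> dist y z \<ge> 2 * q" for S :: "'a set" and q s y
  proof -
    define t where "t = s * q"
    have t1: "t \<ge> 1" "t \<ge> 32 * B / V" using t \<kappa> by (auto simp: t_def)
    have s: "s > 0" using t1(1) q by (metis t_def less_le_trans zero_less_mult_pos2 zero_less_one)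
    let ?R = "\<Sum>z\<in>S - {y}. gauss (1/s) (y - z)"
    have R0: "?R \<ge> 0" by (simp add: sum_nonneg)
    have e1: "t\<^sup>2 / 16 \<le> exp (t\<^sup>2 / 16)"
      using exp_ge_add_one_self[of "t\<^sup>2 / 16"] by linarith
    have "exp (- (t\<^sup>2 / 16)) = 1 / exp (t\<^sup>2 / 16)" by (simp only: exp_minus inverse_eq_divide)
    also have "\<dots> \<le> 1 / (t\<^sup>2 / 16)"
      using t1 by (intro divide_left_mono[OF e1]) auto
    also have "\<dots> \<le> 16 / t" using t1 by (simp add: power2_eq_square field_simps)
    finally have e: "exp (- (t\<^sup>2 / 16)) \<le> 16 / t" .
    have "?R * V \<le> ?R * (V * t ^ DIM('a))"
      using R0 V t1 by (intro mult_left_mono) (auto simp: one_le_power)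
    also have "\<dots> \<le> exp (- (t\<^sup>2 / 16)) * B"
      using gauss_row_sum_le[OF S q s y sep] by (simp add: t_def V_def B_def)
    also have "\<dots> \<le> 16 / t * B" using e B by (intro mult_right_mono) auto
    also have "\<dots> \<le> V / 2" using t1 V by (simp add: field_simps)
    finally show ?thesis using V by (simp add: field_simps)
  qed
  then show ?thesis using \<kappa>(1) that[of \<kappa>] by auto
qed

section \<open>From Gaussian averages to Bessel weights\<close>

lemma integrable_bessel_weight_scaled:
  assumes b: "b > real DIM('a) / 2" and s: "s > 0"
  shows "integrable lborel (\<lambda>\<omega>::'a::euclidean_space. bessel_weight (- b) ((1/s) *\<^sub>R \<omega>))"
    and "(LINT \<omega>|lborel. bessel_weight (- b) ((1/s) *\<^sub>R (\<omega>::'a))) = s ^ DIM('a) * (LINT \<omega>|lborel. bessel_weight (- b) (\<omega>::'a))"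
proof -
  let ?f = "bessel_weight (- b) :: 'a \<Rightarrow> real"
  show "integrable lborel (\<lambda>\<omega>. ?f ((1/s) *\<^sub>R \<omega>))"
    using lborel_integrable_affine[OF integrable_bessel_weight[OF b], of "1/s" 0] s by simp
  have "(LINT \<omega>|lborel. ?f \<omega>) = (1/s) ^ DIM('a) * (LINT \<omega>|lborel. ?f ((1/s) *\<^sub>R \<omega>))"
    using lborel_integral_affine[of "1/s" ?f 0] s by simp
  then show "(LINT \<omega>|lborel. ?f ((1/s) *\<^sub>R \<omega>)) = s ^ DIM('a) * (LINT \<omega>|lborel. ?f \<omega>)"
    using s by (simp add: power_divide)
qed

text \<open>
  The scaled weight is dominated by its convolution with a Gaussian of the same scale, so that bounds
  for integrals against translated Gaussians yield bounds for integrals against the weight.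
\<close>

lemma bessel_weight_scaled_le_convolution:
  fixes \<omega> :: "'a::euclidean_space"
  assumes b: "b \<ge> 0" and s: "s > 0"
  shows "ennreal (bessel_weight (- b) ((1/s) *\<^sub>R \<omega>) * (3 powr (- b) * exp (- (1/2)) * (unit_ball_vol DIM('a) * s ^ DIM('a))))
    \<le> (\<integral>\<^sup>+c. ennreal (bessel_weight (- b) ((1/s) *\<^sub>R c) * gauss s (\<omega> - c)) \<partial>lborel)"
proof -
  let ?m = "\<lambda>\<omega>::'a. bessel_weight (- b) ((1/s) *\<^sub>R \<omega>)"
  let ?A = "?m \<omega> * (3 powr (- b) * exp (- (1/2)))"
  \<comment> \<open>Over \<open>ball \<omega> s\<close> the scaled weight is at least
    \<open>3 powr (- b)\<close> times its value at \<omega>, and the Gaussian is at least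
    \<open>exp (- (1/2))\<close>.\<close>
  have pw: "?A \<le> ?m c * gauss s (\<omega> - c)" if c: "c \<in> ball \<omega> s" for c
  proof -
    let ?p = "norm ((1/s) *\<^sub>R c)" and ?q = "norm ((1/s) *\<^sub>R \<omega>)"
    have gen: "1 + P \<le> 3 * (1 + Q)" if "P \<le> 2 * Q + 2" "0 \<le> Q" for P Q :: real
      using that by simp
    have d: "norm (\<omega> - c) \<le> s" using c by (simp add: dist_norm)
    have "norm ((1/s) *\<^sub>R (c - \<omega>)) \<le> 1" using d s by (simp add: norm_minus_commute)
    moreover have "?p \<le> ?q + norm ((1/s) *\<^sub>R (c - \<omega>))"
      using norm_triangle_ineq[of "(1/s) *\<^sub>R \<omega>" "(1/s) *\<^sub>R (c - \<omega>)"] by (simp add: scaleR_diff_right)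
    ultimately have "?p \<le> ?q + 1" by linarith
    then have "?p\<^sup>2 \<le> (?q + 1)\<^sup>2" by (intro power_mono) auto
    also have "\<dots> \<le> 2 * ?q\<^sup>2 + 2" using sum_squares_bound[of ?q 1] by (simp add: power2_sum)
    finally have le: "1 + ?p\<^sup>2 \<le> 3 * (1 + ?q\<^sup>2)"
      by (rule gen) simp
    have "(3 * (1 + ?q\<^sup>2)) powr (- b) \<le> (1 + ?p\<^sup>2) powr (- b)"
      by (rule powr_mono2'[OF _ one_plus_norm_pos le]) (use b in simp)
    then have m: "?m \<omega> * 3 powr (- b) \<le> ?m c"
      unfolding bessel_weight_def powr_mult by (simp only: mult.commute)
    have "(norm (\<omega> - c))\<^sup>2 \<le> s\<^sup>2" by (intro power_mono d) simp
    then have "exp (- (1/2)) \<le> gauss s (\<omega> - c)"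
      using s by (simp add: gauss_def field_simps)
    from mult_mono[OF m this] show ?thesis by (simp add: mult.assoc)
  qed
  have "ennreal (?A * (unit_ball_vol DIM('a) * s ^ DIM('a))) = ennreal ?A * emeasure lborel (ball \<omega> s)"
    using s by (simp add: emeasure_ball ennreal_mult)
  also have "\<dots> = (\<integral>\<^sup>+c. ennreal ?A * indicator (ball \<omega> s) c \<partial>lborel)"
    by (subst nn_integral_cmult_indicator) auto
  also have "\<dots> \<le> (\<integral>\<^sup>+c. ennreal (?m c * gauss s (\<omega> - c)) \<partial>lborel)"
    by (intro nn_integral_mono) (use pw in \<open>auto simp: indicator_def intro!: ennreal_leI\<close>)
  finally show ?thesis by (simp only: mult.assoc)
qed

text \<open>The weight decays only polynomially, so no single Gaussian dominates it. A superposition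
  of translates does, and every translate obeys the same bound \<open>T\<close>; after exchanging
  the integrals only the total mass \<open>s ^ DIM('a) * I\<close> of the scaled weight
  remains.\<close>

lemma trig_sum_bessel_upper:
  assumes b: "b > real DIM('a) / 2"
  obtains C where "C \<ge> 0" "\<And>(S::'a::euclidean_space set) \<alpha> s. \<lbrakk>finite S; s > 0;
     \<And>y. y \<in> S \<Longrightarrow> (\<Sum>z\<in>S - {y}. gauss (1/s) (y - z)) \<le> 1/2\<rbrakk> \<Longrightarrow>
     (LINT \<omega>|lborel. (norm (trig_sum S \<alpha> \<omega>))\<^sup>2 * bessel_weight (- b) ((1/s) *\<^sub>R \<omega>)) \<le> C * (s ^ DIM('a) * (\<Sum>y\<in>S. (norm (\<alpha> y))\<^sup>2))"
proof -
  define I where "I = (LINT \<omega>|lborel. bessel_weight (- b) (\<omega>::'a))"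
  define K where "K = 3 powr (- b) * exp (- (1/2)) * unit_ball_vol (real DIM('a))"
  define C where "C = 3/2 * sqrt (2 * pi) ^ DIM('a) * I / K"
  have b0: "b \<ge> 0" using b by (meson divide_nonneg_nonneg le_less_trans less_imp_le of_nat_0_le_iff zero_le_numeral)
  have I: "I \<ge> 0" unfolding I_def by (intro integral_nonneg_AE) auto
  have K: "K > 0" by (simp add: K_def)
  have "(LINT \<omega>|lborel. (norm (trig_sum S \<alpha> \<omega>))\<^sup>2 * bessel_weight (- b) ((1/s) *\<^sub>R \<omega>)) \<le> C * (s ^ DIM('a) * (\<Sum>y\<in>S. (norm (\<alpha> y))\<^sup>2))"
    if S: "finite S" and s: "s > 0" and row: "\<And>y. y \<in> S \<Longrightarrow> (\<Sum>z\<in>S - {y}. gauss (1/s) (y - z)) \<le> 1/2"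
    for S :: "'a set" and \<alpha> s
  proof -
    define M where "M = (\<Sum>y\<in>S. (norm (\<alpha> y))\<^sup>2)"
    define p where "p \<omega> = (norm (trig_sum S \<alpha> \<omega>))\<^sup>2" for \<omega>
    define m where "m \<omega> = bessel_weight (- b) ((1/s) *\<^sub>R \<omega>)" for \<omega> :: 'a
    define J where "J = (LINT \<omega>|lborel. p \<omega> * m \<omega>)"
    have M: "M \<ge> 0" by (simp add: M_def sum_nonneg)
    have p0: "p \<omega> \<ge> 0" and m0: "m \<omega> \<ge> 0" for \<omega> by (simp_all add: p_def m_def)
    have [measurable]: "p \<in> borel_measurable borel" "m \<in> borel_measurable borel"
      unfolding p_def[abs_def] m_def[abs_def] by measurable
    have mi: "integrable lborel m" and mI: "(LINT \<omega>|lborel. m \<omega>) = s ^ DIM('a) * I"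
      using integrable_bessel_weight_scaled[OF b s] unfolding m_def[abs_def] I_def by auto
    have pmi: "integrable lborel (\<lambda>\<omega>. p \<omega> * m \<omega>)"
      unfolding p_def by (rule integrable_trig_sum_mult[OF mi])
    have J: "J \<ge> 0" unfolding J_def using p0 m0 by (intro integral_nonneg_AE) auto
    define T where "T = 3/2 * (sqrt (2 * pi) * s) ^ DIM('a) * M"
    have T: "T \<ge> 0" using s M by (simp add: T_def)
    have "ennreal (J * (K * s ^ DIM('a))) = (\<integral>\<^sup>+\<omega>. ennreal (p \<omega> * m \<omega>) \<partial>lborel) * ennreal (K * s ^ DIM('a))"
      unfolding J_def using J K s pmi p0 m0 
      by (subst nn_integral_eq_integral) (auto simp: J_def ennreal_mult)
    also have "\<dots> = (\<integral>\<^sup>+\<omega>. ennreal (p \<omega> * m \<omega>) * ennreal (K * s ^ DIM('a)) \<partial>lborel)"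
      by (rule nn_integral_multc[symmetric]) measurable
    also have "\<dots> = (\<integral>\<^sup>+\<omega>. ennreal (p \<omega>) * ennreal (m \<omega> * (K * s ^ DIM('a))) \<partial>lborel)"
      using p0 m0 K s by (intro nn_integral_cong) (simp add: ennreal_mult mult.assoc)
    also have "\<dots> \<le> (\<integral>\<^sup>+\<omega>. ennreal (p \<omega>) * (\<integral>\<^sup>+c. ennreal (m c * gauss s (\<omega> - c)) \<partial>lborel) \<partial>lborel)"
      using bessel_weight_scaled_le_convolution[OF b0 s]
      by (intro nn_integral_mono mult_left_mono) (simp_all only: m_def K_def mult.assoc zero_le)
    also have "\<dots> = (\<integral>\<^sup>+\<omega>. \<integral>\<^sup>+c. ennreal (p \<omega>) * ennreal (m c * gauss s (\<omega> - c)) \<partial>lborel \<partial>lborel)"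
      by (intro nn_integral_cong nn_integral_cmult[symmetric]) measurable
    also have "\<dots> = (\<integral>\<^sup>+c. \<integral>\<^sup>+\<omega>. ennreal (p \<omega>) * ennreal (m c * gauss s (\<omega> - c)) \<partial>lborel \<partial>lborel)"
      by (rule lborel_pair.Fubini'[symmetric]) measurable
    also have "\<dots> = (\<integral>\<^sup>+c. \<integral>\<^sup>+\<omega>. ennreal (m c) * ennreal (p \<omega> * gauss s (\<omega> - c)) \<partial>lborel \<partial>lborel)"
      using p0 m0 by (intro nn_integral_cong) (simp add: ennreal_mult mult_ac)
    also have "\<dots> = (\<integral>\<^sup>+c. ennreal (m c) * (\<integral>\<^sup>+\<omega>. ennreal (p \<omega> * gauss s (\<omega> - c)) \<partial>lborel) \<partial>lborel)"
      by (intro nn_integral_cong nn_integral_cmult) measurable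
    also have "\<dots> \<le> (\<integral>\<^sup>+c. ennreal (m c) * ennreal T \<partial>lborel)"
      unfolding p_def T_def M_def by (intro nn_integral_mono mult_left_mono trig_sum_gauss_upper S s row) auto
    also have "\<dots> = (\<integral>\<^sup>+c. ennreal (m c) \<partial>lborel) * ennreal T"
      by (rule nn_integral_multc) measurable
    also have "\<dots> = ennreal (s ^ DIM('a) * I * T)"
      using mi m0 I s T by (subst nn_integral_eq_integral) (auto simp: mI ennreal_mult)
    finally have "J * (K * s ^ DIM('a)) \<le> s ^ DIM('a) * I * T"
      using s I T by (subst (asm) ennreal_le_iff) auto
    then have "s ^ DIM('a) * (J * K) \<le> s ^ DIM('a) * (I * T)" by (simp only: mult_ac)
    then have "J * K \<le> I * T" using s by simp
    then have "J \<le> I * T / K" using K by (simp add: pos_le_divide_eq)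
    also have "\<dots> = C * (s ^ DIM('a) * M)"
      by (simp add: C_def T_def power_mult_distrib)
    finally show ?thesis unfolding J_def p_def m_def M_def .
  qed
  moreover have "C \<ge> 0" using I K by (simp add: C_def)
  ultimately show ?thesis using that by blast
qed

text \<open>The constant is the value of \<open>exp (- t / 2) * (1 + t) powr u\<close> at its
  stationary point \<open>1 + t = 2 * u\<close>; the bound is \<open>ln x \<le> x - 1\<close> at
  \<open>x = (1 + t) / (2 * u)\<close>.\<close>

lemma exp_le_powr:
  fixes t :: real
  assumes "t \<ge> 0" "u > 0"
  shows "exp (- t / 2) \<le> exp (1/2 - u + u * ln (2 * u)) * (1 + t) powr (- u)"
proof -
  have "ln ((1 + t) / (2 * u)) \<le> (1 + t) / (2 * u) - 1"
    using assms by (intro ln_le_minus_one) auto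
  then have "ln (1 + t) - ln (2 * u) \<le> (1 + t) / (2 * u) - 1"
    using assms by (simp add: ln_div)
  then have "u * (ln (1 + t) - ln (2 * u)) \<le> u * ((1 + t) / (2 * u) - 1)"
    using assms by (intro mult_left_mono) auto
  also have "\<dots> = (1 + t) / 2 - u" using assms by (simp add: field_simps)
  finally have "- t / 2 \<le> (1/2 - u + u * ln (2 * u)) + - u * ln (1 + t)"
    by (simp add: algebra_simps add_divide_distrib)
  then have "exp (- t / 2) \<le> exp ((1/2 - u + u * ln (2 * u)) + - u * ln (1 + t))" by simp
  also have "\<dots> = exp (1/2 - u + u * ln (2 * u)) * (1 + t) powr (- u)"
    using assms by (subst exp_add) (simp add: powr_def)
  finally show ?thesis .
qed

text \<open>The Gaussian is a function of \<omega>/s and decays faster than any weight in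
  \<omega>/s; passing from there to the weight in \<omega> costs \<open>s powr (2 * u)\<close>, as
  \<open>s \<ge> 1\<close>.\<close>

lemma gauss_le_bessel_weight:
  fixes \<omega> :: "'a::euclidean_space"
  assumes s: "s \<ge> 1" and u: "u > 0"
  shows "gauss s \<omega> \<le> exp (1/2 - u + u * ln (2 * u)) * s powr (2 * u) * bessel_weight (- u) \<omega>"
proof -
  let ?t = "(norm \<omega>)\<^sup>2 / s\<^sup>2"
  have le: "1 + (norm \<omega>)\<^sup>2 \<le> s\<^sup>2 * (1 + ?t)"
    using s by (simp add: distrib_left one_le_power)
  have "gauss s \<omega> = exp (- ?t / 2)" by (simp add: gauss_def mult.commute)
  also have "\<dots> \<le> exp (1/2 - u + u * ln (2 * u)) * (1 + ?t) powr (- u)"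
    by (rule exp_le_powr) (use u in auto)
  also have "(1 + ?t) powr (- u) = s powr (2 * u) * (s\<^sup>2 * (1 + ?t)) powr (- u)"
  proof -
    have "(s\<^sup>2 * (1 + ?t)) powr (- u) = (s\<^sup>2) powr (- u) * (1 + ?t) powr (- u)"
      by (rule powr_mult)
    also have "(s\<^sup>2) powr (- u) = s powr (- (2 * u))"
      using s powr_powr[of s 2 "- u"] by (simp add: powr_numeral)
    finally show ?thesis using s by (simp add: powr_minus)
  qed
  also have "(s\<^sup>2 * (1 + ?t)) powr (- u) \<le> (1 + (norm \<omega>)\<^sup>2) powr (- u)"
    by (rule powr_mono2'[OF _ _ le]) (use u in auto)
  finally show ?thesis by (simp add: bessel_weight_def mult.assoc mult_left_mono)
qed

text \<open>An inverse estimate: the sum of squares is controlled by a weak norm of negative order,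
  at the price \<open>s powr (2 * u)\<close> of fitting the Gaussian below the weight.\<close>

lemma trig_sum_bessel_lower:
  fixes S :: "'a::euclidean_space set"
  assumes u: "u > real DIM('a) / 2" and S: "finite S" and s: "s \<ge> 1"
    and row: "\<And>y. y \<in> S \<Longrightarrow> (\<Sum>z\<in>S - {y}. gauss (1/s) (y - z)) \<le> 1/2"
  shows "s ^ DIM('a) * (\<Sum>y\<in>S. (norm (\<alpha> y))\<^sup>2) \<le>
    2 * exp (1/2 - u + u * ln (2 * u)) / sqrt (2 * pi) ^ DIM('a) * s powr (2 * u) *
     (LINT \<omega>|lborel. (norm (trig_sum S \<alpha> \<omega>))\<^sup>2 * bessel_weight (- u) \<omega>)"
proof -
  let ?c = "exp (1/2 - u + u * ln (2 * u)) * s powr (2 * u)"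
  let ?D = "LINT \<omega>|lborel. (norm (trig_sum S \<alpha> \<omega>))\<^sup>2 * bessel_weight (- u) \<omega>"
  have u0: "u > 0" using u by (meson divide_nonneg_nonneg le_less_trans of_nat_0_le_iff zero_le_numeral)
  have gi: "integrable lborel (gauss s :: 'a \<Rightarrow> real)"
    using has_integral_gauss[of s, where 'a='a] s by (simp add: has_bochner_integral_iff)
  have bi: "integrable lborel (\<lambda>\<omega>. (norm (trig_sum S \<alpha> \<omega>))\<^sup>2 * bessel_weight (- u) \<omega>)"
    by (rule integrable_trig_sum_mult[OF integrable_bessel_weight[OF u]])
  have "(sqrt (2 * pi) * s) ^ DIM('a) * (\<Sum>y\<in>S. (norm (\<alpha> y))\<^sup>2) / 2
      \<le> (LINT \<omega>|lborel. (norm (trig_sum S \<alpha> \<omega>))\<^sup>2 * gauss s \<omega>)"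
    using s by (intro trig_sum_gauss_lower S row) auto
  also have "\<dots> \<le> (LINT \<omega>|lborel. ?c * ((norm (trig_sum S \<alpha> \<omega>))\<^sup>2 * bessel_weight (- u) \<omega>))"
  proof (rule integral_mono)
    show "integrable lborel (\<lambda>\<omega>. (norm (trig_sum S \<alpha> \<omega>))\<^sup>2 * gauss s \<omega>)"
      by (rule integrable_trig_sum_mult[OF gi])
    show "integrable lborel (\<lambda>\<omega>. ?c * ((norm (trig_sum S \<alpha> \<omega>))\<^sup>2 * bessel_weight (- u) \<omega>))"
      by (rule integrable_mult_right[OF bi])
    fix \<omega>
    have "(norm (trig_sum S \<alpha> \<omega>))\<^sup>2 * gauss s \<omega> \<le> (norm (trig_sum S \<alpha> \<omega>))\<^sup>2 * (?c * bessel_weight (- u) \<omega>)"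
      by (intro mult_left_mono gauss_le_bessel_weight s u0) simp
    then show "(norm (trig_sum S \<alpha> \<omega>))\<^sup>2 * gauss s \<omega> \<le> ?c * ((norm (trig_sum S \<alpha> \<omega>))\<^sup>2 * bessel_weight (- u) \<omega>)"
      by (simp only: mult_ac)
  qed
  also have "\<dots> = ?c * ?D" by (rule Bochner_Integration.integral_mult_right_zero)
  finally have "sqrt (2 * pi) ^ DIM('a) * (s ^ DIM('a) * (\<Sum>y\<in>S. (norm (\<alpha> y))\<^sup>2)) \<le> 2 * (?c * ?D)"
    by (simp add: power_mult_distrib mult.assoc)
  moreover have "sqrt (2 * pi) ^ DIM('a) > 0" by simp
  ultimately have "s ^ DIM('a) * (\<Sum>y\<in>S. (norm (\<alpha> y))\<^sup>2) \<le> 2 * (?c * ?D) / sqrt (2 * pi) ^ DIM('a)"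
    by (subst pos_le_divide_eq) (simp_all only: mult.commute)
  then show ?thesis by (simp add: mult.assoc)
qed

text \<open>The threshold is \<open>norm \<omega> = s\<close>. Below it
  \<open>1 + (norm \<omega>)\<^sup>2 \<le> 2 * s\<^sup>2\<close>; above it the left-hand side is at
  least half of \<open>s\<^sup>2 + (norm \<omega>)\<^sup>2\<close>. Adding the two bounds, rather
  than splitting the domain, lets each be integrated over the whole space.\<close>

lemma bessel_weight_split:
  fixes \<omega> :: "'a::euclidean_space"
  assumes s: "s \<ge> 1" and b: "b \<ge> 0" and bu: "b \<le> u"
  shows "bessel_weight (- b) \<omega> \<le> 2 powr (u - b) * s powr (2 * (u - b)) * bessel_weight (- u) \<omega> +
    2 powr b * s powr (- (2 * b)) * bessel_weight (- b) ((1/s) *\<^sub>R \<omega>)"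
proof -
  have s2: "(s\<^sup>2) powr t = s powr (2 * t)" for t
    using s powr_powr[of s 2 t] by (simp add: powr_numeral)
  show ?thesis
  proof (cases "norm \<omega> \<le> s")
    case True
    then have "(norm \<omega>)\<^sup>2 \<le> s\<^sup>2" by (intro power_mono) auto
    moreover have "1 \<le> s\<^sup>2" using s by (simp add: one_le_power)
    ultimately have "1 + (norm \<omega>)\<^sup>2 \<le> 2 * s\<^sup>2" by linarith
    then have "bessel_weight (u - b) \<omega> \<le> (2 * s\<^sup>2) powr (u - b)"
      unfolding bessel_weight_def using bu by (intro powr_mono2) auto
    also have "\<dots> = 2 powr (u - b) * s powr (2 * (u - b))"
      by (simp add: powr_mult s2)
    finally have "bessel_weight (u - b) \<omega> * bessel_weight (- u) \<omega> \<le> 2 powr (u - b) * s powr (2 * (u - b)) * bessel_weight (- u) \<omega>"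
      by (rule mult_right_mono) simp
    then have "bessel_weight (- b) \<omega> \<le> 2 powr (u - b) * s powr (2 * (u - b)) * bessel_weight (- u) \<omega>"
      by (simp add: bessel_weight_add)
    moreover have "0 \<le> 2 powr b * s powr (- (2 * b)) * bessel_weight (- b) ((1/s) *\<^sub>R \<omega>)" by simp
    ultimately show ?thesis by linarith
  next
    case False
    then have "s\<^sup>2 \<le> (norm \<omega>)\<^sup>2" using s by (intro power_mono) auto
    then have le: "(1/2) * (s\<^sup>2 * (1 + (norm \<omega>)\<^sup>2 / s\<^sup>2)) \<le> 1 + (norm \<omega>)\<^sup>2"
    proof -
      have "(1/2) * (s\<^sup>2 * (1 + (norm \<omega>)\<^sup>2 / s\<^sup>2)) = (s\<^sup>2 + (norm \<omega>)\<^sup>2) / 2"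
        using s by (simp add: distrib_left)
      also have "(a + b) / 2 \<le> 1 + b" if "a \<le> b" for a b :: real using that by simp
      then have "(s\<^sup>2 + (norm \<omega>)\<^sup>2) / 2 \<le> 1 + (norm \<omega>)\<^sup>2" using \<open>s\<^sup>2 \<le> (norm \<omega>)\<^sup>2\<close> by blast
      finally show ?thesis .
    qed
    have "bessel_weight (- b) \<omega> \<le> ((1/2) * (s\<^sup>2 * (1 + (norm \<omega>)\<^sup>2 / s\<^sup>2))) powr (- b)"
      unfolding bessel_weight_def
      by (rule powr_mono2'[OF _ _ le]) (use b s in \<open>auto intro!: mult_pos_pos add_pos_nonneg\<close>)
    also have "\<dots> = (1/2) powr (- b) * ((s\<^sup>2) powr (- b) * (1 + (norm \<omega>)\<^sup>2 / s\<^sup>2) powr (- b))"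
      by (simp only: powr_mult)
    also have "(1/2) powr (- b) = 2 powr b"
      by (simp add: powr_divide powr_minus)
    also have "(s\<^sup>2) powr (- b) = s powr (- (2 * b))" by (simp add: s2)
    also have "(1 + (norm \<omega>)\<^sup>2 / s\<^sup>2) powr (- b) = bessel_weight (- b) ((1/s) *\<^sub>R \<omega>)"
      using s by (simp add: bessel_weight_def power_divide)
    finally have "bessel_weight (- b) \<omega> \<le> 2 powr b * s powr (- (2 * b)) * bessel_weight (- b) ((1/s) *\<^sub>R \<omega>)"
      by (simp only: mult.assoc)
    moreover have "0 \<le> 2 powr (u - b) * s powr (2 * (u - b)) * bessel_weight (- u) \<omega>" by simp
    ultimately show ?thesis by linarith
  qed
qed

text \<open>For a set with at most one point this holds for every \<open>q\<close>, in line with the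
  infinite \<open>separation_radius\<close>.\<close>

definition separated :: "real \<Rightarrow> 'a::metric_space set \<Rightarrow> bool" where
  "separated q S \<longleftrightarrow> (\<forall>y\<in>S. \<forall>z\<in>S. y \<noteq> z \<longrightarrow> 2 * q \<le> dist y z)"

text \<open>Low frequencies give the factor \<open>s powr (2 * (u - b))\<close> at once. High
  frequencies give it as \<open>s powr (- (2 * b)) * s powr (2 * u)\<close>, with
  \<open>s ^ DIM('a) * M\<close> as the link between the upper and the lower bound. The scale is
  tied to \<open>q\<close> by an inequality only, so it can be adjusted to
  \<open>s \<ge> 1\<close>.\<close>

lemma trig_sum_bessel_comparison:
  assumes b: "b > real DIM('a) / 2" and bu: "b \<le> u"
  shows "\<exists>C>0. \<exists>\<kappa>>0. \<forall>(S::'a::euclidean_space set) \<alpha> q s.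
      finite S \<longrightarrow> q > 0 \<longrightarrow> s \<ge> 1 \<longrightarrow> s * q \<ge> \<kappa> \<longrightarrow> separated q S \<longrightarrow>
      (LINT \<omega>|lborel. (norm (trig_sum S \<alpha> \<omega>))\<^sup>2 * bessel_weight (- b) \<omega>) \<le>
      C * s powr (2 * (u - b)) * (LINT \<omega>|lborel. (norm (trig_sum S \<alpha> \<omega>))\<^sup>2 * bessel_weight (- u) \<omega>)"
proof -
  obtain \<kappa> where \<kappa>: "\<kappa> > 0" and row: "\<And>(S::'a set) q s y. \<lbrakk>finite S; q > 0; s * q \<ge> \<kappa>; y \<in> S;
     \<And>y z. y \<in> S \<Longrightarrow> z \<in> S \<Longrightarrow> y \<noteq> z \<Longrightarrow> dist y z \<ge> 2 * q\<rbrakk> \<Longrightarrow> (\<Sum>z\<in>S - {y}. gauss (1/s) (y - z)) \<le> 1/2"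
    using gauss_row_sum_le_half by blast
  obtain C1 where C1: "C1 \<ge> 0" and up: "\<And>(S::'a set) \<alpha> s. \<lbrakk>finite S; s > 0;
     \<And>y. y \<in> S \<Longrightarrow> (\<Sum>z\<in>S - {y}. gauss (1/s) (y - z)) \<le> 1/2\<rbrakk> \<Longrightarrow>
     (LINT \<omega>|lborel. (norm (trig_sum S \<alpha> \<omega>))\<^sup>2 * bessel_weight (- b) ((1/s) *\<^sub>R \<omega>)) \<le> C1 * (s ^ DIM('a) * (\<Sum>y\<in>S. (norm (\<alpha> y))\<^sup>2))"
    using trig_sum_bessel_upper[OF b] by blast
  define C2 where "C2 = 2 * exp (1/2 - u + u * ln (2 * u)) / sqrt (2 * pi) ^ DIM('a)"
  define C where "C = 2 powr (u - b) + 2 powr b * C1 * C2"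
  have u: "u > real DIM('a) / 2" using b bu by linarith
  have b0: "b \<ge> 0" using b by (meson divide_nonneg_nonneg le_less_trans less_imp_le of_nat_0_le_iff zero_le_numeral)
  have C2: "C2 \<ge> 0" by (simp add: C2_def)
  have "(LINT \<omega>|lborel. (norm (trig_sum S \<alpha> \<omega>))\<^sup>2 * bessel_weight (- b) \<omega>) \<le>
      C * s powr (2 * (u - b)) * (LINT \<omega>|lborel. (norm (trig_sum S \<alpha> \<omega>))\<^sup>2 * bessel_weight (- u) \<omega>)"
    if S: "finite S" and q: "q > 0" and s: "s \<ge> 1" and sq: "s * q \<ge> \<kappa>"
      and "separated q S" for S :: "'a set" and \<alpha> q s
  proof -
    have sep: "2 * q \<le> dist y z" if "y \<in> S" "z \<in> S" "y \<noteq> z" for y z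
      using \<open>separated q S\<close> that by (simp add: separated_def)
    define p where "p \<omega> = (norm (trig_sum S \<alpha> \<omega>))\<^sup>2" for \<omega>
    define D where "D = (LINT \<omega>|lborel. p \<omega> * bessel_weight (- u) \<omega>)"
    define M where "M = (\<Sum>y\<in>S. (norm (\<alpha> y))\<^sup>2)"
    have p0: "p \<omega> \<ge> 0" for \<omega> by (simp add: p_def)
    have s0: "s > 0" using s by simp
    have r: "(\<Sum>z\<in>S - {y}. gauss (1/s) (y - z)) \<le> 1/2" if "y \<in> S" for y
      by (rule row[OF S q sq that sep])
    have int: "integrable lborel (\<lambda>\<omega>. p \<omega> * w \<omega>)" if "integrable lborel w" for w :: "'a \<Rightarrow> real"
      unfolding p_def by (rule integrable_trig_sum_mult[OF that])
    note bi = int[OF integrable_bessel_weight[OF b]] int[OF integrable_bessel_weight[OF u]] int[OF integrable_bessel_weight_scaled(1)[OF b s0]]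
    let ?a1 = "2 powr (u - b) * s powr (2 * (u - b))" and ?a2 = "2 powr b * s powr (- (2 * b))"
    have "(LINT \<omega>|lborel. p \<omega> * bessel_weight (- b) \<omega>) \<le>
        (LINT \<omega>|lborel. ?a1 * (p \<omega> * bessel_weight (- u) \<omega>) + ?a2 * (p \<omega> * bessel_weight (- b) ((1/s) *\<^sub>R \<omega>)))"
    proof (intro integral_mono Bochner_Integration.integrable_add integrable_mult_right bi)
      fix \<omega>
      have "p \<omega> * bessel_weight (- b) \<omega> \<le> p \<omega> * (?a1 * bessel_weight (- u) \<omega> + ?a2 * bessel_weight (- b) ((1/s) *\<^sub>R \<omega>))"
        by (intro mult_left_mono bessel_weight_split s b0 bu p0)
      then show "p \<omega> * bessel_weight (- b) \<omega> \<le> ?a1 * (p \<omega> * bessel_weight (- u) \<omega>) + ?a2 * (p \<omega> * bessel_weight (- b) ((1/s) *\<^sub>R \<omega>))"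
        by (simp only: distrib_left mult_ac)
    qed
    also have "\<dots> = ?a1 * D + ?a2 * (LINT \<omega>|lborel. p \<omega> * bessel_weight (- b) ((1/s) *\<^sub>R \<omega>))"
      unfolding D_def using bi by (subst Bochner_Integration.integral_add) auto
    also have "(LINT \<omega>|lborel. p \<omega> * bessel_weight (- b) ((1/s) *\<^sub>R \<omega>)) \<le> C1 * (s ^ DIM('a) * M)"
      unfolding p_def M_def by (rule up[OF S s0 r])
    also have "s ^ DIM('a) * M \<le> C2 * s powr (2 * u) * D"
      unfolding p_def M_def C2_def D_def by (rule trig_sum_bessel_lower[OF u S s r])
    finally have "(LINT \<omega>|lborel. p \<omega> * bessel_weight (- b) \<omega>) \<le> ?a1 * D + ?a2 * (C1 * (C2 * s powr (2 * u) * D))"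
      using C1 by (simp add: mult_left_mono)
    also have "?a2 * (C1 * (C2 * s powr (2 * u) * D)) = 2 powr b * C1 * C2 * (s powr (- (2 * b)) * s powr (2 * u)) * D"
      by (simp only: mult_ac)
    also have "s powr (- (2 * b)) * s powr (2 * u) = s powr (2 * (u - b))"
      by (simp add: powr_add[symmetric] algebra_simps)
    finally show ?thesis
      unfolding D_def[symmetric] p_def[symmetric] C_def by (simp add: algebra_simps)
  qed
  note main = this
  have "C > 0" using C1 C2 by (simp add: C_def add_pos_nonneg)
  with \<kappa> show ?thesis by (intro exI[of _ C] exI[of _ \<kappa>] conjI allI impI main)
qed

section \<open>Native spaces and interpolation\<close>

lemma kernel_coeffs_finite: "c \<in> kernel_coeffs \<Omega> \<Longrightarrow> finite {y. c y \<noteq> 0}"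
  by (simp add: kernel_coeffs_def)

lemma kernel_coeffs_mono: "X \<subseteq> Y \<Longrightarrow> kernel_coeffs X \<subseteq> kernel_coeffs Y"
  by (auto simp: kernel_coeffs_def)

lemma kernel_coeffs_lincomb:
  assumes "a \<in> kernel_coeffs \<Omega>" "b \<in> kernel_coeffs \<Omega>"
  shows "(\<lambda>y. s * a y + t * b y) \<in> kernel_coeffs \<Omega>"
proof -
  have "{y. s * a y + t * b y \<noteq> 0} \<subseteq> {y. a y \<noteq> 0} \<union> {y. b y \<noteq> 0}" by auto
  then show ?thesis
    using assms by (auto simp: kernel_coeffs_def intro: finite_subset)
qed

lemma kernel_coeffs_diff:
  "a \<in> kernel_coeffs \<Omega> \<Longrightarrow> b \<in> kernel_coeffs \<Omega> \<Longrightarrow> (\<lambda>y. a y - b y) \<in> kernel_coeffs \<Omega>"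
  using kernel_coeffs_lincomb[of a \<Omega> b 1 "-1"] by simp

lemma kernel_sum_eq_superset:
  assumes "finite S" "{y. c y \<noteq> 0} \<subseteq> S"
  shows "kernel_sum \<Phi> c x = (\<Sum>y\<in>S. c y * \<Phi> (x - y))"
  unfolding kernel_sum_def by (rule sum.mono_neutral_left) (use assms in auto)

lemma kernel_sum_lincomb:
  assumes "a \<in> kernel_coeffs \<Omega>" "b \<in> kernel_coeffs \<Omega>"
  shows "kernel_sum \<Phi> (\<lambda>y. s * a y + t * b y) x = s * kernel_sum \<Phi> a x + t * kernel_sum \<Phi> b x"
proof -
  let ?S = "{y. a y \<noteq> 0} \<union> {y. b y \<noteq> 0}"
  have S: "finite ?S" using assms by (auto simp: kernel_coeffs_finite)
  show ?thesis
    by (subst (1 2 3) kernel_sum_eq_superset[OF S])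
       (auto simp: sum.distrib sum_distrib_left algebra_simps)
qed

lemma kernel_sum_diff:
  assumes "a \<in> kernel_coeffs \<Omega>" "b \<in> kernel_coeffs \<Omega>"
  shows "kernel_sum \<Phi> (\<lambda>y. a y - b y) x = kernel_sum \<Phi> a x - kernel_sum \<Phi> b x"
  using kernel_sum_lincomb[OF assms, of \<Phi> 1 "-1"] by simp

section \<open>The inner product on coefficient functions\<close>

text \<open>Evenness, which radial kernels have, makes the pairing below symmetric.\<close>

locale spd_kernel =
  fixes \<Phi> :: "'a::euclidean_space \<Rightarrow> real"
  assumes spd: "strictly_positive_definite \<Phi>" and even: "\<Phi> (- x) = \<Phi> x"
begin

text \<open>The native inner product of \<open>kernel_sum \<Phi> a\<close> and
  \<open>kernel_sum \<Phi> b\<close>. The one-sided form has the reproducing property built in: only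
  point values of the second function enter, which suits pointwise limits.\<close>

definition pairing :: "('a \<Rightarrow> real) \<Rightarrow> ('a \<Rightarrow> real) \<Rightarrow> real" where
  "pairing a b = (\<Sum>y | a y \<noteq> 0. a y * kernel_sum \<Phi> b y)"

lemma pairing_eq_superset:
  assumes "finite S" "{y. a y \<noteq> 0} \<subseteq> S" "{y. b y \<noteq> 0} \<subseteq> S"
  shows "pairing a b = (\<Sum>y\<in>S. \<Sum>z\<in>S. a y * b z * \<Phi> (y - z))"
proof -
  have "pairing a b = (\<Sum>y\<in>S. a y * kernel_sum \<Phi> b y)"
    unfolding pairing_def by (rule sum.mono_neutral_left) (use assms in auto)
  then show ?thesis
    by (simp add: kernel_sum_eq_superset[OF assms(1,3)] sum_distrib_left mult.assoc)
qed

lemma pairing_sym: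
  assumes "a \<in> kernel_coeffs \<Omega>" "b \<in> kernel_coeffs \<Omega>"
  shows "pairing a b = pairing b a"
proof -
  let ?S = "{y. a y \<noteq> 0} \<union> {y. b y \<noteq> 0}"
  have S: "finite ?S" using assms by (auto simp: kernel_coeffs_finite)
  have "(\<Sum>y\<in>?S. \<Sum>z\<in>?S. a y * b z * \<Phi> (y - z)) = (\<Sum>y\<in>?S. \<Sum>z\<in>?S. b y * a z * \<Phi> (y - z))"
    by (subst sum.swap) (intro sum.cong refl, metis even minus_diff_eq mult.commute)
  then show ?thesis
    by (subst (1 2) pairing_eq_superset[OF S]) auto
qed

lemma pairing_lincomb_right:
  assumes "b \<in> kernel_coeffs \<Omega>" "c \<in> kernel_coeffs \<Omega>"
  shows "pairing a (\<lambda>y. s * b y + t * c y) = s * pairing a b + t * pairing a c"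
  unfolding pairing_def kernel_sum_lincomb[OF assms]
  by (simp add: sum.distrib sum_distrib_left algebra_simps)

lemma pairing_lincomb_left:
  assumes "a \<in> kernel_coeffs \<Omega>" "b \<in> kernel_coeffs \<Omega>" "c \<in> kernel_coeffs \<Omega>"
  shows "pairing (\<lambda>y. s * b y + t * c y) a = s * pairing b a + t * pairing c a"
  using pairing_lincomb_right[OF assms(2,3), of a s t] kernel_coeffs_lincomb[OF assms(2,3)] assms
  by (metis pairing_sym)

lemma pairing_pos:
  assumes "a \<in> kernel_coeffs \<Omega>" "a \<noteq> (\<lambda>_. 0)"
  shows "pairing a a > 0"
proof -
  have "\<exists>y\<in>{y. a y \<noteq> 0}. a y \<noteq> 0" using assms(2) by auto
  then show ?thesis
    using spd kernel_coeffs_finite[OF assms(1)]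
    unfolding strictly_positive_definite_def
    by (subst pairing_eq_superset[of "{y. a y \<noteq> 0}"]) auto
qed

lemma pairing_zero [simp]: "pairing (\<lambda>_. 0) a = 0" "pairing a (\<lambda>_. 0) = 0"
  by (simp_all add: pairing_def kernel_sum_def)

lemma pairing_nonneg: "a \<in> kernel_coeffs \<Omega> \<Longrightarrow> pairing a a \<ge> 0"
  using pairing_pos[of a] by (cases "a = (\<lambda>_. 0)") force+

lemma kernel_norm_eq:
  assumes "a \<in> kernel_coeffs \<Omega>"
  shows "kernel_norm \<Phi> a = sqrt (pairing a a)"
proof -
  have "pairing a a = (\<Sum>y | a y \<noteq> 0. \<Sum>z | a z \<noteq> 0. a y * a z * \<Phi> (y - z))"
    by (rule pairing_eq_superset[OF kernel_coeffs_finite[OF assms] subset_refl subset_refl])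
  then show ?thesis by (simp only: kernel_norm_def)
qed

lemma kernel_norm_power2:
  assumes "a \<in> kernel_coeffs \<Omega>"
  shows "(kernel_norm \<Phi> a)\<^sup>2 = pairing a a"
  using pairing_nonneg[OF assms] by (simp only: kernel_norm_eq[OF assms] real_sqrt_pow2)

lemma kernel_norm_nonneg:
  assumes "a \<in> kernel_coeffs \<Omega>"
  shows "kernel_norm \<Phi> a \<ge> 0"
  using pairing_nonneg[OF assms] by (simp only: kernel_norm_eq[OF assms] real_sqrt_ge_0_iff)

lemma pairing_le:
  assumes a: "a \<in> kernel_coeffs \<Omega>" and b: "b \<in> kernel_coeffs \<Omega>"
  shows "\<bar>pairing a b\<bar> \<le> kernel_norm \<Phi> a * kernel_norm \<Phi> b"
proof (cases "b = (\<lambda>_. 0)")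
  case True
  then show ?thesis by (simp add: kernel_norm_def)
next
  case False
  with b have pos: "pairing b b > 0" by (rule pairing_pos)
  \<comment> \<open>The minimiser of the quadratic polynomial that maps \<open>t\<close> to the
    squared norm of \<open>a + t b\<close>.\<close>
  let ?t = "- pairing a b / pairing b b"
  have "0 \<le> pairing (\<lambda>y. 1 * a y + ?t * b y) (\<lambda>y. 1 * a y + ?t * b y)"
    by (rule pairing_nonneg[OF kernel_coeffs_lincomb[OF a b]])
  also have "\<dots> = pairing a a + 2 * ?t * pairing a b + ?t\<^sup>2 * pairing b b"
    unfolding pairing_lincomb_left[OF kernel_coeffs_lincomb[OF a b] a b] pairing_lincomb_right[OF a b]
    using pairing_sym[OF a b] by (simp add: algebra_simps power2_eq_square)
  also have "\<dots> = pairing a a - (pairing a b)\<^sup>2 / pairing b b"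
    using pos by (simp add: field_simps power2_eq_square)
  finally have "(pairing a b)\<^sup>2 \<le> pairing a a * pairing b b"
    using pos by (simp add: field_simps)
  then have "\<bar>pairing a b\<bar> \<le> sqrt (pairing a a * pairing b b)"
    by (rule real_le_rsqrt[OF ord_eq_le_trans, rotated]) simp
  then show ?thesis
    by (simp add: kernel_norm_eq[OF a] kernel_norm_eq[OF b] real_sqrt_mult)
qed

lemma kernel_norm_triangle_diff:
  assumes a: "a \<in> kernel_coeffs \<Omega>" and b: "b \<in> kernel_coeffs \<Omega>"
  shows "kernel_norm \<Phi> (\<lambda>y. a y - b y) \<le> kernel_norm \<Phi> a + kernel_norm \<Phi> b"
proof (rule power2_le_imp_le)
  have "(kernel_norm \<Phi> (\<lambda>y. a y - b y))\<^sup>2 = pairing (\<lambda>y. 1 * a y + (-1) * b y) (\<lambda>y. 1 * a y + (-1) * b y)"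
    using kernel_norm_power2[OF kernel_coeffs_diff[OF a b]] by simp
  also have "\<dots> = pairing a a - 2 * pairing a b + pairing b b"
    unfolding pairing_lincomb_left[OF kernel_coeffs_lincomb[OF a b] a b] pairing_lincomb_right[OF a b]
    using pairing_sym[OF a b] by simp
  also have "\<dots> \<le> (kernel_norm \<Phi> a + kernel_norm \<Phi> b)\<^sup>2"
    using pairing_le[OF a b] kernel_norm_power2[OF a] kernel_norm_power2[OF b]
    by (simp add: power2_sum algebra_simps)
  finally show "(kernel_norm \<Phi> (\<lambda>y. a y - b y))\<^sup>2 \<le> (kernel_norm \<Phi> a + kernel_norm \<Phi> b)\<^sup>2" .
  show "0 \<le> kernel_norm \<Phi> a + kernel_norm \<Phi> b"
    using a b by (simp add: kernel_norm_nonneg)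
qed

lemma kernel_norm_diff_abs:
  assumes a: "a \<in> kernel_coeffs \<Omega>" and b: "b \<in> kernel_coeffs \<Omega>"
  shows "\<bar>kernel_norm \<Phi> a - kernel_norm \<Phi> b\<bar> \<le> kernel_norm \<Phi> (\<lambda>y. a y - b y)"
proof -
  have z: "(\<lambda>_. 0) \<in> kernel_coeffs \<Omega>" by (simp add: kernel_coeffs_def)
  have neg: "kernel_norm \<Phi> (\<lambda>y. - d y) = kernel_norm \<Phi> d" for d
    by (simp add: kernel_norm_def)
  let ?d = "\<lambda>y. a y - b y"
  have d: "?d \<in> kernel_coeffs \<Omega>" by (rule kernel_coeffs_diff[OF a b])
  have "kernel_norm \<Phi> b \<le> kernel_norm \<Phi> a + kernel_norm \<Phi> ?d"
    using kernel_norm_triangle_diff[OF a d] by simp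
  moreover have "kernel_norm \<Phi> a \<le> kernel_norm \<Phi> ?d + kernel_norm \<Phi> b"
    using kernel_norm_triangle_diff[OF d kernel_coeffs_diff[OF z b]] neg[of b] by simp
  ultimately show ?thesis by linarith
qed

section \<open>The completion as a space of functions\<close>

lemma native_approximation_norm_convergent:
  assumes "native_approximation \<Phi> \<Omega> f c"
  shows "\<exists>r. (\<lambda>n. kernel_norm \<Phi> (c n)) \<longlonglongrightarrow> r"
proof -
  have c: "c n \<in> kernel_coeffs \<Omega>" for n
    using assms by (simp add: native_approximation_def)
  have "Cauchy (\<lambda>n. kernel_norm \<Phi> (c n))"
    unfolding Cauchy_def
  proof (intro allI impI)
    fix e :: real assume "e > 0"
    then obtain M where M: "\<forall>m\<ge>M. \<forall>n\<ge>M. kernel_norm \<Phi> (\<lambda>y. c m y - c n y) < e"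
      using assms unfolding native_approximation_def by meson
    have "dist (kernel_norm \<Phi> (c m)) (kernel_norm \<Phi> (c n)) < e" if "m \<ge> M" "n \<ge> M" for m n
      using kernel_norm_diff_abs[OF c[of m] c[of n]] M[rule_format, OF that] by (simp add: dist_real_def)
    then show "\<exists>M. \<forall>m\<ge>M. \<forall>n\<ge>M. dist (kernel_norm \<Phi> (c m)) (kernel_norm \<Phi> (c n)) < e" by blast
  qed
  then show ?thesis by (simp add: Cauchy_convergent_iff convergent_def)
qed

text \<open>The abstract completion embeds injectively into functions on \<Omega>. The differences
  \<open>e n\<close> form a Cauchy sequence tending to 0 pointwise; for fixed \<open>n\<close> the
  pairing with \<open>e n\<close> involves finitely many point values, so \<open>e m\<close> becomes
  orthogonal to \<open>e n\<close> as \<open>m\<close> grows, and a Cauchy sequence with this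
  property tends to 0 in norm.\<close>

lemma native_approximation_unique:
  assumes A: "native_approximation \<Phi> \<Omega> f c" "native_approximation \<Phi> \<Omega> f d"
  shows "(\<lambda>n. kernel_norm \<Phi> (\<lambda>y. c n y - d n y)) \<longlonglongrightarrow> 0"
proof -
  have c: "c n \<in> kernel_coeffs \<Omega>" and d: "d n \<in> kernel_coeffs \<Omega>" for n
    using assms by (simp_all add: native_approximation_def)
  define e where "e n y = c n y - d n y" for n y
  have e: "e n \<in> kernel_coeffs \<Omega>" for n
    unfolding e_def[abs_def] by (rule kernel_coeffs_diff[OF c d])
  have e0: "(\<lambda>n. kernel_sum \<Phi> (e n) x) \<longlonglongrightarrow> 0" if "x \<in> \<Omega>" for x
  proof -
    have "(\<lambda>n. kernel_sum \<Phi> (c n) x - kernel_sum \<Phi> (d n) x) \<longlonglongrightarrow> f x - f x"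
      using A that by (intro tendsto_diff) (auto simp: native_approximation_def)
    then show ?thesis
      unfolding e_def[abs_def] kernel_sum_diff[OF c d] by simp
  qed
  have eC: "\<exists>M. \<forall>m\<ge>M. \<forall>n\<ge>M. kernel_norm \<Phi> (\<lambda>y. e m y - e n y) < \<epsilon>" if "\<epsilon> > 0" for \<epsilon>
  proof -
    obtain M1 where M1: "\<forall>m\<ge>M1. \<forall>n\<ge>M1. kernel_norm \<Phi> (\<lambda>y. c m y - c n y) < \<epsilon>/2"
      using A(1) \<open>\<epsilon> > 0\<close> unfolding native_approximation_def by (meson half_gt_zero)
    obtain M2 where M2: "\<forall>m\<ge>M2. \<forall>n\<ge>M2. kernel_norm \<Phi> (\<lambda>y. d m y - d n y) < \<epsilon>/2"
      using A(2) \<open>\<epsilon> > 0\<close> unfolding native_approximation_def by (meson half_gt_zero)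
    have "kernel_norm \<Phi> (\<lambda>y. e m y - e n y) < \<epsilon>" if "m \<ge> max M1 M2" "n \<ge> max M1 M2" for m n
    proof -
      have "kernel_norm \<Phi> (\<lambda>y. c m y - c n y) < \<epsilon>/2" "kernel_norm \<Phi> (\<lambda>y. d m y - d n y) < \<epsilon>/2"
        using M1 M2 that by auto
      then have "kernel_norm \<Phi> (\<lambda>y. (c m y - c n y) - (d m y - d n y)) < \<epsilon>/2 + \<epsilon>/2"
        using kernel_norm_triangle_diff[OF kernel_coeffs_diff[OF c[of m] c[of n]] kernel_coeffs_diff[OF d[of m] d[of n]]]
        by linarith
      also have "(\<lambda>y. (c m y - c n y) - (d m y - d n y)) = (\<lambda>y. e m y - e n y)"
        by (auto simp: e_def)
      finally show ?thesis by simp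
    qed
    then show ?thesis by blast
  qed
  have orth: "(\<lambda>m. pairing (e n) (e m)) \<longlonglongrightarrow> 0" for n
  proof -
    have "(\<lambda>m. \<Sum>y | e n y \<noteq> 0. e n y * kernel_sum \<Phi> (e m) y) \<longlonglongrightarrow> (\<Sum>y | e n y \<noteq> 0. e n y * 0)"
      using e[of n] by (intro tendsto_sum tendsto_mult tendsto_const e0) (auto simp: kernel_coeffs_def)
    then show ?thesis by (simp add: pairing_def)
  qed
  have "\<exists>M. \<forall>n\<ge>M. kernel_norm \<Phi> (e n) \<le> \<epsilon>" if \<epsilon>: "\<epsilon> > 0" for \<epsilon>
  proof -
    obtain M where M: "\<And>m n. m \<ge> M \<Longrightarrow> n \<ge> M \<Longrightarrow> kernel_norm \<Phi> (\<lambda>y. e m y - e n y) < \<epsilon>"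
      using eC[OF \<epsilon>] by blast
    have "kernel_norm \<Phi> (e n) \<le> \<epsilon>" if n: "n \<ge> M" for n
    proof -
      \<comment> \<open>Split the second argument as \<open>e n = (e n - e m) + e m\<close>: the
        Cauchy property controls the first part, and the second vanishes in the limit over
        \<open>m\<close>.\<close>
      have "pairing (e n) (e n) \<le> kernel_norm \<Phi> (e n) * \<epsilon>"
      proof (rule LIMSEQ_le_const)
        show "(\<lambda>m. kernel_norm \<Phi> (e n) * \<epsilon> + pairing (e n) (e m)) \<longlonglongrightarrow> kernel_norm \<Phi> (e n) * \<epsilon>"
          using tendsto_add[OF tendsto_const orth[of n], of "kernel_norm \<Phi> (e n) * \<epsilon>"] by simp
        have "pairing (e n) (e n) \<le> kernel_norm \<Phi> (e n) * \<epsilon> + pairing (e n) (e m)" if m: "m \<ge> M" for m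
        proof -
          have "pairing (e n) (\<lambda>y. 1 * e n y + (-1) * e m y) = pairing (e n) (e n) - pairing (e n) (e m)"
            unfolding pairing_lincomb_right[OF e e] by simp
          moreover have "pairing (e n) (\<lambda>y. 1 * e n y + (-1) * e m y) \<le> kernel_norm \<Phi> (e n) * kernel_norm \<Phi> (\<lambda>y. e n y - e m y)"
            using pairing_le[OF e[of n] kernel_coeffs_lincomb[OF e[of n] e[of m]], of 1 "-1"] by simp
          moreover have "\<dots> \<le> kernel_norm \<Phi> (e n) * \<epsilon>"
            using M[OF n m] kernel_norm_nonneg[OF e[of n]] by (intro mult_left_mono) auto
          ultimately show ?thesis by linarith
        qed
        then show "\<exists>N. \<forall>m\<ge>N. pairing (e n) (e n) \<le> kernel_norm \<Phi> (e n) * \<epsilon> + pairing (e n) (e m)" by blast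
      qed
      then have "kernel_norm \<Phi> (e n) * kernel_norm \<Phi> (e n) \<le> kernel_norm \<Phi> (e n) * \<epsilon>"
        using kernel_norm_power2[OF e[of n]] by (simp add: power2_eq_square)
      then show ?thesis
        using kernel_norm_nonneg[OF e[of n]] \<epsilon> by (cases "kernel_norm \<Phi> (e n) = 0") (auto simp: mult_le_cancel_left)
    qed
    then show ?thesis by blast
  qed
  then have small: "\<exists>M. \<forall>n\<ge>M. kernel_norm \<Phi> (e n) \<le> \<epsilon>" if "\<epsilon> > 0" for \<epsilon> using that by blast
  have "(\<lambda>n. kernel_norm \<Phi> (e n)) \<longlonglongrightarrow> 0"
  proof (rule LIMSEQ_I)
    fix r :: real assume "r > 0"
    then obtain M where M: "\<And>n. n \<ge> M \<Longrightarrow> kernel_norm \<Phi> (e n) \<le> r / 2"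
      using small[of "r/2"] by auto
    have "norm (kernel_norm \<Phi> (e n) - 0) < r" if "n \<ge> M" for n
      using M[OF that] kernel_norm_nonneg[OF e[of n]] \<open>r > 0\<close> by simp
    then show "\<exists>M. \<forall>n\<ge>M. norm (kernel_norm \<Phi> (e n) - 0) < r" by blast
  qed
  then show ?thesis by (simp add: e_def[abs_def])
qed

text \<open>Discharges the definite description in \<open>native_norm\<close>: two approximating
  sequences of the same function approach each other in norm, so their norms have the same
  limit.\<close>

lemma native_norm_eqI:
  assumes A: "native_approximation \<Phi> \<Omega> f c" and r: "(\<lambda>n. kernel_norm \<Phi> (c n)) \<longlonglongrightarrow> r"
  shows "native_norm \<Phi> \<Omega> f = r"
  unfolding native_norm_def
proof (rule the_equality)
  show "\<exists>c. native_approximation \<Phi> \<Omega> f c \<and> (\<lambda>n. kernel_norm \<Phi> (c n)) \<longlonglongrightarrow> r"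
    using A r by blast
next
  fix s assume "\<exists>c. native_approximation \<Phi> \<Omega> f c \<and> (\<lambda>n. kernel_norm \<Phi> (c n)) \<longlonglongrightarrow> s"
  then obtain d where B: "native_approximation \<Phi> \<Omega> f d" and s: "(\<lambda>n. kernel_norm \<Phi> (d n)) \<longlonglongrightarrow> s" by blast
  have c: "c n \<in> kernel_coeffs \<Omega>" and d: "d n \<in> kernel_coeffs \<Omega>" for n
    using A B by (simp_all add: native_approximation_def)
  have "(\<lambda>n. kernel_norm \<Phi> (c n) - kernel_norm \<Phi> (d n)) \<longlonglongrightarrow> 0"
    by (rule Lim_null_comparison[OF _ native_approximation_unique[OF A B]])
       (use kernel_norm_diff_abs[OF c d] in auto)
  with tendsto_diff[OF r s] have "r - s = 0" by (rule LIMSEQ_unique)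
  then show "s = r" by simp
qed

lemma native_norm_kernel_sum:
  assumes c: "c \<in> kernel_coeffs \<Omega>"
  shows "native_norm \<Phi> \<Omega> (kernel_sum \<Phi> c) = kernel_norm \<Phi> c"
  by (rule native_norm_eqI[of _ _ "\<lambda>_. c"])
     (use c in \<open>auto simp: native_approximation_def kernel_norm_def\<close>)

text \<open>On kernel sums the functional on the left is the pairing with \<open>c\<close>, and the
  bound is Cauchy-Schwarz. Both sides pass to the limit along an approximating sequence, the left
  one pointwise at the finitely many nodes.\<close>

lemma native_norm_reproducing_le:
  assumes v: "v \<in> native_space \<Phi> \<Omega>" and c: "c \<in> kernel_coeffs \<Omega>"
  shows "\<bar>\<Sum>y | c y \<noteq> 0. c y * v y\<bar> \<le> kernel_norm \<Phi> c * native_norm \<Phi> \<Omega> v"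
proof -
  obtain d where A: "native_approximation \<Phi> \<Omega> v d" using v by (auto simp: native_space_def)
  obtain r where r: "(\<lambda>n. kernel_norm \<Phi> (d n)) \<longlonglongrightarrow> r"
    using native_approximation_norm_convergent[OF A] by blast
  have d: "d n \<in> kernel_coeffs \<Omega>" for n using A by (simp add: native_approximation_def)
  have "(\<lambda>n. \<bar>pairing c (d n)\<bar>) \<longlonglongrightarrow> \<bar>\<Sum>y | c y \<noteq> 0. c y * v y\<bar>"
    unfolding pairing_def using A c
    by (intro tendsto_rabs tendsto_sum tendsto_mult tendsto_const)
       (auto simp: native_approximation_def kernel_coeffs_def)
  moreover have "(\<lambda>n. kernel_norm \<Phi> c * kernel_norm \<Phi> (d n)) \<longlonglongrightarrow> kernel_norm \<Phi> c * r"
    by (intro tendsto_mult tendsto_const r)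
  ultimately have "\<bar>\<Sum>y | c y \<noteq> 0. c y * v y\<bar> \<le> kernel_norm \<Phi> c * r"
    by (rule LIMSEQ_le) (use pairing_le[OF c d] in auto)
  then show ?thesis by (simp add: native_norm_eqI[OF A r])
qed

section \<open>Solvability of the interpolation problem\<close>

lemma interpolation_exists:
  assumes "finite X"
  shows "\<exists>c\<in>kernel_coeffs X. \<forall>x\<in>X. kernel_sum \<Phi> c x = f x"
  using assms
proof (induction X arbitrary: f)
  case empty
  then show ?case by (intro bexI[of _ "\<lambda>_. 0"]) (auto simp: kernel_coeffs_def)
next
  case (insert p X)
  \<comment> \<open>\<open>e\<close> is the translate at \<open>p\<close> minus its interpolant on \<open>X\<close>; strict positivity makes it nonzero at \<open>p\<close>.\<close>
  obtain a where a: "a \<in> kernel_coeffs X" "\<And>x. x \<in> X \<Longrightarrow> kernel_sum \<Phi> a x = f x"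
    using insert.IH[of f] by blast
  obtain d where d: "d \<in> kernel_coeffs X" "\<And>x. x \<in> X \<Longrightarrow> kernel_sum \<Phi> d x = \<Phi> (x - p)"
    using insert.IH[of "\<lambda>x. \<Phi> (x - p)"] by blast
  define u :: "'a \<Rightarrow> real" where "u y = (if y = p then 1 else 0)" for y
  define e where "e y = 1 * u y + (- 1) * d y" for y
  have u: "u \<in> kernel_coeffs (insert p X)" "kernel_sum \<Phi> u x = \<Phi> (x - p)" for x
    by (auto simp: u_def kernel_coeffs_def kernel_sum_def)
  have d': "d \<in> kernel_coeffs (insert p X)" and a': "a \<in> kernel_coeffs (insert p X)"
    using d(1) a(1) kernel_coeffs_mono[of X "insert p X"] by auto
  have e: "e \<in> kernel_coeffs (insert p X)"
    unfolding e_def[abs_def] by (rule kernel_coeffs_lincomb[OF u(1) d'])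
  have dp: "d p = 0" using d(1) insert.hyps by (auto simp: kernel_coeffs_def)
  have ep: "e p = 1" by (simp add: e_def u_def dp)
  have eX: "kernel_sum \<Phi> e x = 0" if "x \<in> X" for x
    unfolding e_def[abs_def] kernel_sum_lincomb[OF u(1) d'] using u d(2)[OF that] by simp
  have "0 < pairing e e"
    by (rule pairing_pos[OF e]) (use ep in \<open>auto dest: fun_cong[of _ _ p]\<close>)
  \<comment> \<open>\<open>kernel_sum \<Phi> e\<close> vanishes on \<open>X\<close>, so only the
    node \<open>p\<close> survives, with coefficient 1.\<close>
  also have "pairing e e = (\<Sum>y\<in>{p}. e y * kernel_sum \<Phi> e y)"
    unfolding pairing_def
    by (rule sum.mono_neutral_right) (use e eX ep in \<open>auto simp: kernel_coeffs_def\<close>)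
  finally have pos: "kernel_sum \<Phi> e p > 0" by (simp add: ep)
  let ?t = "(f p - kernel_sum \<Phi> a p) / kernel_sum \<Phi> e p"
  show ?case
  proof (intro bexI[of _ "\<lambda>y. 1 * a y + ?t * e y"] ballI)
    show "(\<lambda>y. 1 * a y + ?t * e y) \<in> kernel_coeffs (insert p X)"
      by (rule kernel_coeffs_lincomb[OF a' e])
    show "kernel_sum \<Phi> (\<lambda>y. 1 * a y + ?t * e y) x = f x" if "x \<in> insert p X" for x
      unfolding kernel_sum_lincomb[OF a' e] using that pos a(2) eX by auto
  qed
qed

lemma interpolation_unique:
  assumes c: "c \<in> kernel_coeffs X" "d \<in> kernel_coeffs X"
    and eq: "\<And>x. x \<in> X \<Longrightarrow> kernel_sum \<Phi> c x = kernel_sum \<Phi> d x"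
  shows "c = d"
proof -
  let ?e = "\<lambda>y. c y - d y"
  have e: "?e \<in> kernel_coeffs X" by (rule kernel_coeffs_diff[OF c])
  have "pairing ?e ?e = 0"
    unfolding pairing_def kernel_sum_diff[OF c] using e eq
    by (intro sum.neutral) (auto simp: kernel_coeffs_def)
  then have "?e = (\<lambda>_. 0)" using pairing_pos[OF e] by (metis less_irrefl)
  then show ?thesis by (metis eq_iff_diff_eq_0 ext)
qed

lemma interpolant_eq_kernel_sum:
  assumes "finite X"
  shows "\<exists>c\<in>kernel_coeffs X. interpolant \<Phi> X f = kernel_sum \<Phi> c \<and> (\<forall>x\<in>X. kernel_sum \<Phi> c x = f x)"
proof -
  obtain c where c: "c \<in> kernel_coeffs X" "\<And>x. x \<in> X \<Longrightarrow> kernel_sum \<Phi> c x = f x"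
    using interpolation_exists[OF assms] by blast
  have "interpolant \<Phi> X f = kernel_sum \<Phi> c"
    unfolding interpolant_def
  proof (rule the_equality)
    show "kernel_sum \<Phi> c \<in> kernel_span \<Phi> X \<and> (\<forall>x\<in>X. kernel_sum \<Phi> c x = f x)"
      using c unfolding kernel_span_def by blast
    fix s assume "s \<in> kernel_span \<Phi> X \<and> (\<forall>x\<in>X. s x = f x)"
    then obtain d where d: "d \<in> kernel_coeffs X" "s = kernel_sum \<Phi> d" "\<forall>x\<in>X. s x = f x"
      unfolding kernel_span_def by blast
    then have "d = c" by (intro interpolation_unique[OF d(1) c(1)]) (use c(2) in auto)
    with d show "s = kernel_sum \<Phi> c" by simp
  qed
  with c show ?thesis by blast
qed

end

section \<open>Interpolants of rough functions\<close>

lemma integral_trig_sum_mult: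
  fixes g :: "'a::euclidean_space \<Rightarrow> complex"
  assumes g: "integrable lborel g"
  shows "integrable lborel (\<lambda>\<omega>. trig_sum S \<alpha> \<omega> * g \<omega>)"
    and "(LINT \<omega>|lborel. trig_sum S \<alpha> \<omega> * g \<omega>) = (\<Sum>y\<in>S. \<alpha> y * fourier_integral g y)"
proof -
  have eq: "(\<lambda>\<omega>. trig_sum S \<alpha> \<omega> * g \<omega>) = (\<lambda>\<omega>. \<Sum>y\<in>S. \<alpha> y * (cis (y \<bullet> \<omega>) * g \<omega>))"
    by (rule ext) (simp only: trig_sum_def sum_distrib_right mult.assoc)
  have int: "integrable lborel (\<lambda>\<omega>. \<alpha> y * (cis (y \<bullet> \<omega>) * g \<omega>))" for y
    by (intro integrable_mult_right integrable_cis_mult g)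
  show "integrable lborel (\<lambda>\<omega>. trig_sum S \<alpha> \<omega> * g \<omega>)"
    unfolding eq by (intro Bochner_Integration.integrable_sum int)
  have "(LINT \<omega>|lborel. (\<Sum>y\<in>S. \<alpha> y * (cis (y \<bullet> \<omega>) * g \<omega>))) = (\<Sum>y\<in>S. LINT \<omega>|lborel. \<alpha> y * (cis (y \<bullet> \<omega>) * g \<omega>))"
    by (rule Bochner_Integration.integral_sum) (rule int)
  then show "(LINT \<omega>|lborel. trig_sum S \<alpha> \<omega> * g \<omega>) = (\<Sum>y\<in>S. \<alpha> y * fourier_integral g y)"
    unfolding eq fourier_integral_def by (simp only: Bochner_Integration.integral_mult_right_zero)
qed

lemma bessel_norm_nonneg [simp]: "bessel_norm s g \<ge> 0"
  unfolding bessel_norm_def by (intro real_sqrt_ge_zero integral_nonneg_AE AE_I2) simp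

text \<open>Cauchy-Schwarz after inserting \<open>bessel_weight (- s/2) \<omega> * bessel_weight
  (s/2) \<omega> = 1\<close>: the duality between orders \<open>s\<close> and
  \<open>- s\<close>.\<close>

lemma norm_integral_trig_sum_mult_le:
  fixes g :: "'a::euclidean_space \<Rightarrow> complex"
  assumes g: "integrable lborel g" and fin: "bessel_finite s g" and s: "s > real DIM('a) / 2"
  shows "norm (LINT \<omega>|lborel. trig_sum S \<alpha> \<omega> * g \<omega>) \<le>
    bessel_norm s g * sqrt (LINT \<omega>|lborel. (norm (trig_sum S \<alpha> \<omega>))\<^sup>2 * bessel_weight (- s) \<omega>)"
proof -
  have [measurable]: "g \<in> borel_measurable borel" using borel_measurable_integrable[OF g] by simp
  define A where "A = (LINT \<omega>|lborel. (norm (trig_sum S \<alpha> \<omega>))\<^sup>2 * bessel_weight (- s) \<omega>)"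
  define B where "B = (LINT \<omega>|lborel. bessel_weight s \<omega> * (norm (g \<omega>))\<^sup>2)"
  have A: "A \<ge> 0" and B: "B \<ge> 0" unfolding A_def B_def by (auto intro!: integral_nonneg_AE)
  define u where "u \<omega> = norm (trig_sum S \<alpha> \<omega>) * bessel_weight (- s/2) \<omega>" for \<omega>
  define v where "v \<omega> = bessel_weight (s/2) \<omega> * norm (g \<omega>)" for \<omega>
  have uv: "u \<omega> * v \<omega> = norm (trig_sum S \<alpha> \<omega> * g \<omega>)" for \<omega>
  proof -
    have "u \<omega> * v \<omega> = norm (trig_sum S \<alpha> \<omega>) * (bessel_weight (- s/2) \<omega> * bessel_weight (s/2) \<omega>) * norm (g \<omega>)"
      unfolding u_def v_def by (simp only: mult_ac)
    then show ?thesis by (simp add: bessel_weight_add norm_mult)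
  qed
  have u0: "u \<omega> \<ge> 0" and v0: "v \<omega> \<ge> 0" for \<omega> by (simp_all add: u_def v_def)
  have u2: "(u \<omega>)\<^sup>2 = (norm (trig_sum S \<alpha> \<omega>))\<^sup>2 * bessel_weight (- s) \<omega>" for \<omega>
    unfolding u_def power_mult_distrib power2_eq_square[of "bessel_weight _ _"] bessel_weight_add by simp
  have v2: "(v \<omega>)\<^sup>2 = bessel_weight s \<omega> * (norm (g \<omega>))\<^sup>2" for \<omega>
    unfolding v_def power_mult_distrib power2_eq_square[of "bessel_weight _ _"] bessel_weight_add by simp
  have [measurable]: "u \<in> borel_measurable borel" "v \<in> borel_measurable borel"
    unfolding u_def[abs_def] v_def[abs_def] by measurable
  have "ennreal (norm (LINT \<omega>|lborel. trig_sum S \<alpha> \<omega> * g \<omega>)) \<le> (\<integral>\<^sup>+\<omega>. ennreal (u \<omega>) * ennreal (v \<omega>) \<partial>lborel)"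
    using integral_norm_bound_ennreal[OF integral_trig_sum_mult(1)[OF g, of S \<alpha>]] u0 v0
    by (simp add: uv[symmetric] ennreal_mult)
  then have "(ennreal (norm (LINT \<omega>|lborel. trig_sum S \<alpha> \<omega> * g \<omega>)))\<^sup>2 \<le> (\<integral>\<^sup>+\<omega>. ennreal (u \<omega>) * ennreal (v \<omega>) \<partial>lborel)\<^sup>2"
    by (intro power_mono) auto
  also have "\<dots> \<le> (\<integral>\<^sup>+\<omega>. (ennreal (u \<omega>))\<^sup>2 \<partial>lborel) * (\<integral>\<^sup>+\<omega>. (ennreal (v \<omega>))\<^sup>2 \<partial>lborel)"
    by (rule Cauchy_Schwarz_nn_integral) measurable
  also have "(\<integral>\<^sup>+\<omega>. (ennreal (u \<omega>))\<^sup>2 \<partial>lborel) = ennreal A"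
    unfolding A_def ennreal_power[OF u0] u2
    by (intro nn_integral_eq_integral integrable_trig_sum_mult integrable_bessel_weight s) auto
  also have "(\<integral>\<^sup>+\<omega>. (ennreal (v \<omega>))\<^sup>2 \<partial>lborel) = ennreal B"
    unfolding B_def ennreal_power[OF v0] v2
    using fin unfolding bessel_finite_def bessel_weight_def[symmetric] by (intro nn_integral_eq_integral) auto
  also have "ennreal A * ennreal B = ennreal (A * B)" by (rule ennreal_mult[OF A B, symmetric])
  finally have "(norm (LINT \<omega>|lborel. trig_sum S \<alpha> \<omega> * g \<omega>))\<^sup>2 \<le> A * B"
    using A B by (subst (asm) ennreal_power) (simp_all add: ennreal_le_iff)
  then have "norm (LINT \<omega>|lborel. trig_sum S \<alpha> \<omega> * g \<omega>) \<le> sqrt (A * B)" by (rule real_le_rsqrt)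
  then show ?thesis
    unfolding A_def B_def bessel_norm_def bessel_weight_def by (simp only: real_sqrt_mult mult.commute)
qed

lemma sobolev_norm_le:
  assumes "sobolev_extension s \<Omega> f F g"
  shows "sobolev_norm s \<Omega> f \<le> bessel_norm s g"
  unfolding sobolev_norm_def
  by (rule cInf_lower) (use assms in \<open>auto intro!: bdd_belowI[of _ 0]\<close>)

lemma sobolev_norm_nonneg:
  assumes "f \<in> sobolev_space s \<Omega>"
  shows "sobolev_norm s \<Omega> f \<ge> 0"
  unfolding sobolev_norm_def by (rule cInf_greatest) (use assms in \<open>auto simp: sobolev_space_def\<close>)

text \<open>Avoids the question whether the quotient norm is attained: a bound for every extension
  passes to the infimum. \<open>K = 0\<close> is apart because the other case divides by
  \<open>K\<close>.\<close>

lemma le_mult_sobolev_norm: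
  assumes f: "f \<in> sobolev_space s \<Omega>" and K: "K \<ge> 0"
    and le: "\<And>F g. sobolev_extension s \<Omega> f F g \<Longrightarrow> r \<le> K * bessel_norm s g"
  shows "r \<le> K * sobolev_norm s \<Omega> f"
proof (cases "K = 0")
  case True
  then show ?thesis using f le by (auto simp: sobolev_space_def)
next
  case False
  with K have K: "K > 0" by simp
  have "r / K \<le> sobolev_norm s \<Omega> f"
    unfolding sobolev_norm_def
    by (rule cInf_greatest)
      (use f le K in \<open>auto simp: sobolev_space_def pos_divide_le_eq mult.commute\<close>)
  then show ?thesis using K by (simp add: pos_divide_le_eq mult.commute)
qed

lemma fourier_integral_cnj_symmetric:
  fixes h :: "'a::euclidean_space \<Rightarrow> complex"
  assumes "\<And>\<omega>. h (- \<omega>) = cnj (h \<omega>)"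
  shows "cnj (fourier_integral h x) = fourier_integral h x"
proof -
  have "fourier_integral h x = (LINT \<omega>|lborel. cis (x \<bullet> - \<omega>) * h (- \<omega>))"
    unfolding fourier_integral_def
    by (subst lborel_integral_affine[of "-1" _ 0]) auto
  also have "\<dots> = (LINT \<omega>|lborel. cnj (cis (x \<bullet> \<omega>) * h \<omega>))"
    by (intro Bochner_Integration.integral_cong refl) (simp add: assms cis_cnj)
  also have "\<dots> = cnj (fourier_integral h x)"
    unfolding fourier_integral_def by (subst Bochner_Integration.integral_cnj) (rule refl)
  finally show ?thesis by simp
qed

text \<open>Up to the factor \<open>fourier_const\<close>, \<open>v\<close> is the Riesz representer
  in the whole-space Sobolev space of the functional that sums point values with weights
  \<open>c\<close>. Its squared norm there is \<open>D\<close>; restriction to \<Omega> does not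
  increase the norm.\<close>

lemma sobolev_dual_element:
  fixes S \<Omega> :: "'a::euclidean_space set" and c :: "'a \<Rightarrow> real"
  assumes u: "u > real DIM('a) / 2"
  defines "D \<equiv> LINT \<omega>|lborel. (norm (trig_sum S (\<lambda>y. complex_of_real (c y)) \<omega>))\<^sup>2 * bessel_weight (- u) \<omega>"
  obtains v where "v \<in> continuous_sobolev_space u \<Omega>" "sobolev_norm u \<Omega> v \<le> sqrt D"
    "(\<Sum>y\<in>S. c y * v y) = fourier_const TYPE('a) * D"
proof -
  let ?N = "fourier_const TYPE('a)"
  let ?P = "trig_sum S (\<lambda>y. complex_of_real (c y))"
  define h where "h \<omega> = cnj (?P \<omega>) * of_real (bessel_weight (- u) \<omega>)" for \<omega>
  define M where "M = (\<Sum>y\<in>S. norm (complex_of_real (c y)))"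
  define v where "v x = ?N * Re (fourier_integral h x)" for x
  have u0: "u > 0" using u by (meson divide_nonneg_nonneg le_less_trans of_nat_0_le_iff zero_le_numeral)
  have [measurable]: "(\<lambda>\<omega>. cnj (?P \<omega>)) \<in> borel_measurable borel"
    by (rule measurable_compose[OF trig_sum_measurable borel_measurable_continuous_onI[OF continuous_on_cnj[OF continuous_on_id]]])
  have [measurable]: "h \<in> borel_measurable borel" unfolding h_def[abs_def] by measurable
  have PM: "norm (?P \<omega>) \<le> M" for \<omega> unfolding M_def by (rule norm_trig_sum_le)
  have nh: "norm (h \<omega>) = norm (?P \<omega>) * bessel_weight (- u) \<omega>" for \<omega>
    by (simp add: h_def norm_mult)
  have wle: "bessel_weight (- u) \<omega> \<le> 1" for \<omega> :: 'a
    unfolding bessel_weight_def using u0 powr_mono2'[of "- u" 1 "1 + (norm \<omega>)\<^sup>2"] by simp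
  have bi: "integrable lborel (bessel_weight (- u) :: 'a \<Rightarrow> real)" by (rule integrable_bessel_weight[OF u])
  have Di: "integrable lborel (\<lambda>\<omega>. (norm (?P \<omega>))\<^sup>2 * bessel_weight (- u) \<omega>)"
    by (rule integrable_trig_sum_mult[OF bi])
  have hi: "integrable lborel h"
  proof (rule Bochner_Integration.integrable_bound)
    show "integrable lborel (\<lambda>\<omega>::'a. M * bessel_weight (- u) \<omega>)" using bi by simp
    show "h \<in> borel_measurable lborel" by simp
    have "norm (h \<omega>) \<le> M * bessel_weight (- u) \<omega>" for \<omega>
      unfolding nh by (rule mult_right_mono[OF PM]) simp
    then show "AE \<omega> in lborel. norm (h \<omega>) \<le> norm (M * bessel_weight (- u) \<omega>)"
      by (intro AE_I2) (metis abs_ge_self order_trans real_norm_def)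
  qed
  have h2: "(norm (h \<omega>))\<^sup>2 \<le> (norm (?P \<omega>))\<^sup>2 * bessel_weight (- u) \<omega>" for \<omega>
  proof -
    have "(norm (h \<omega>))\<^sup>2 = (norm (?P \<omega>))\<^sup>2 * bessel_weight (- u) \<omega> * bessel_weight (- u) \<omega>"
      unfolding nh power_mult_distrib power2_eq_square[of "bessel_weight _ _"] by (simp only: mult.assoc)
    also have "\<dots> \<le> (norm (?P \<omega>))\<^sup>2 * bessel_weight (- u) \<omega> * 1"
      by (intro mult_left_mono wle) simp
    finally show ?thesis by simp
  qed
  have sq: "square_integrable h"
    unfolding square_integrable_def
  proof (intro conjI Bochner_Integration.integrable_bound[OF Di])
    show "AE \<omega> in lborel. norm ((norm (h \<omega>))\<^sup>2) \<le> norm ((norm (?P \<omega>))\<^sup>2 * bessel_weight (- u) \<omega>)"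
      using h2 by (intro AE_I2) simp
  qed simp_all
  have wh: "bessel_weight u \<omega> * (norm (h \<omega>))\<^sup>2 = (norm (?P \<omega>))\<^sup>2 * bessel_weight (- u) \<omega>" for \<omega>
  proof -
    have "bessel_weight u \<omega> * (norm (h \<omega>))\<^sup>2 = (norm (?P \<omega>))\<^sup>2 * bessel_weight (- u) \<omega> * (bessel_weight u \<omega> * bessel_weight (- u) \<omega>)"
      unfolding nh power_mult_distrib power2_eq_square[of "bessel_weight _ _"] by (simp only: mult_ac)
    then show ?thesis by (simp add: bessel_weight_add)
  qed
  have fin: "bessel_finite u h"
    unfolding bessel_finite_def bessel_weight_def[symmetric] wh by (rule Di)
  have bn: "bessel_norm u h = sqrt D"
    unfolding bessel_norm_def bessel_weight_def[symmetric] wh D_def ..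
  have real: "complex_of_real (v x) = ?N *\<^sub>R fourier_integral h x" for x
  proof -
    have "cnj (fourier_integral h x) = fourier_integral h x"
      by (rule fourier_integral_cnj_symmetric) (simp add: h_def trig_sum_def cis_cnj)
    then have "complex_of_real (Re (fourier_integral h x)) = fourier_integral h x"
      by (simp add: complex_eq_iff)
    then show ?thesis by (simp add: v_def scaleR_conv_of_real)
  qed
  have ext: "sobolev_extension u \<Omega> v (\<lambda>x. ?N *\<^sub>R fourier_integral h x) h"
    unfolding sobolev_extension_def using has_fourier_transform_fourier_integral[OF hi sq] fin real by simp
  have "continuous_on \<Omega> v"
    unfolding v_def[abs_def]
    by (intro continuous_intros continuous_on_subset[OF continuous_on_fourier_integral[OF hi]]) simp
  then have 1: "v \<in> continuous_sobolev_space u \<Omega>"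
    using ext unfolding continuous_sobolev_space_def sobolev_space_def by blast
  have 2: "sobolev_norm u \<Omega> v \<le> sqrt D"
    using sobolev_norm_le[OF ext] by (simp only: bn)
  have "complex_of_real (\<Sum>y\<in>S. c y * v y) = (\<Sum>y\<in>S. of_real (c y) * (?N *\<^sub>R fourier_integral h y))"
    by (simp only: of_real_sum of_real_mult real)
  also have "\<dots> = ?N *\<^sub>R (\<Sum>y\<in>S. of_real (c y) * fourier_integral h y)"
    by (simp add: scaleR_sum_right)
  also have "(\<Sum>y\<in>S. of_real (c y) * fourier_integral h y) = (LINT \<omega>|lborel. ?P \<omega> * h \<omega>)"
    by (rule integral_trig_sum_mult(2)[OF hi, symmetric])
  also have "\<dots> = (LINT \<omega>|lborel. complex_of_real ((norm (?P \<omega>))\<^sup>2 * bessel_weight (- u) \<omega>))"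
    unfolding h_def of_real_mult complex_norm_square by (simp only: mult.assoc)
  also have "\<dots> = complex_of_real D" unfolding D_def by (rule integral_complex_of_real)
  also have "?N *\<^sub>R complex_of_real D = complex_of_real (?N * D)" by (simp add: scaleR_conv_of_real)
  finally have 3: "(\<Sum>y\<in>S. c y * v y) = ?N * D" by (simp only: of_real_eq_iff)
  from that[OF 1 2 3] show ?thesis .
qed

context spd_kernel
begin

text \<open>\<open>C\<close> and \<kappa> are fixed before \<open>X\<close>, \<open>f\<close>,
  \<open>c\<close>, \<open>q\<close> and \<open>s\<close>; this order of quantifiers is what later
  makes the constant independent of \<open>n\<close> and \<open>f\<close>.\<close>

lemma kernel_norm_interpolant_le:
  assumes \<Omega>: "compact_lipschitz_region \<Omega>" and nat: "native_space_equivalent_sobolev \<Phi> \<Omega> \<tau>"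
    and b: "real DIM('a) / 2 < \<beta>" and bt: "\<beta> \<le> \<tau>"
  shows "\<exists>C>0. \<exists>\<kappa>>0. \<forall>X f c q s. finite X \<longrightarrow> X \<subseteq> \<Omega> \<longrightarrow> f \<in> continuous_sobolev_space \<beta> \<Omega> \<longrightarrow>
     c \<in> kernel_coeffs X \<longrightarrow> (\<forall>x\<in>X. kernel_sum \<Phi> c x = f x) \<longrightarrow>
     q > 0 \<longrightarrow> s \<ge> 1 \<longrightarrow> s * q \<ge> \<kappa> \<longrightarrow> separated q X \<longrightarrow>
     kernel_norm \<Phi> c \<le> C * s powr (\<tau> - \<beta>) * sobolev_norm \<beta> \<Omega> f"
proof -
  have t: "real DIM('a) / 2 < \<tau>" using b bt by linarith
  obtain C0 \<kappa> where C0: "C0 > 0" and \<kappa>: "\<kappa> > 0" and cmp: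
    "\<And>(S::'a set) \<alpha> q s. \<lbrakk>finite S; q > 0; s \<ge> 1; s * q \<ge> \<kappa>; separated q S\<rbrakk> \<Longrightarrow>
      (LINT \<omega>|lborel. (norm (trig_sum S \<alpha> \<omega>))\<^sup>2 * bessel_weight (- \<beta>) \<omega>) \<le>
      C0 * s powr (2 * (\<tau> - \<beta>)) * (LINT \<omega>|lborel. (norm (trig_sum S \<alpha> \<omega>))\<^sup>2 * bessel_weight (- \<tau>) \<omega>)"
    using trig_sum_bessel_comparison[OF b bt] by blast
  obtain B where B: "B > 0" and nB: "\<And>v. v \<in> native_space \<Phi> \<Omega> \<Longrightarrow> native_norm \<Phi> \<Omega> v \<le> B * sobolev_norm \<tau> \<Omega> v"
    and nsp: "native_space \<Phi> \<Omega> = continuous_sobolev_space \<tau> \<Omega>"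
    using nat unfolding native_space_equivalent_sobolev_def by blast
  have "kernel_norm \<Phi> c \<le> sqrt C0 * B * s powr (\<tau> - \<beta>) * sobolev_norm \<beta> \<Omega> f"
    if X: "finite X" "X \<subseteq> \<Omega>" and f: "f \<in> continuous_sobolev_space \<beta> \<Omega>"
      and c: "c \<in> kernel_coeffs X" and cf: "\<forall>x\<in>X. kernel_sum \<Phi> c x = f x"
      and q: "q > 0" and s: "s \<ge> 1" and sq: "s * q \<ge> \<kappa>"
      and sep: "separated q X" for X f c q s
  proof (rule le_mult_sobolev_norm)
    show "f \<in> sobolev_space \<beta> \<Omega>" using f by (simp add: continuous_sobolev_space_def)
    show "0 \<le> sqrt C0 * B * s powr (\<tau> - \<beta>)" using C0 B by simp
    fix F g assume E: "sobolev_extension \<beta> \<Omega> f F g"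
    let ?N = "fourier_const TYPE('a)"
    let ?P = "trig_sum X (\<lambda>y. complex_of_real (c y))"
    define k where "k = kernel_norm \<Phi> c"
    define A where "A = (LINT \<omega>|lborel. (norm (?P \<omega>))\<^sup>2 * bessel_weight (- \<beta>) \<omega>)"
    define D where "D = (LINT \<omega>|lborel. (norm (?P \<omega>))\<^sup>2 * bessel_weight (- \<tau>) \<omega>)"
    have c': "c \<in> kernel_coeffs \<Omega>" using c kernel_coeffs_mono[OF X(2)] by blast
    have k: "k \<ge> 0" unfolding k_def by (rule kernel_norm_nonneg[OF c])
    have D: "D \<ge> 0" unfolding D_def by (intro integral_nonneg_AE) auto
    have sumX: "(\<Sum>y | c y \<noteq> 0. c y * w y) = (\<Sum>y\<in>X. c y * w y)" for w
      by (rule sum.mono_neutral_left) (use X c in \<open>auto simp: kernel_coeffs_def\<close>)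
    \<comment> \<open>The functional with coefficients \<open>c\<close> takes the value
      \<open>?N * D\<close> on a test element of Sobolev norm at most \<open>sqrt D\<close>, so one
      factor \<open>sqrt D\<close> can be divided out unless it is 0.\<close>
    have "?N * sqrt D \<le> B * k"
    proof -
      obtain v where v: "v \<in> continuous_sobolev_space \<tau> \<Omega>" "sobolev_norm \<tau> \<Omega> v \<le> sqrt D"
        "(\<Sum>y\<in>X. c y * v y) = ?N * D"
        using sobolev_dual_element[OF t, of \<Omega> X c] unfolding D_def by blast
      have vn: "v \<in> native_space \<Phi> \<Omega>" using v(1) nsp by simp
      have "?N * D \<le> k * native_norm \<Phi> \<Omega> v"
        using native_norm_reproducing_le[OF vn c'] unfolding sumX v(3) k_def by linarith
      also have "\<dots> \<le> k * (B * sqrt D)"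
        using nB[OF vn] mult_left_mono[OF v(2), of B] B by (intro mult_left_mono k) linarith
      finally have le: "?N * D \<le> (B * k) * sqrt D" by (simp only: mult_ac)
      show ?thesis
      proof (cases "D = 0")
        case True
        then show ?thesis using B k by simp
      next
        case False
        then have pos: "sqrt D > 0" using D by simp
        have "?N * D = (?N * sqrt D) * sqrt D" using D by (simp add: mult.assoc)
        with le have "(?N * sqrt D) * sqrt D \<le> (B * k) * sqrt D" by (simp only:)
        then show ?thesis using pos by (rule mult_right_le_imp_le)
      qed
    qed
    have ext: "has_fourier_transform F g" "bessel_finite \<beta> g" using E by (auto simp: sobolev_extension_def)
    have g: "integrable lborel g"
      by (rule bessel_finite_imp_integrable[OF _ ext(2) b]) (use ext(1) in \<open>simp add: has_fourier_transform_def\<close>)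
    \<comment> \<open>The squared norm evaluates the interpolant only at its nodes, where it may be
      replaced by the rougher \<open>f\<close>.\<close>
    have "k\<^sup>2 = (\<Sum>y\<in>X. c y * kernel_sum \<Phi> c y)"
      unfolding k_def kernel_norm_power2[OF c] pairing_def sumX ..
    also have "\<dots> = (\<Sum>y\<in>X. c y * f y)" by (intro sum.cong refl) (simp add: cf)
    finally have "complex_of_real (k\<^sup>2) = (\<Sum>y\<in>X. complex_of_real (c y) * complex_of_real (f y))"
      by (simp only: of_real_sum of_real_mult)
    also have "\<dots> = (\<Sum>y\<in>X. complex_of_real (c y) * (?N *\<^sub>R fourier_integral g y))"
      using sobolev_extension_eq_fourier_integral[OF \<Omega> _ E b] f X
      by (intro sum.cong refl) (auto simp: continuous_sobolev_space_def)
    also have "\<dots> = ?N *\<^sub>R (\<Sum>y\<in>X. complex_of_real (c y) * fourier_integral g y)"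
      by (simp add: scaleR_sum_right)
    also have "(\<Sum>y\<in>X. complex_of_real (c y) * fourier_integral g y) = (LINT \<omega>|lborel. ?P \<omega> * g \<omega>)"
      by (rule integral_trig_sum_mult(2)[OF g, symmetric])
    finally have "norm (complex_of_real (k\<^sup>2)) = norm (?N *\<^sub>R (LINT \<omega>|lborel. ?P \<omega> * g \<omega>))" by (rule arg_cong)
    then have "k\<^sup>2 = ?N * norm (LINT \<omega>|lborel. ?P \<omega> * g \<omega>)"
      unfolding norm_of_real norm_scaleR by (simp add: abs_of_pos)
    also have "norm (LINT \<omega>|lborel. ?P \<omega> * g \<omega>) \<le> bessel_norm \<beta> g * sqrt A"
      unfolding A_def by (rule norm_integral_trig_sum_mult_le[OF g ext(2) b])
    finally have 1: "k\<^sup>2 \<le> ?N * (bessel_norm \<beta> g * sqrt A)" by simp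
    have "A \<le> C0 * s powr (2 * (\<tau> - \<beta>)) * D"
      unfolding A_def D_def by (rule cmp[OF X(1) q s sq sep])
    then have "sqrt A \<le> sqrt (C0 * s powr (2 * (\<tau> - \<beta>)) * D)" by (rule real_sqrt_le_mono)
    also have "s powr (2 * (\<tau> - \<beta>)) = (s powr (\<tau> - \<beta>))\<^sup>2"
      by (simp add: power2_eq_square flip: powr_add)
    finally have "sqrt A \<le> sqrt C0 * s powr (\<tau> - \<beta>) * sqrt D"
      by (simp add: real_sqrt_mult)
    then have "?N * (bessel_norm \<beta> g * sqrt A) \<le> ?N * (bessel_norm \<beta> g * (sqrt C0 * s powr (\<tau> - \<beta>) * sqrt D))"
      by (intro mult_left_mono) (auto intro: less_imp_le)
    also have "\<dots> = (bessel_norm \<beta> g * (sqrt C0 * s powr (\<tau> - \<beta>))) * (?N * sqrt D)" by (simp only: mult_ac)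
    also have "\<dots> \<le> (bessel_norm \<beta> g * (sqrt C0 * s powr (\<tau> - \<beta>))) * (B * k)"
      using \<open>?N * sqrt D \<le> B * k\<close> C0 by (intro mult_left_mono) auto
    finally have "k * k \<le> (sqrt C0 * B * s powr (\<tau> - \<beta>) * bessel_norm \<beta> g) * k"
      using 1 by (simp add: power2_eq_square mult_ac)
    then have "k \<le> sqrt C0 * B * s powr (\<tau> - \<beta>) * bessel_norm \<beta> g"
    proof (cases "k = 0")
      case True
      then show ?thesis using C0 B by simp
    next
      case False
      then show ?thesis using k \<open>k * k \<le> _\<close> by (intro mult_right_le_imp_le[of k k]) auto
    qed
    then show "kernel_norm \<Phi> c \<le> sqrt C0 * B * s powr (\<tau> - \<beta>) * bessel_norm \<beta> g" by (simp only: k_def)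
  qed
  note main = this
  have "sqrt C0 * B > 0" using C0 B by simp
  with \<kappa> show ?thesis by (intro exI[of _ "sqrt C0 * B"] exI[of _ \<kappa>] conjI allI impI main)
qed

end

section \<open>Estimates along the sequence of point sets\<close>

lemma separated_of_le_separation_radius:
  assumes "ereal r \<le> separation_radius X"
  shows "separated r X"
  unfolding separated_def
proof (intro ballI impI)
  fix y z assume "y \<in> X" "z \<in> X" "y \<noteq> z"
  then have "separation_radius X \<le> (case (y, z) of (x, y) \<Rightarrow> ereal (dist x y / 2))"
    unfolding separation_radius_def by (intro INF_lower) simp
  from order_trans[OF assms this] show "2 * r \<le> dist y z" by simp
qed

theorem theorem3p3:
  fixes \<Omega> :: "'a::euclidean_space set"
    and \<Phi> :: "'a \<Rightarrow> real"
    and X :: "nat \<Rightarrow> 'a set"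
    and \<tau> \<beta> c0 c0' a :: real
  assumes "compact_lipschitz_region \<Omega>"
    and "radial \<Phi>"
    and "strictly_positive_definite \<Phi>"
    and "continuous_on UNIV \<Phi>"
    and "\<tau> > real DIM('a) / 2"
    and "native_space_equivalent_sobolev \<Phi> \<Omega> \<tau>"
    and "\<And>n. finite (X n)"
    and "\<And>n. X n \<subseteq> \<Omega>"
    and "\<And>n. X n \<subseteq> X (Suc n)"
    and "quasi_uniform X \<Omega>"
    and "c0 > 0" and "c0' > 0" and "0 < a" and "a < 1"
    and "\<And>n. ereal (c0' * a ^ n) \<le> separation_radius (X n)"
    and "\<And>n. separation_radius (X n) \<le> ereal (fill_distance (X n) \<Omega>)"
    and "\<And>n. fill_distance (X n) \<Omega> \<le> c0 * a ^ n"
    and "real DIM('a) / 2 < \<beta>" and "\<beta> \<le> \<tau>"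
  shows "(\<exists>C>0. \<forall>f\<in>continuous_sobolev_space \<beta> \<Omega>. \<forall>n.
            native_norm \<Phi> \<Omega> (\<lambda>x. interpolant \<Phi> (X n) f x - interpolant \<Phi> (X (Suc n)) f x)
              \<le> C * fill_distance (X n) \<Omega> powr (\<beta> - \<tau>) * sobolev_norm \<beta> \<Omega> f)
       \<and> (\<forall>f\<in>continuous_sobolev_space \<beta> \<Omega>. \<exists>C'>0. \<forall>n.
            native_norm \<Phi> \<Omega> (interpolant \<Phi> (X n) f)
              \<le> C' * fill_distance (X n) \<Omega> powr (\<beta> - \<tau>))"
proof -
  interpret spd_kernel \<Phi>
    by unfold_locales (use assms(2,3) in \<open>auto simp: radial_def\<close>)
  note fin = assms(7) and sub = assms(8) and a = assms(13,14) and c0 = assms(11) and c0' = assms(12)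
  obtain C \<kappa> where C: "C > 0" and \<kappa>: "\<kappa> > 0" and bound: "\<And>X f c q s. \<lbrakk>finite X; X \<subseteq> \<Omega>; f \<in> continuous_sobolev_space \<beta> \<Omega>;
     c \<in> kernel_coeffs X; \<forall>x\<in>X. kernel_sum \<Phi> c x = f x; q > 0; s \<ge> 1; s * q \<ge> \<kappa>; separated q X\<rbrakk> \<Longrightarrow>
     kernel_norm \<Phi> c \<le> C * s powr (\<tau> - \<beta>) * sobolev_norm \<beta> \<Omega> f"
    using kernel_norm_interpolant_le[OF assms(1,6,18,19)] by blast
  \<comment> \<open>The scale will be \<open>L / a ^ n\<close> with \<open>q = c0' * a ^ n\<close>:
    \<open>L \<ge> 1\<close> makes the scale at least 1, and \<open>L * c0' \<ge> \<kappa>\<close>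
    is the required bound on their product.\<close>
  define L where "L = max 1 (\<kappa> / c0')"
  \<comment> \<open>Absorbs the passage from \<open>a ^ n\<close> to the fill distance:
    \<open>h n \<le> c0 * a ^ n\<close> gives \<open>L / a ^ n \<le> L * c0 / h n\<close>.\<close>
  define K where "K = C * (L * c0) powr (\<tau> - \<beta>)"
  \<comment> \<open>The factor \<open>(1 / a) powr (\<tau> - \<beta>)\<close> lost between
    consecutive scales.\<close>
  define e where "e = a powr (\<beta> - \<tau>)"
  define h where "h n = fill_distance (X n) \<Omega>" for n
  have L: "L \<ge> 1" "L * c0' \<ge> \<kappa>" using c0' by (auto simp: L_def pos_divide_le_eq[symmetric])
  have K: "K > 0" using C L c0 by (simp add: K_def)
  have e: "e > 0" using a by (simp add: e_def)
  \<comment> \<open>Positivity matters because \<open>0 powr t = 0\<close> for every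
    \<open>t\<close>: at fill distance 0 the claimed bounds would be 0.\<close>
  have h: "h n > 0" "h n \<le> c0 * a ^ n" for n
  proof -
    have "ereal (c0' * a ^ n) \<le> ereal (h n)"
      unfolding h_def by (rule order_trans[OF assms(15,16)])
    moreover have "0 < c0' * a ^ n" using c0' a by simp
    ultimately show "h n > 0" by simp
    show "h n \<le> c0 * a ^ n" unfolding h_def by (rule assms(17))
  qed
  have scale: "C * (L / a ^ n) powr (\<tau> - \<beta>) \<le> K * h n powr (\<beta> - \<tau>)" for n
  proof -
    have "L / a ^ n \<le> L * c0 / h n"
      using h[of n] L(1) a by (simp add: field_simps)
    then have "(L / a ^ n) powr (\<tau> - \<beta>) \<le> (L * c0 / h n) powr (\<tau> - \<beta>)"
      using L(1) a assms(19) by (intro powr_mono2) auto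
    also have "\<dots> = (L * c0) powr (\<tau> - \<beta>) * h n powr (\<beta> - \<tau>)"
      using powr_minus_divide[of "h n" "\<tau> - \<beta>"] by (simp add: powr_divide)
    finally show ?thesis using C by (simp add: K_def mult.assoc)
  qed
  \<comment> \<open>Differences are measured in the fill distance of the coarser set. The second
    bound refers the interpolant on \<open>X (Suc m)\<close> back to \<open>h m\<close> through
    powers of \<open>a\<close>, without comparing two fill distances.\<close>
  have coeffs: "kernel_norm \<Phi> c \<le> K * h n powr (\<beta> - \<tau>) * sobolev_norm \<beta> \<Omega> f"
    "n = Suc m \<Longrightarrow> kernel_norm \<Phi> c \<le> K * e * h m powr (\<beta> - \<tau>) * sobolev_norm \<beta> \<Omega> f"
    if f: "f \<in> continuous_sobolev_space \<beta> \<Omega>" and c: "c \<in> kernel_coeffs (X n)" "\<forall>x\<in>X n. kernel_sum \<Phi> c x = f x"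
    for f c n m
  proof -
    let ?s = "L / a ^ n" and ?q = "c0' * a ^ n"
    have an: "0 < a ^ n" "a ^ n \<le> 1" using a by (auto simp: power_le_one)
    have f0: "sobolev_norm \<beta> \<Omega> f \<ge> 0"
      using f by (intro sobolev_norm_nonneg) (simp add: continuous_sobolev_space_def)
    have "?s \<ge> 1" using L(1) an by (simp add: pos_le_divide_eq)
    moreover have "?s * ?q \<ge> \<kappa>" using L(2) a by simp
    moreover have "?q > 0" using c0' an by simp
    ultimately have k: "kernel_norm \<Phi> c \<le> C * ?s powr (\<tau> - \<beta>) * sobolev_norm \<beta> \<Omega> f"
      using separated_of_le_separation_radius[OF assms(15)[of n]] c(2) by (intro bound[OF fin sub f c(1)]) auto
    also have "\<dots> \<le> K * h n powr (\<beta> - \<tau>) * sobolev_norm \<beta> \<Omega> f"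
      by (rule mult_right_mono[OF scale f0])
    finally show "kernel_norm \<Phi> c \<le> K * h n powr (\<beta> - \<tau>) * sobolev_norm \<beta> \<Omega> f" .
    assume n: "n = Suc m"
    have "C * ?s powr (\<tau> - \<beta>) = e * (C * (L / a ^ m) powr (\<tau> - \<beta>))"
    proof -
      have "?s = (1 / a) * (L / a ^ m)" by (simp add: n)
      then have "?s powr (\<tau> - \<beta>) = (1 / a) powr (\<tau> - \<beta>) * (L / a ^ m) powr (\<tau> - \<beta>)"
        by (simp only: powr_mult)
      also have "(1 / a) powr (\<tau> - \<beta>) = e"
        using powr_minus_divide[of a "\<tau> - \<beta>"] by (simp add: e_def powr_divide)
      finally show ?thesis by (simp only: mult_ac)
    qed
    also have "\<dots> \<le> e * (K * h m powr (\<beta> - \<tau>))"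
      using e by (intro mult_left_mono scale) simp
    finally have "C * ?s powr (\<tau> - \<beta>) \<le> K * e * h m powr (\<beta> - \<tau>)" by (simp only: mult_ac)
    from order_trans[OF k mult_right_mono[OF this f0]]
    show "kernel_norm \<Phi> c \<le> K * e * h m powr (\<beta> - \<tau>) * sobolev_norm \<beta> \<Omega> f" .
  qed
  have diff: "native_norm \<Phi> \<Omega> (\<lambda>x. interpolant \<Phi> (X n) f x - interpolant \<Phi> (X (Suc n)) f x)
        \<le> (K + K * e) * fill_distance (X n) \<Omega> powr (\<beta> - \<tau>) * sobolev_norm \<beta> \<Omega> f"
    if f: "f \<in> continuous_sobolev_space \<beta> \<Omega>" for f n
  proof -
    obtain c where c: "c \<in> kernel_coeffs (X n)" "interpolant \<Phi> (X n) f = kernel_sum \<Phi> c"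
      "\<forall>x\<in>X n. kernel_sum \<Phi> c x = f x"
      using interpolant_eq_kernel_sum[OF fin, of n f] by blast
    obtain d where d: "d \<in> kernel_coeffs (X (Suc n))" "interpolant \<Phi> (X (Suc n)) f = kernel_sum \<Phi> d"
      "\<forall>x\<in>X (Suc n). kernel_sum \<Phi> d x = f x"
      using interpolant_eq_kernel_sum[OF fin, of "Suc n" f] by blast
    have c': "c \<in> kernel_coeffs \<Omega>" and d': "d \<in> kernel_coeffs \<Omega>"
      using c(1) d(1) kernel_coeffs_mono[OF sub] by blast+
    have "native_norm \<Phi> \<Omega> (\<lambda>x. interpolant \<Phi> (X n) f x - interpolant \<Phi> (X (Suc n)) f x) =
        kernel_norm \<Phi> (\<lambda>y. c y - d y)"
      unfolding c(2) d(2) kernel_sum_diff[OF c' d', symmetric]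
      by (rule native_norm_kernel_sum[OF kernel_coeffs_diff[OF c' d']])
    \<comment> \<open>No cancellation between the two interpolants is sought, since both obey the
      same order in \<open>h n\<close>.\<close>
    also have "\<dots> \<le> kernel_norm \<Phi> c + kernel_norm \<Phi> d"
      by (rule kernel_norm_triangle_diff[OF c' d'])
    also have "\<dots> \<le> K * h n powr (\<beta> - \<tau>) * sobolev_norm \<beta> \<Omega> f + K * e * h n powr (\<beta> - \<tau>) * sobolev_norm \<beta> \<Omega> f"
      by (rule add_mono[OF coeffs(1)[OF f c(1,3)] coeffs(2)[OF f d(1,3) refl]])
    finally show ?thesis
      unfolding h_def by (simp only: distrib_right)
  qed
  have single: "\<exists>C'>0. \<forall>n. native_norm \<Phi> \<Omega> (interpolant \<Phi> (X n) f) \<le> C' * fill_distance (X n) \<Omega> powr (\<beta> - \<tau>)"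
    if f: "f \<in> continuous_sobolev_space \<beta> \<Omega>" for f
  proof -
    \<comment> \<open>The added 1 keeps the constant positive when the Sobolev norm of
      \<open>f\<close> is 0.\<close>
    let ?C = "K * (sobolev_norm \<beta> \<Omega> f + 1)"
    have f0: "sobolev_norm \<beta> \<Omega> f \<ge> 0"
      using f by (intro sobolev_norm_nonneg) (simp add: continuous_sobolev_space_def)
    have "native_norm \<Phi> \<Omega> (interpolant \<Phi> (X n) f) \<le> ?C * fill_distance (X n) \<Omega> powr (\<beta> - \<tau>)" for n
    proof -
      obtain c where c: "c \<in> kernel_coeffs (X n)" "interpolant \<Phi> (X n) f = kernel_sum \<Phi> c"
        "\<forall>x\<in>X n. kernel_sum \<Phi> c x = f x"
        using interpolant_eq_kernel_sum[OF fin, of n f] by blast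
      have "native_norm \<Phi> \<Omega> (interpolant \<Phi> (X n) f) = kernel_norm \<Phi> c"
        unfolding c(2) using c(1) kernel_coeffs_mono[OF sub] by (intro native_norm_kernel_sum) blast
      also have "\<dots> \<le> K * h n powr (\<beta> - \<tau>) * sobolev_norm \<beta> \<Omega> f"
        by (rule coeffs(1)[OF f c(1,3)])
      also have "\<dots> \<le> K * h n powr (\<beta> - \<tau>) * (sobolev_norm \<beta> \<Omega> f + 1)"
        using K by (intro mult_left_mono) auto
      finally show ?thesis unfolding h_def by (simp only: mult_ac)
    qed
    moreover have "?C > 0" using K f0 by simp
    ultimately show ?thesis by blast
  qed
  have "K + K * e > 0" using K e by (simp add: add_pos_pos)
  then have "\<exists>C>0. \<forall>f\<in>continuous_sobolev_space \<beta> \<Omega>. \<forall>n.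
      native_norm \<Phi> \<Omega> (\<lambda>x. interpolant \<Phi> (X n) f x - interpolant \<Phi> (X (Suc n)) f x)
        \<le> C * fill_distance (X n) \<Omega> powr (\<beta> - \<tau>) * sobolev_norm \<beta> \<Omega> f"
    by (intro exI[of _ "K + K * e"] conjI ballI allI diff)
  moreover have "\<forall>f\<in>continuous_sobolev_space \<beta> \<Omega>. \<exists>C'>0. \<forall>n.
      native_norm \<Phi> \<Omega> (interpolant \<Phi> (X n) f) \<le> C' * fill_distance (X n) \<Omega> powr (\<beta> - \<tau>)"
    by (intro ballI single)
  ultimately show ?thesis by (rule conjI)
qed

end
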